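(* Let $R\subseteq S$ be an integral FCP t-closed extension of commutative rings. Then $R\subseteq S$ is unramified if and only if $R\subseteq S$ is $\kappa$-separable.
   Context: All rings are commutative and unital. $[R,S]$ is the set of all $R$-subalgebras of $S$; $R\subseteq S$ has FCP if each chain in $[R,S]$ (ordered by inclusion) is finite. $R\subseteq S$ is t-closed if an element $b\in S$ is in $R$ whenever there is some $r\in R$ with $b^2-rb\in R$ and $b^3-rb^2\in R$. For $Q\in\mathrm{Spec}(S)$ the residual extension at $Q$ is $\kappa_R(Q\cap R)\to\kappa_S(Q)$, where $\kappa_R(P)=R_P/PR_P$. An integral extension is $\kappa$-separable if all its residual extensions are separable (algebraic) field extensions. A ring morphism $R\to S$ is unramified if $S$ is of finite type as an $R$-algebra and $\Omega_R(S)=I/I^2=0$, where $I=\ker(S\otimes_RS\to S)$. *)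

theory Defs
  imports "HOL-Algebra.Algebra"
begin

text \<open>
  A ring extension \<open>R \<subseteq> S\<close> is a commutative ring \<open>S\<close> (a record) together with a subring given by
  its carrier set \<open>R\<close>; the ring \<open>R\<close> itself is \<open>S\<lparr>carrier := R\<rparr>\<close>.  The zero ring is allowed.
\<close>

section \<open>Conditions on extensions\<close>

definition subalgs :: "'a set \<Rightarrow> ('a, 'b) ring_scheme \<Rightarrow> 'a set set" where
  "subalgs R S = {T. subring T S \<and> R \<subseteq> T}"

definition FCP :: "'a set \<Rightarrow> ('a, 'b) ring_scheme \<Rightarrow> bool" where
  "FCP R S \<longleftrightarrow> (\<forall>C \<in> chains (subalgs R S). finite C)"

text \<open>
  The list \<open>\<one> # p\<close> holds the coefficients of a monic polynomial of degree \<open>length p\<close>, leading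
  coefficient first.  The carrier of \<^const>\<open>univ_poly\<close> is avoided here because it contains no
  monic polynomial when \<open>S\<close> is the zero ring.
\<close>

definition integral_ext :: "'a set \<Rightarrow> ('a, 'b) ring_scheme \<Rightarrow> bool" where
  "integral_ext R S \<longleftrightarrow>
     (\<forall>x \<in> carrier S. \<exists>p. set p \<subseteq> R \<and> ring.eval S (\<one>\<^bsub>S\<^esub> # p) x = \<zero>\<^bsub>S\<^esub>)"

definition t_closed :: "'a set \<Rightarrow> ('a, 'b) ring_scheme \<Rightarrow> bool" where
  "t_closed R S \<longleftrightarrow>
     (\<forall>b \<in> carrier S.
        (\<exists>r \<in> R. b [^]\<^bsub>S\<^esub> (2::nat) \<ominus>\<^bsub>S\<^esub> r \<otimes>\<^bsub>S\<^esub> b \<in> R \<and>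
                 b [^]\<^bsub>S\<^esub> (3::nat) \<ominus>\<^bsub>S\<^esub> r \<otimes>\<^bsub>S\<^esub> b [^]\<^bsub>S\<^esub> (2::nat) \<in> R) \<longrightarrow> b \<in> R)"


section \<open>Localization at a prime ideal and residue fields\<close>

text \<open>\<open>fraction A P a s\<close> is the class of \<open>a/s\<close> in \<open>A\<^sub>P\<close>.\<close>

definition fraction :: "('a, 'b) ring_scheme \<Rightarrow> 'a set \<Rightarrow> 'a \<Rightarrow> 'a \<Rightarrow> ('a \<times> 'a) set" where
  "fraction A P a s =
     {(b, t). b \<in> carrier A \<and> t \<in> carrier A - P \<and>
              (\<exists>u \<in> carrier A - P. u \<otimes>\<^bsub>A\<^esub> (t \<otimes>\<^bsub>A\<^esub> a) = u \<otimes>\<^bsub>A\<^esub> (s \<otimes>\<^bsub>A\<^esub> b))}"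

definition localization :: "('a, 'b) ring_scheme \<Rightarrow> 'a set \<Rightarrow> ('a \<times> 'a) set ring" where
  "localization A P =
     \<lparr>carrier = {fraction A P a s | a s. a \<in> carrier A \<and> s \<in> carrier A - P},
      monoid.mult = (\<lambda>U V. \<Union>(a, s) \<in> U. \<Union>(b, t) \<in> V. fraction A P (a \<otimes>\<^bsub>A\<^esub> b) (s \<otimes>\<^bsub>A\<^esub> t)),
      one = fraction A P \<one>\<^bsub>A\<^esub> \<one>\<^bsub>A\<^esub>,
      ring.zero = fraction A P \<zero>\<^bsub>A\<^esub> \<one>\<^bsub>A\<^esub>,
      ring.add = (\<lambda>U V. \<Union>(a, s) \<in> U. \<Union>(b, t) \<in> V.
               fraction A P (a \<otimes>\<^bsub>A\<^esub> t \<oplus>\<^bsub>A\<^esub> b \<otimes>\<^bsub>A\<^esub> s) (s \<otimes>\<^bsub>A\<^esub> t))\<rparr>"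

text \<open>The extended ideal \<open>P A\<^sub>P\<close>.\<close>

definition local_ideal :: "('a, 'b) ring_scheme \<Rightarrow> 'a set \<Rightarrow> ('a \<times> 'a) set set" where
  "local_ideal A P = Idl\<^bsub>localization A P\<^esub> ((\<lambda>x. fraction A P x \<one>\<^bsub>A\<^esub>) ` P)"

definition residue_field :: "('a, 'b) ring_scheme \<Rightarrow> 'a set \<Rightarrow> ('a \<times> 'a) set set ring" where
  "residue_field A P = localization A P Quot local_ideal A P"

text \<open>
  The canonical maps \<open>R\<^bsub>Q \<inter> R\<^esub> \<rightarrow> S\<^sub>Q\<close>, \<open>a/s \<mapsto> a/s\<close>, and \<open>\<kappa>\<^sub>R(Q \<inter> R) \<rightarrow> \<kappa>\<^sub>S(Q)\<close>.  As usual
  for maps out of a quotient, the (constant) value is collected over all representatives.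
\<close>

definition local_map :: "('a, 'b) ring_scheme \<Rightarrow> 'a set \<Rightarrow> ('a \<times> 'a) set \<Rightarrow> ('a \<times> 'a) set" where
  "local_map S Q U = (\<Union>(a, s) \<in> U. fraction S Q a s)"

definition residual_map ::
    "('a, 'b) ring_scheme \<Rightarrow> 'a set \<Rightarrow> ('a \<times> 'a) set set \<Rightarrow> ('a \<times> 'a) set set" where
  "residual_map S Q C = (\<Union>U \<in> C. local_ideal S Q +>\<^bsub>localization S Q\<^esub> local_map S Q U)"


section \<open>Separable field extensions\<close>

definition poly_deriv :: "('a, 'b) ring_scheme \<Rightarrow> 'a list \<Rightarrow> 'a list" where
  "poly_deriv L p =
     ring.normalize L (map (\<lambda>i. add_pow L i (ring.coeff L p i)) (rev [1..<length p]))"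

text \<open>\<open>p \<in> K[X]\<close> is coprime in \<open>K[X]\<close> to its derivative.\<close>

definition separable_poly :: "('a, 'b) ring_scheme \<Rightarrow> 'a set \<Rightarrow> 'a list \<Rightarrow> bool" where
  "separable_poly L K p \<longleftrightarrow>
     (\<forall>d \<in> carrier (univ_poly L K).
        d divides\<^bsub>univ_poly L K\<^esub> p \<and> d divides\<^bsub>univ_poly L K\<^esub> poly_deriv L p
        \<longrightarrow> d \<in> Units (univ_poly L K))"

text \<open>\<open>h : F \<rightarrow> L\<close> is a morphism of fields, whose image is the base field inside \<open>L\<close>.\<close>

definition separable_ext ::
    "('f, 'm) ring_scheme \<Rightarrow> ('l, 'n) ring_scheme \<Rightarrow> ('f \<Rightarrow> 'l) \<Rightarrow> bool" where
  "separable_ext F L h \<longleftrightarrow>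
     (let K = h ` carrier F in
      \<forall>x \<in> carrier L. ring.algebraic L K x \<and> separable_poly L K (ring.Irr L K x))"

definition kappa_separable :: "'a set \<Rightarrow> ('a, 'b) ring_scheme \<Rightarrow> bool" where
  "kappa_separable R S \<longleftrightarrow>
     (\<forall>Q. primeideal Q S \<longrightarrow>
        separable_ext (residue_field (S\<lparr>carrier := R\<rparr>) (Q \<inter> R)) (residue_field S Q)
                      (residual_map S Q))"


section \<open>Tensor square, differentials, unramified extensions\<close>

text \<open>
  The free abelian group on \<open>S \<times> S\<close>, with multiplication \<open>(a, b) (c, d) = (a c, b d)\<close> on generators.
\<close>

definition pair_ring :: "('a, 'b) ring_scheme \<Rightarrow> ('a \<times> 'a \<Rightarrow>\<^sub>0 int) ring" where
  "pair_ring S =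
     \<lparr>carrier = {f. Poly_Mapping.keys f \<subseteq> carrier S \<times> carrier S},
      monoid.mult = (\<lambda>f g. frag_extend (\<lambda>(a, b). frag_extend (\<lambda>(c, d).
                frag_of (a \<otimes>\<^bsub>S\<^esub> c, b \<otimes>\<^bsub>S\<^esub> d)) g) f),
      one = frag_of (\<one>\<^bsub>S\<^esub>, \<one>\<^bsub>S\<^esub>),
      ring.zero = 0,
      ring.add = (+)\<rparr>"

definition bilin_rels :: "'a set \<Rightarrow> ('a, 'b) ring_scheme \<Rightarrow> ('a \<times> 'a \<Rightarrow>\<^sub>0 int) set" where
  "bilin_rels R S =
     {frag_of (x \<oplus>\<^bsub>S\<^esub> y, z) - frag_of (x, z) - frag_of (y, z) | x y z.
        x \<in> carrier S \<and> y \<in> carrier S \<and> z \<in> carrier S} \<union>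
     {frag_of (x, y \<oplus>\<^bsub>S\<^esub> z) - frag_of (x, y) - frag_of (x, z) | x y z.
        x \<in> carrier S \<and> y \<in> carrier S \<and> z \<in> carrier S} \<union>
     {frag_of (r \<otimes>\<^bsub>S\<^esub> x, y) - frag_of (x, r \<otimes>\<^bsub>S\<^esub> y) | r x y.
        r \<in> R \<and> x \<in> carrier S \<and> y \<in> carrier S}"

text \<open>
  The ring \<open>S \<otimes>\<^sub>R S\<close>.  The subgroup generated by the bilinearity relations is stable under
  multiplication by generators, so it is the ideal they generate.
\<close>

definition tensor_square :: "'a set \<Rightarrow> ('a, 'b) ring_scheme \<Rightarrow> ('a \<times> 'a \<Rightarrow>\<^sub>0 int) set ring" where
  "tensor_square R S = pair_ring S Quot (Idl\<^bsub>pair_ring S\<^esub> (bilin_rels R S))"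

text \<open>The map \<open>S \<otimes>\<^sub>R S \<rightarrow> S\<close>, \<open>a \<otimes> b \<mapsto> a b\<close>, first on representatives.\<close>

definition pair_mult :: "('a, 'b) ring_scheme \<Rightarrow> ('a \<times> 'a \<Rightarrow>\<^sub>0 int) \<Rightarrow> 'a" where
  "pair_mult S f =
     (\<Oplus>\<^bsub>S\<^esub>p \<in> Poly_Mapping.keys f. add_pow S (Poly_Mapping.lookup f p) (fst p \<otimes>\<^bsub>S\<^esub> snd p))"

definition tensor_mult :: "('a, 'b) ring_scheme \<Rightarrow> ('a \<times> 'a \<Rightarrow>\<^sub>0 int) set \<Rightarrow> 'a" where
  "tensor_mult S U = the_elem (pair_mult S ` U)"

definition diag_ideal :: "'a set \<Rightarrow> ('a, 'b) ring_scheme \<Rightarrow> ('a \<times> 'a \<Rightarrow>\<^sub>0 int) set set" where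
  "diag_ideal R S = a_kernel (tensor_square R S) S (tensor_mult S)"

text \<open>
  \<open>\<Omega>\<^sub>R(S) = I/I\<^sup>2\<close> as an abelian group; its \<open>S\<close>-module structure plays no role for its vanishing.
\<close>

definition kaehler :: "'a set \<Rightarrow> ('a, 'b) ring_scheme \<Rightarrow> ('a \<times> 'a \<Rightarrow>\<^sub>0 int) set set monoid" where
  "kaehler R S =
     (let T = tensor_square R S; I = diag_ideal R S
      in T\<lparr>carrier := I\<rparr> A_Mod ideal_prod T I I)"

definition finite_type :: "'a set \<Rightarrow> ('a, 'b) ring_scheme \<Rightarrow> bool" where
  "finite_type R S \<longleftrightarrow>
     (\<exists>G. finite G \<and> G \<subseteq> carrier S \<and> generate_ring S (R \<union> G) = carrier S)"

definition unramified :: "'a set \<Rightarrow> ('a, 'b) ring_scheme \<Rightarrow> bool" where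
  "unramified R S \<longleftrightarrow>
     finite_type R S \<and> carrier (kaehler R S) = {\<one>\<^bsub>kaehler R S\<^esub>}"

end

theory Submission
  imports Defs
begin

text \<open>
  The structural input is that, for an integral FCP t-closed extension \<open>R \<subseteq> S\<close>, a prime \<open>Q\<close> of \<open>S\<close> and
  \<open>q \<in> Q\<close>, some \<open>e \<in> R - Q\<close> satisfies \<open>e q \<in> R\<close>.  By t-closedness the conductor \<open>C\<close> of \<open>R \<subseteq> R[q]\<close> is
  radical and every idempotent of \<open>R[q]/C\<close> lies in \<open>R/C\<close>; by FCP the chains \<open>R + a\<^sup>n R[q]\<close> are stationary,
  so Nakayama makes \<open>R/C\<close> von Neumann regular, and from \<open>q\<^sup>n \<in> R + q\<^sup>n\<^sup>+\<^sup>1 R[q]\<close> one extracts an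
  idempotent that yields \<open>e\<close>.

  If the residual extensions are separable, a minimal polynomial over \<open>\<kappa>(Q \<inter> R)\<close> gives, after clearing
  denominators, \<open>f \<in> R[X]\<close> with \<open>f(s) \<in> Q\<close> and \<open>f'(s) \<notin> Q\<close>; as \<open>e f(s) \<in> R\<close>, the element \<open>e f'(s) \<notin> Q\<close>
  kills \<open>ds\<close>.  So \<open>\<Omega> = 0\<close>.

  Conversely, let \<open>K \<subseteq> L\<close> be an inseparable residual extension, in characteristic \<open>p\<close>.  Counting dimensions,
  the subfield \<open>M = K L\<^sup>p\<close> is proper, so there is a nonzero \<open>M\<close>-linear functional \<open>\<theta>\<close> on \<open>L\<close> with \<open>\<theta>(1) = 0\<close>.
  The map \<open>a \<otimes> b \<mapsto> a \<theta>(b)\<close> kills an ideal \<open>J\<close> of \<open>S \<otimes>\<^sub>R S\<close> that contains the \<open>p\<close>-th powers of the finitely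
  many generators of the diagonal ideal \<open>I\<close>.  If \<open>I = I\<^sup>2\<close> this forces \<open>I \<subseteq> J\<close>, that is \<open>\<theta> = 0\<close>.
\<close>

section \<open>Finitely generated modules and Nakayama's lemma\<close>

text \<open>The minimal polynomial of a residue class only makes \<open>f(s)\<close> vanish modulo
  \<open>Q\<close>, and the differential of an element of \<open>Q\<close> has no reason to be zero.
  The structural input removes this obstacle: up to a multiplier outside \<open>Q\<close>, each
  element of \<open>Q\<close> already comes from \<open>R\<close>, where \<open>d\<close> vanishes.
  Polynomial and multiplier depend on \<open>Q\<close>; they are glued by observing that the
  annihilator of \<open>ds\<close> is an ideal contained in no prime ideal, so the module of
  differentials is never localized.

  The converse uses a functional rather than a derivation of \<open>L\<close>: Zorn's lemma yields
  an \<open>M\<close>-linear functional at once, whereas a derivation would have to be built from a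
  p-basis. The price is that the resulting map on \<open>S \<otimes> S\<close> is only additive, so
  its kernel has to be replaced by the largest ideal inside it. Finiteness enters twice:
  \<open>S\<close> is of finite type, so only finitely many p-th powers need control, and the
  residue extensions have finite degree, which the dimension count requires.\<close>

lemma FCP_decseq_stable:
  assumes fcp: "FCP A S" and sub: "\<And>n. Y n \<in> subalgs A S" and dec: "\<And>n. Y (Suc n) \<subseteq> Y n"
  shows "\<exists>n::nat. Y (Suc n) = Y n"
proof (rule ccontr)
  assume "\<not> ?thesis"
  then have strict: "Y (Suc n) \<subset> Y n" for n using dec[of n] by blast
  have lt: "Y n \<subset> Y m" if "m < n" for m n
    using that by (induction rule: less_Suc_induct) (use strict in blast)+
  have "inj Y"
    by (rule injI, rule ccontr) (metis lt nat_neq_iff psubset_eq)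
  then have "infinite (range Y)" by (rule range_inj_infinite)
  moreover have "range Y \<in> chains (subalgs A S)"
    unfolding chains_def chain_subset_def using sub lt
    by (auto, metis less_imp_le linorder_cases psubset_imp_subset subsetD)
  ultimately show False using fcp unfolding FCP_def by blast
qed

context cring begin

text \<open>One notion covers ideals (\<open>A\<close> the whole carrier), modules over a subring in
  Nakayama's lemma, and vector subspaces over a subfield. Negation is left out because the scalars
  of a subring include \<open>\<ominus> \<one>\<close>.\<close>

definition submod :: "'a set \<Rightarrow> 'a set \<Rightarrow> bool" where
  "submod A V \<longleftrightarrow> V \<subseteq> carrier R \<and> \<zero> \<in> V \<and> (\<forall>v\<in>V. \<forall>w\<in>V. v \<oplus> w \<in> V) \<and> (\<forall>a\<in>A. \<forall>v\<in>V. a \<otimes> v \<in> V)"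

lemma submodI:
  assumes "V \<subseteq> carrier R" "\<zero> \<in> V" "\<And>v w. v \<in> V \<Longrightarrow> w \<in> V \<Longrightarrow> v \<oplus> w \<in> V"
    "\<And>a v. a \<in> A \<Longrightarrow> v \<in> V \<Longrightarrow> a \<otimes> v \<in> V"
  shows "submod A V"
  using assms unfolding submod_def by simp

lemma submodD:
  assumes "submod A V"
  shows "V \<subseteq> carrier R" "\<zero> \<in> V" "\<And>v w. v \<in> V \<Longrightarrow> w \<in> V \<Longrightarrow> v \<oplus> w \<in> V"
    "\<And>a v. a \<in> A \<Longrightarrow> v \<in> V \<Longrightarrow> a \<otimes> v \<in> V" "\<And>v. v \<in> V \<Longrightarrow> v \<in> carrier R"
  using assms unfolding submod_def by auto

lemma subring_submod:
  assumes "subring A R" shows "submod A A"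
  using subringE[OF assms] unfolding submod_def by auto

lemma submod_minus:
  assumes "subring A R" "submod A V" "v \<in> V" shows "\<ominus> v \<in> V"
proof -
  have "(\<ominus> \<one>) \<otimes> v \<in> V" by (intro submodD(4)[OF assms(2)] subringE(3,5)[OF assms(1)] assms)
  moreover have "(\<ominus> \<one>) \<otimes> v = \<ominus> v" using submodD(5)[OF assms(2,3)] by algebra
  ultimately show ?thesis by simp
qed

lemma submod_ideal:
  assumes J: "submod (carrier R) J" shows "ideal J R"
proof (rule idealI[OF ring_axioms])
  note Js = submodD[OF J]
  show "subgroup J (add_monoid R)"
    by (rule add.subgroupI) (use Js(1,2,3) submod_minus[OF carrier_is_subring J] in auto)
  show "x \<otimes> a \<in> J" "a \<otimes> x \<in> J" if "a \<in> J" "x \<in> carrier R" for a x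
    using Js(4,5) m_comm[of a x] that by auto
qed

lemma ideal_submod: "ideal J R \<Longrightarrow> submod (carrier R) J"
  by (rule submodI) (auto intro: ideal.Icarr ideal.I_l_closed additive_subgroup.zero_closed
      additive_subgroup.a_closed ideal.axioms(1))

text \<open>Provides the upper bounds in two Zorn arguments, one for ideals and one for
  subspaces.\<close>

lemma submod_Union_chain:
  assumes "\<C> \<noteq> {}" and sub: "\<And>V. V \<in> \<C> \<Longrightarrow> submod A V"
    and lin: "\<And>V W. V \<in> \<C> \<Longrightarrow> W \<in> \<C> \<Longrightarrow> V \<subseteq> W \<or> W \<subseteq> V"
  shows "submod A (\<Union>\<C>)"
proof (rule submodI)
  show "\<Union>\<C> \<subseteq> carrier R" using submodD(5)[OF sub] by auto
  obtain V where V: "V \<in> \<C>" using assms(1) by auto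
  show "\<zero> \<in> \<Union>\<C>" using submodD(2)[OF sub[OF V]] V by auto
next
  fix v w assume "v \<in> \<Union>\<C>" "w \<in> \<Union>\<C>"
  then obtain V W where V: "V \<in> \<C>" "v \<in> V" and W: "W \<in> \<C>" "w \<in> W" by auto
  obtain Y where Y: "Y \<in> \<C>" "v \<in> Y" "w \<in> Y" using lin[OF V(1) W(1)] V W by auto
  show "v \<oplus> w \<in> \<Union>\<C>" using submodD(3)[OF sub[OF Y(1)] Y(2,3)] Y(1) by auto
next
  fix a v assume a: "a \<in> A" and "v \<in> \<Union>\<C>"
  then obtain V where V: "V \<in> \<C>" "v \<in> V" by auto
  show "a \<otimes> v \<in> \<Union>\<C>" using submodD(4)[OF sub[OF V(1)] a V(2)] V(1) by auto
qed

lemma Span_Cons_iff: "x \<in> Span A (v # vs) \<longleftrightarrow> (\<exists>k\<in>A. \<exists>w\<in>Span A vs. x = k \<otimes> v \<oplus> w)"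
  by (simp add: line_extension_mem_iff)

lemma line_extension_submod:
  assumes A: "subring A R" and V: "submod A V" and v: "v \<in> carrier R"
  shows "submod A (line_extension A v V)" "V \<subseteq> line_extension A v V" "v \<in> line_extension A v V"
proof -
  note As = subringE[OF A] and Vs = submodD[OF V]
  have Ac: "\<And>a. a \<in> A \<Longrightarrow> a \<in> carrier R" using As(1) by blast
  show sub: "V \<subseteq> line_extension A v V"
  proof
    fix w assume w: "w \<in> V"
    have "w = \<zero> \<otimes> v \<oplus> w" using v Vs(5)[OF w] by simp
    then show "w \<in> line_extension A v V" unfolding line_extension_mem_iff using As(2) w by blast
  qed
  have "v = \<one> \<otimes> v \<oplus> \<zero>" using v by simp
  then show "v \<in> line_extension A v V" unfolding line_extension_mem_iff using As(3) Vs(2) by blast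
  show "submod A (line_extension A v V)"
  proof (rule submodI)
    show "line_extension A v V \<subseteq> carrier R" by (rule line_extension_in_carrier[OF As(1) v Vs(1)])
    show "\<zero> \<in> line_extension A v V" using sub Vs(2) by blast
  next
    fix x y assume "x \<in> line_extension A v V" "y \<in> line_extension A v V"
    then obtain k w l u where *: "k \<in> A" "w \<in> V" "x = k \<otimes> v \<oplus> w" "l \<in> A" "u \<in> V" "y = l \<otimes> v \<oplus> u"
      unfolding line_extension_mem_iff by blast
    have "x \<oplus> y = (k \<oplus> l) \<otimes> v \<oplus> (w \<oplus> u)"
      unfolding *(3,6) using Ac[OF *(1)] Ac[OF *(4)] Vs(5)[OF *(2)] Vs(5)[OF *(5)] v by algebra
    moreover have "k \<oplus> l \<in> A" "w \<oplus> u \<in> V" using As(7) Vs(3) * by auto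
    ultimately show "x \<oplus> y \<in> line_extension A v V" unfolding line_extension_mem_iff by blast
  next
    fix a x assume a: "a \<in> A" and "x \<in> line_extension A v V"
    then obtain k w where *: "k \<in> A" "w \<in> V" "x = k \<otimes> v \<oplus> w" unfolding line_extension_mem_iff by blast
    have "a \<otimes> x = (a \<otimes> k) \<otimes> v \<oplus> (a \<otimes> w)"
      unfolding *(3) using Ac[OF *(1)] Ac[OF a] Vs(5)[OF *(2)] v by algebra
    moreover have "a \<otimes> k \<in> A" "a \<otimes> w \<in> V" using As(6) Vs(4) a * by auto
    ultimately show "a \<otimes> x \<in> line_extension A v V" unfolding line_extension_mem_iff by blast
  qed
qed

lemma Span_submod:
  assumes A: "subring A R" and "set vs \<subseteq> carrier R"
  shows "submod A (Span A vs)"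
  using assms(2)
proof (induction vs)
  case Nil
  then show ?case using subringE(1)[OF A] unfolding submod_def by auto
next
  case (Cons v vs)
  then show ?case using line_extension_submod(1)[OF A, of "Span A vs" v] by simp
qed

lemma Span_scale:
  assumes "A \<subseteq> carrier R" "set vs \<subseteq> carrier R" "z \<in> carrier R"
  shows "Span A (map ((\<otimes>) z) vs) = (\<otimes>) z ` Span A vs"
  using assms(2)
proof (induction vs)
  case (Cons v vs)
  have d: "k \<otimes> (z \<otimes> v) \<oplus> z \<otimes> w = z \<otimes> (k \<otimes> v \<oplus> w)" if "k \<in> A" "w \<in> Span A vs" for k w
  proof -
    have "w \<in> carrier R" using that(2) Span_in_carrier[OF assms(1)] Cons.prems by auto
    then show ?thesis using that(1) assms(1,3) Cons.prems by (simp add: subset_iff r_distr m_lcomm)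
  qed
  have IH: "Span A (map ((\<otimes>) z) vs) = (\<otimes>) z ` Span A vs" using Cons by simp
  have "x \<in> Span A (map ((\<otimes>) z) (v # vs)) \<longleftrightarrow> x \<in> (\<otimes>) z ` Span A (v # vs)" for x
  proof -
    have "x \<in> Span A (map ((\<otimes>) z) (v # vs)) \<longleftrightarrow> (\<exists>k\<in>A. \<exists>w\<in>Span A vs. x = k \<otimes> (z \<otimes> v) \<oplus> z \<otimes> w)"
      unfolding list.map(2) Span_Cons_iff IH by blast
    also have "\<dots> \<longleftrightarrow> (\<exists>k\<in>A. \<exists>w\<in>Span A vs. x = z \<otimes> (k \<otimes> v \<oplus> w))" using d by (intro bex_cong) auto
    also have "\<dots> \<longleftrightarrow> x \<in> (\<otimes>) z ` Span A (v # vs)" unfolding image_iff Bex_def Span_Cons_iff by blast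
    finally show ?thesis .
  qed
  then show ?case by blast
qed (use assms(3) in auto)

lemma nakayama:
  assumes A: "subring A R" and a: "a \<in> A" and U: "submod A U"
    and "set vs \<subseteq> carrier R" "c0 \<in> A"
    and "\<And>x. x \<in> Span A vs \<Longrightarrow> \<exists>u\<in>U. \<exists>y\<in>Span A vs. (\<one> \<ominus> a \<otimes> c0) \<otimes> x = u \<oplus> a \<otimes> y"
  shows "\<exists>c\<in>A. \<forall>x\<in>Span A vs. (\<one> \<ominus> a \<otimes> c) \<otimes> x \<in> U"
  using assms(4-6)
  \<comment> \<open>The generators are eliminated one at a time, so that no determinants are needed.\<close>
proof (induction vs arbitrary: c0)
  case Nil
  then have "\<forall>x\<in>Span A []. (\<one> \<ominus> a \<otimes> c0) \<otimes> x \<in> U"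
    using submodD[OF U] subringE(1)[OF A] a by (auto simp: subset_iff)
  then show ?case using Nil by blast
next
  case (Cons v vs)
  note As = subringE[OF A] and Us = submodD[OF U]
  have v: "v \<in> carrier R" and vs: "set vs \<subseteq> carrier R" using Cons.prems by auto
  note V = submodD[OF Span_submod[OF A vs]]
  have Ac: "\<And>a. a \<in> A \<Longrightarrow> a \<in> carrier R" using As(1) by blast
  have Am: "\<And>x y. x \<in> A \<Longrightarrow> y \<in> A \<Longrightarrow> x \<ominus> y \<in> A" unfolding a_minus_def using As by blast
  note c0 = \<open>c0 \<in> A\<close>
  note ext = line_extension_submod(2,3)[OF A Span_submod[OF A vs] v]
  have sub: "x \<in> Span A (v # vs)" if "x \<in> Span A vs" for x using ext(1) that by auto
  have "v \<in> Span A (v # vs)" using ext(2) by simp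
  from Cons.prems(3)[OF this] obtain u k y0 where 
    uk: "u \<in> U" "k \<in> A" "y0 \<in> Span A vs" "(\<one> \<ominus> a \<otimes> c0) \<otimes> v = u \<oplus> a \<otimes> (k \<otimes> v \<oplus> y0)"
    using Span_Cons_iff by metis
  \<comment> \<open>Moving \<open>a \<otimes> (k \<otimes> v)\<close> to the left-hand side solves
    the relation of \<open>v\<close> for \<open>s' \<otimes> v\<close>. Substituting this in the
    other relations costs a factor \<open>s'\<close>, which is why the hypothesis carries a factor
    \<open>\<one> \<ominus> a \<otimes> c0\<close>: such factors are closed under products, as
    \<open>c1\<close> and \<open>c2\<close> record.\<close>
  define s' where "s' = \<one> \<ominus> a \<otimes> (c0 \<oplus> k)"
  have s': "s' \<in> A" unfolding s'_def by (intro Am As(3,6,7) a c0 uk)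
  have car: "a \<in> carrier R" "c0 \<in> carrier R" "u \<in> carrier R" "k \<in> carrier R" "y0 \<in> carrier R" "s' \<in> carrier R"
    using Ac[OF a] Ac[OF c0] Us(5)[OF uk(1)] Ac[OF uk(2)] V(5)[OF uk(3)] Ac[OF s'] by auto
  have "s' \<otimes> v = (\<one> \<ominus> a \<otimes> c0) \<otimes> v \<ominus> a \<otimes> (k \<otimes> v)"
    unfolding s'_def using car v by algebra
  also have "\<dots> = u \<oplus> a \<otimes> y0" unfolding uk(4) using car v by algebra
  finally have s'v: "s' \<otimes> v = u \<oplus> a \<otimes> y0" .
  define c1 where "c1 = c0 \<oplus> (c0 \<oplus> k) \<ominus> a \<otimes> c0 \<otimes> (c0 \<oplus> k)"
  have c1: "c1 \<in> A" unfolding c1_def by (intro Am As(3,6,7) a c0 uk)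
  have c1s: "\<one> \<ominus> a \<otimes> c1 = s' \<otimes> (\<one> \<ominus> a \<otimes> c0)" unfolding c1_def s'_def using car by algebra
  have "\<exists>u\<in>U. \<exists>y\<in>Span A vs. (\<one> \<ominus> a \<otimes> c1) \<otimes> x = u \<oplus> a \<otimes> y" if x: "x \<in> Span A vs" for x
  proof -
    from Cons.prems(3)[OF sub[OF x]] obtain u1 k1 y1 where 
      1: "u1 \<in> U" "k1 \<in> A" "y1 \<in> Span A vs" "(\<one> \<ominus> a \<otimes> c0) \<otimes> x = u1 \<oplus> a \<otimes> (k1 \<otimes> v \<oplus> y1)"
      using Span_Cons_iff by metis
    have car1: "x \<in> carrier R" "u1 \<in> carrier R" "k1 \<in> carrier R" "y1 \<in> carrier R"
      using V(5)[OF x] Us(5)[OF 1(1)] Ac[OF 1(2)] V(5)[OF 1(3)] by auto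
    have "(\<one> \<ominus> a \<otimes> c1) \<otimes> x = s' \<otimes> ((\<one> \<ominus> a \<otimes> c0) \<otimes> x)"
      unfolding c1s using car car1 by (simp add: m_assoc)
    also have "\<dots> = s' \<otimes> u1 \<oplus> a \<otimes> k1 \<otimes> (s' \<otimes> v) \<oplus> a \<otimes> (s' \<otimes> y1)"
      unfolding 1(4) using car car1 v by algebra
    also have "\<dots> = (s' \<otimes> u1 \<oplus> (a \<otimes> k1) \<otimes> u) \<oplus> a \<otimes> ((k1 \<otimes> a) \<otimes> y0 \<oplus> s' \<otimes> y1)"
      unfolding s'v using car car1 v by algebra
    finally have e: "(\<one> \<ominus> a \<otimes> c1) \<otimes> x = (s' \<otimes> u1 \<oplus> (a \<otimes> k1) \<otimes> u) \<oplus> a \<otimes> ((k1 \<otimes> a) \<otimes> y0 \<oplus> s' \<otimes> y1)" .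
    have "s' \<otimes> u1 \<oplus> (a \<otimes> k1) \<otimes> u \<in> U" by (intro Us(3,4) As(6) 1 uk a s')
    moreover have "(k1 \<otimes> a) \<otimes> y0 \<oplus> s' \<otimes> y1 \<in> Span A vs" by (intro V(3,4) As(6) 1 uk a s')
    ultimately show ?thesis using e by blast
  qed
  from Cons.IH[OF vs c1 this] obtain c where c: "c \<in> A" and cU: "\<And>x. x \<in> Span A vs \<Longrightarrow> (\<one> \<ominus> a \<otimes> c) \<otimes> x \<in> U" by blast
  have cc: "c \<in> carrier R" using Ac c by blast
  define s where "s = \<one> \<ominus> a \<otimes> c"
  have s: "s \<in> A" unfolding s_def by (intro Am As(3,6,7) a c)
  then have sc: "s \<in> carrier R" using Ac by blast
  define c2 where "c2 = c \<oplus> (c0 \<oplus> k) \<ominus> a \<otimes> c \<otimes> (c0 \<oplus> k)"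
  have c2: "c2 \<in> A" unfolding c2_def by (intro Am As(3,6,7) a c c0 uk)
  have c2s: "\<one> \<ominus> a \<otimes> c2 = s' \<otimes> s" unfolding c2_def s'_def s_def using car cc by algebra
  have "(\<one> \<ominus> a \<otimes> c2) \<otimes> x \<in> U" if "x \<in> Span A (v # vs)" for x
  proof -
    from that obtain l y where ly: "l \<in> A" "y \<in> Span A vs" "x = l \<otimes> v \<oplus> y" using Span_Cons_iff by blast
    have car1: "l \<in> carrier R" "y \<in> carrier R" using Ac[OF ly(1)] V(5)[OF ly(2)] by auto
    have "(\<one> \<ominus> a \<otimes> c2) \<otimes> x = (l \<otimes> s) \<otimes> (s' \<otimes> v) \<oplus> s' \<otimes> (s \<otimes> y)"
      unfolding c2s ly(3) using car1 car sc v by algebra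
    also have "\<dots> = (l \<otimes> s) \<otimes> u \<oplus> (l \<otimes> a) \<otimes> (s \<otimes> y0) \<oplus> s' \<otimes> (s \<otimes> y)"
      unfolding s'v using car1 car sc v by algebra
    also have "\<dots> \<in> U"
      by (intro Us(3,4) As(6) ly a s s' uk cU[OF ly(2), folded s_def] cU[OF uk(3), folded s_def])
    finally show ?thesis .
  qed
  then show ?case using c2 by blast
qed

section \<open>Subrings generated by one integral element\<close>

lemma eval_in_Span_exp_base:
  assumes A: "subring A R" and q: "q \<in> carrier R" and "set p \<subseteq> A"
  shows "eval p q \<in> Span A (exp_base q (length p))"
  using assms(3)
proof (induction p)
  case Nil
  then show ?case by (simp add: exp_base_def)
next
  case (Cons k p)
  have "exp_base q (length (k # p)) = q [^] length p # exp_base q (length p)" by (simp add: exp_base_def)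
  moreover have "eval p q \<in> Span A (exp_base q (length p))" "k \<in> A" using Cons by auto
  ultimately show ?case using Span_Cons_iff by fastforce
qed

lemma Span_exp_base_shift:
  assumes A: "subring A R" and q: "q \<in> carrier R" and "x \<in> Span A (exp_base q n)"
  shows "q \<otimes> x \<in> Span A (exp_base q (Suc n))"
  using assms(3)
proof (induction n arbitrary: x)
  case 0
  have *: "\<zero> = \<zero> \<otimes> \<one> \<oplus> \<zero>" by simp
  have e: "exp_base q (Suc 0) = [\<one>]" "exp_base q 0 = []" by (simp_all add: exp_base_def)
  have "q \<otimes> x = \<zero>" using 0 q unfolding e by simp
  moreover have "\<zero> \<in> Span A []" by simp
  ultimately show ?case using * subringE(2)[OF A] unfolding e Span_Cons_iff by metis
next
  case (Suc n)
  have e: "exp_base q (Suc n) = q [^] n # exp_base q n" for n by (simp add: exp_base_def)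
  from Suc.prems obtain k w where *: "k \<in> A" "w \<in> Span A (exp_base q n)" "x = k \<otimes> q [^] n \<oplus> w"
    unfolding e Span_Cons_iff by blast
  have "w \<in> carrier R" using *(2) Span_in_carrier[OF subringE(1)[OF A], of "exp_base q n"] q by (auto simp: exp_base_def)
  then have "q \<otimes> x = k \<otimes> q [^] Suc n \<oplus> q \<otimes> w" unfolding *(3) using q *(1) subringE(1)[OF A]
    by (simp add: subset_iff r_distr m_lcomm m_comm[of q])
  then show ?case unfolding e[of "Suc n"] Span_Cons_iff using *(1) Suc.IH[OF *(2)] by blast
qed

text \<open>The multipliers \<open>W\<close> of the span \<open>V\<close> form a subring containing
  \<open>A\<close> and \<open>q\<close>, hence contain the generated ring; as
  \<open>\<one> \<in> V\<close>, every multiplier lies in \<open>V\<close>. No division of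
  polynomials is involved.\<close>

lemma integral_imp_finitely_generated:
  assumes A: "subring A R" and q: "q \<in> carrier R" and p: "set p \<subseteq> A" "eval (\<one> # p) q = \<zero>"
  shows "generate_ring R (A \<union> {q}) = Span A (exp_base q (length p))"
proof
  define n where "n = length p"
  define V where "V = Span A (exp_base q n)"
  note As = subringE[OF A]
  have eb: "set (exp_base q n) \<subseteq> carrier R" using q by (auto simp: exp_base_def)
  have V: "submod A V" unfolding V_def by (rule Span_submod[OF A eb])
  note Vs = submodD[OF V]
  have Aq: "A \<union> {q} \<subseteq> carrier R" using As q by auto
  have evc: "eval p q \<in> carrier R" using p(1) As(1) q by (intro eval_in_carrier) auto
  have "q [^] n \<oplus> eval p q = \<zero>" using p(2) q unfolding n_def by simp
  then have "q [^] n = \<ominus> eval p q" using q evc by (metis minus_equality nat_pow_closed)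
  then have qn: "q [^] n \<in> V"
    using submod_minus[OF A V] eval_in_Span_exp_base[OF A q p(1)] unfolding V_def n_def by simp
  have shift: "q \<otimes> x \<in> V" if "x \<in> V" for x
  proof -
    have "q \<otimes> x \<in> Span A (q [^] n # exp_base q n)"
      using Span_exp_base_shift[OF A q] that unfolding V_def by (auto simp: exp_base_def)
    then obtain k w where "k \<in> A" "w \<in> V" "q \<otimes> x = k \<otimes> q [^] n \<oplus> w" unfolding Span_Cons_iff V_def by blast
    then show ?thesis using Vs(3,4) qn by simp
  qed
  have one: "\<one> \<in> V"
  proof (cases n)
    \<comment> \<open>With \<open>n = 0\<close> the integral equation reads
      \<open>\<one> = \<zero>\<close>, so the ring is zero and the empty span contains
      \<open>\<one>\<close>.\<close>
    case 0
    then have "\<one> = \<zero>" using p q unfolding n_def by simp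
    then show ?thesis using Vs(2) by simp
  next
    case (Suc m)
    have "eval (replicate m \<zero> @ [\<one>]) q = \<one>" by (induction m) (use q in auto)
    then show ?thesis
      using eval_in_Span_exp_base[OF A q, of "replicate m \<zero> @ [\<one>]"] As(2,3) Suc unfolding V_def
      by (auto simp: set_replicate_conv_if)
  qed
  define W where "W = {z \<in> carrier R. \<forall>x\<in>V. z \<otimes> x \<in> V}"
  have "subring W R"
  proof (rule subringI)
    show "\<one> \<in> W" unfolding W_def using Vs(5) by simp
    show "\<ominus> z \<in> W" if "z \<in> W" for z
      using that submod_minus[OF A V] Vs(5) unfolding W_def by (simp add: l_minus)
    show "z \<otimes> y \<in> W" if "z \<in> W" "y \<in> W" for z y
      using that Vs(5) unfolding W_def by (simp add: m_assoc)
    show "z \<oplus> y \<in> W" if "z \<in> W" "y \<in> W" for z y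
      using that Vs(3,5) unfolding W_def by (simp add: l_distr)
  qed (auto simp: W_def)
  moreover have "A \<union> {q} \<subseteq> W" unfolding W_def using Aq Vs(4) shift by auto
  ultimately have "generate_ring R (A \<union> {q}) \<subseteq> W" by (rule generate_ring_min_subring1[OF Aq])
  moreover have "W \<subseteq> V"
  proof
    fix z assume "z \<in> W"
    then have "z \<otimes> \<one> \<in> V" "z \<in> carrier R" using one unfolding W_def by auto
    then show "z \<in> V" by simp
  qed
  ultimately show "generate_ring R (A \<union> {q}) \<subseteq> Span A (exp_base q (length p))"
    unfolding V_def n_def by blast
  define B where "B = generate_ring R (A \<union> {q})"
  have Bs: "subring B R" unfolding B_def by (rule generate_ring_is_subring[OF Aq])
  note Bs = subringE[OF Bs]
  have AB: "A \<subseteq> B" "q \<in> B" unfolding B_def by (auto intro: generate_ring.incl)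
  have pw: "q [^] i \<in> B" for i :: nat by (induction i) (use Bs(3,6) AB in auto)
  have "Span A (exp_base q k) \<subseteq> B" for k
  proof (induction k)
    case (Suc k)
    have *: "Span A (exp_base q (Suc k)) = Span A (q [^] k # exp_base q k)" by (simp add: exp_base_def)
    show ?case
    proof
      fix x assume "x \<in> Span A (exp_base q (Suc k))"
      then obtain a w where "a \<in> A" "w \<in> Span A (exp_base q k)" "x = a \<otimes> q [^] k \<oplus> w"
        unfolding * Span_Cons_iff by blast
      then show "x \<in> B" using Suc AB pw by (auto intro!: Bs(6,7))
    qed
  qed (use Bs(2) in \<open>simp add: exp_base_def\<close>)
  then show "Span A (exp_base q (length p)) \<subseteq> generate_ring R (A \<union> {q})" unfolding B_def .
qed

end

section \<open>The conductor of an FCP t-closed extension\<close>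

text \<open>\<open>B\<close> will be the ring generated over \<open>A\<close> by one integral
  element: it is a finitely generated \<open>A\<close>-module, as Nakayama's lemma demands, while
  t-closedness and FCP refer to the ambient ring.\<close>

locale t_closed_extension = cring +
  fixes A B
  assumes A: "subring A R" and B: "subring B R" and AB: "A \<subseteq> B" and t_closed: "t_closed A R"
begin

definition conductor :: "'a set" where
  "conductor = {x \<in> B. \<forall>b\<in>B. x \<otimes> b \<in> A}"

lemmas Aprops = subringE[OF A] and Bprops = subringE[OF B]

lemma Acarr: "x \<in> A \<Longrightarrow> x \<in> carrier R" using Aprops(1) by blast
lemma Bcarr: "x \<in> B \<Longrightarrow> x \<in> carrier R" using Bprops(1) by blast
lemma A_in_B: "x \<in> A \<Longrightarrow> x \<in> B" using AB by blast
lemma A_minus: "x \<in> A \<Longrightarrow> y \<in> A \<Longrightarrow> x \<ominus> y \<in> A" unfolding a_minus_def by (intro Aprops(5,7))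
lemma B_pow: "x \<in> B \<Longrightarrow> x [^] (n::nat) \<in> B" by (induction n) (use Bprops(3,6) in auto)

lemma conductor_in_A: "x \<in> conductor \<Longrightarrow> x \<in> A"
  using Bprops(3) Bcarr unfolding conductor_def by force

lemma conductor_mult: "x \<in> conductor \<Longrightarrow> b \<in> B \<Longrightarrow> x \<otimes> b \<in> conductor"
  using Bprops(6) Bcarr unfolding conductor_def by (simp add: m_assoc)

lemma conductor_add: "x \<in> conductor \<Longrightarrow> y \<in> conductor \<Longrightarrow> x \<oplus> y \<in> conductor"
  using Bprops(7) Aprops(7) Bcarr unfolding conductor_def by (simp add: l_distr)

lemma conductor_uminus: "x \<in> conductor \<Longrightarrow> \<ominus> x \<in> conductor"
  using Bprops(5) Aprops(5) Bcarr unfolding conductor_def by (simp add: l_minus)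

lemma conductor_zero: "\<zero> \<in> conductor"
  using Bprops(2) Aprops(2) Bcarr unfolding conductor_def by simp

lemma t_closedD:
  assumes "b \<in> carrier R" "r \<in> A" "b [^] (2::nat) \<ominus> r \<otimes> b \<in> A" "b [^] (3::nat) \<ominus> r \<otimes> b [^] (2::nat) \<in> A"
  shows "b \<in> A"
  using t_closed assms unfolding t_closed_def by blast

lemma pow_2_3: "b \<in> carrier R \<Longrightarrow> b [^] (2::nat) = b \<otimes> b" "b \<in> carrier R \<Longrightarrow> b [^] (3::nat) = b \<otimes> b \<otimes> b"
  by (simp_all add: numeral_2_eq_2 numeral_3_eq_3)

text \<open>This is t-closedness with \<open>r = \<zero>\<close>, tested on
  \<open>x \<otimes> b\<close>: its square and its cube are multiples of
  \<open>x \<otimes> x\<close> by elements of \<open>B\<close>, hence lie in the conductor and so in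
  \<open>A\<close>.\<close>

lemma conductor_square:
  assumes x: "x \<in> B" and xx: "x \<otimes> x \<in> conductor" shows "x \<in> conductor"
  unfolding conductor_def
proof (intro CollectI conjI ballI x)
  fix b assume b: "b \<in> B"
  note car = Bcarr[OF x] Bcarr[OF b]
  have "(x \<otimes> b) [^] (2::nat) \<ominus> \<zero> \<otimes> (x \<otimes> b) = (x \<otimes> x) \<otimes> (b \<otimes> b)"
    unfolding pow_2_3[OF m_closed[OF car]] using car by algebra
  moreover have "(x \<otimes> b) [^] (3::nat) \<ominus> \<zero> \<otimes> (x \<otimes> b) [^] (2::nat) = (x \<otimes> x) \<otimes> (b \<otimes> b \<otimes> (x \<otimes> b))"
    unfolding pow_2_3[OF m_closed[OF car]] using car by algebra
  moreover have "(x \<otimes> x) \<otimes> (b \<otimes> b) \<in> A" "(x \<otimes> x) \<otimes> (b \<otimes> b \<otimes> (x \<otimes> b)) \<in> A"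
    by (intro conductor_in_A conductor_mult xx Bprops(6) x b)+
  ultimately show "x \<otimes> b \<in> A"
    using t_closedD[of "x \<otimes> b" \<zero>] car Aprops(2) by simp
qed

text \<open>The square of \<open>x [^] Suc n\<close> is a multiple of
  \<open>x [^] Suc (Suc n)\<close>, so \<open>conductor_square\<close> lowers the exponent by one at
  a time.\<close>

lemma conductor_radical:
  assumes x: "x \<in> B" shows "x [^] Suc n \<in> conductor \<Longrightarrow> x \<in> conductor"
proof (induction n)
  case 0
  then show ?case using Bcarr[OF x] by simp
next
  case (Suc n)
  have "x [^] Suc n \<otimes> x [^] Suc n = x [^] Suc (Suc n) \<otimes> x [^] n"
    using Bcarr[OF x] by (simp only: nat_pow_mult) simp
  also have "\<dots> \<in> conductor" by (intro conductor_mult Suc.prems B_pow x)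
  finally have "x [^] Suc n \<in> conductor" by (rule conductor_square[OF B_pow[OF x]])
  then show ?case by (rule Suc.IH)
qed

text \<open>This is t-closedness with \<open>r = \<one>\<close>: the two elements to be tested are
  \<open>w \<otimes> w \<ominus> w\<close> and its product with \<open>w\<close>.\<close>

lemma idempotent_mod_conductor:
  assumes w: "w \<in> B" and ww: "w \<otimes> w \<ominus> w \<in> conductor" shows "w \<in> A"
proof -
  have e: "w [^] (2::nat) \<ominus> \<one> \<otimes> w = w \<otimes> w \<ominus> w"
    "w [^] (3::nat) \<ominus> \<one> \<otimes> w [^] (2::nat) = (w \<otimes> w \<ominus> w) \<otimes> w"
    unfolding pow_2_3[OF Bcarr[OF w]] using Bcarr[OF w] by algebra+
  show ?thesis
    by (rule t_closedD[of w \<one>]) (auto simp only: e intro!: Bcarr w Aprops(3) conductor_in_A conductor_mult ww)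
qed

section \<open>Stationary chains and regularity modulo the conductor\<close>

definition add_multiples :: "'a \<Rightarrow> 'a set" where
  "add_multiples z = {r \<oplus> z \<otimes> b | r b. r \<in> A \<and> b \<in> B}"

lemma add_multiples_subalg:
  assumes z: "z \<in> B" shows "add_multiples z \<in> subalgs A R"
  unfolding subalgs_def
proof (intro CollectI conjI subringI)
  show "add_multiples z \<subseteq> carrier R" unfolding add_multiples_def using Acarr Bcarr z by auto
  have "r = r \<oplus> z \<otimes> \<zero>" if "r \<in> A" for r using z Bcarr Acarr that by simp
  then show sub: "A \<subseteq> add_multiples z" unfolding add_multiples_def using Bprops(2) by blast
  then show "\<one> \<in> add_multiples z" using Aprops(3) by blast
  show "\<ominus> x \<in> add_multiples z" if "x \<in> add_multiples z" for x
  proof -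
    from that obtain r b where *: "r \<in> A" "b \<in> B" "x = r \<oplus> z \<otimes> b" unfolding add_multiples_def by blast
    have "\<ominus> x = \<ominus> r \<oplus> z \<otimes> (\<ominus> b)" unfolding *(3) using Acarr[OF *(1)] Bcarr[OF *(2)] Bcarr[OF z] by algebra
    then show ?thesis unfolding add_multiples_def using Aprops(5)[OF *(1)] Bprops(5)[OF *(2)] by blast
  qed
  fix x y assume "x \<in> add_multiples z" "y \<in> add_multiples z"
  then obtain r b s c where *: "r \<in> A" "b \<in> B" "x = r \<oplus> z \<otimes> b" "s \<in> A" "c \<in> B" "y = s \<oplus> z \<otimes> c"
    unfolding add_multiples_def by blast
  note car = Acarr[OF *(1)] Bcarr[OF *(2)] Acarr[OF *(4)] Bcarr[OF *(5)] Bcarr[OF z]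
  have "x \<oplus> y = (r \<oplus> s) \<oplus> z \<otimes> (b \<oplus> c)" unfolding *(3,6) using car by algebra
  then show "x \<oplus> y \<in> add_multiples z"
    unfolding add_multiples_def using Aprops(7)[OF *(1,4)] Bprops(7)[OF *(2,5)] by blast
  have "x \<otimes> y = (r \<otimes> s) \<oplus> z \<otimes> (r \<otimes> c \<oplus> (s \<otimes> b \<oplus> z \<otimes> (b \<otimes> c)))" unfolding *(3,6) using car by algebra
  moreover have "r \<otimes> c \<oplus> (s \<otimes> b \<oplus> z \<otimes> (b \<otimes> c)) \<in> B" by (intro Bprops(6,7) A_in_B * z)
  ultimately show "x \<otimes> y \<in> add_multiples z"
    unfolding add_multiples_def using Aprops(6)[OF *(1,4)] by blast
qed

text \<open>The chain starts at exponent 1, because later uses need a positive exponent: radicality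
  of the conductor is stated for such, and a power of \<open>q\<close> lies in \<open>Q\<close> only
  then.\<close>

lemma add_multiples_stable:
  assumes fcp: "FCP A R" and z: "z \<in> B"
  obtains n where "\<And>b. b \<in> B \<Longrightarrow> \<exists>r\<in>A. \<exists>h\<in>B. z [^] Suc n \<otimes> b = r \<oplus> z [^] Suc (Suc n) \<otimes> h"
proof -
  have "\<exists>n. add_multiples (z [^] Suc (Suc n)) = add_multiples (z [^] Suc n)"
  proof (rule FCP_decseq_stable[OF fcp])
    show "add_multiples (z [^] Suc n) \<in> subalgs A R" for n by (intro add_multiples_subalg B_pow z)
    show "add_multiples (z [^] Suc (Suc n)) \<subseteq> add_multiples (z [^] Suc n)" for n
    proof
      fix x assume "x \<in> add_multiples (z [^] Suc (Suc n))"
      then obtain r b where *: "r \<in> A" "b \<in> B" "x = r \<oplus> z [^] Suc (Suc n) \<otimes> b" unfolding add_multiples_def by blast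
      have "x = r \<oplus> z [^] Suc n \<otimes> (z \<otimes> b)" using * Bcarr[OF z] Bcarr[OF *(2)] by (simp add: m_assoc)
      then show "x \<in> add_multiples (z [^] Suc n)" unfolding add_multiples_def using * Bprops(6)[OF z *(2)] by blast
    qed
  qed
  then obtain n where n: "add_multiples (z [^] Suc (Suc n)) = add_multiples (z [^] Suc n)" by blast
  have "\<exists>r\<in>A. \<exists>h\<in>B. z [^] Suc n \<otimes> b = r \<oplus> z [^] Suc (Suc n) \<otimes> h" if b: "b \<in> B" for b
  proof -
    have "z [^] Suc n \<otimes> b = \<zero> \<oplus> z [^] Suc n \<otimes> b" using Bcarr[OF b] Bcarr[OF z] by simp
    then have "z [^] Suc n \<otimes> b \<in> add_multiples (z [^] Suc n)" unfolding add_multiples_def using b Aprops(2) by blast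
    then show ?thesis unfolding n[symmetric] unfolding add_multiples_def by blast
  qed
  then show ?thesis using that by blast
qed

text \<open>For \<open>z = a [^] Suc n\<close>, stationarity says that the module \<open>zB\<close>
  is contained in \<open>A + a zB\<close>. Nakayama's lemma gives
  \<open>s = \<one> \<ominus> a \<otimes> c\<close> with \<open>s zB\<close> inside
  \<open>A\<close>, that is, \<open>s \<otimes> z\<close> in the conductor, and radicality reduces
  the power of \<open>a\<close> to \<open>a\<close> itself.\<close>

lemma von_Neumann_regular_mod_conductor:
  assumes fcp: "FCP A R" and vs: "set vs \<subseteq> carrier R" and BV: "B = Span A vs" and a: "a \<in> A"
  obtains c where "c \<in> A" "a \<otimes> (\<one> \<ominus> a \<otimes> c) \<in> conductor"
proof -
  have aB: "a \<in> B" using a A_in_B by blast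
  note ac = Acarr[OF a]
  obtain n where n: "\<And>b. b \<in> B \<Longrightarrow> \<exists>r\<in>A. \<exists>h\<in>B. a [^] Suc n \<otimes> b = r \<oplus> a [^] Suc (Suc n) \<otimes> h"
    using add_multiples_stable[OF fcp aB] by blast
  define z where "z = a [^] Suc n"
  have z: "z \<in> B" "z \<in> carrier R" unfolding z_def using B_pow[OF aB] Bcarr by blast+
  let ?ws = "map ((\<otimes>) z) vs"
  have "\<exists>c\<in>A. \<forall>x\<in>Span A ?ws. (\<one> \<ominus> a \<otimes> c) \<otimes> x \<in> A"
  \<comment> \<open>The module is \<open>zB\<close>, spanned by the scaled generators, and
    \<open>A\<close> plays the role of the submodule \<open>U\<close>. The relation carries no
    correction factor yet, hence \<open>c0 = \<zero>\<close>.\<close>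
  proof (rule nakayama[OF A a subring_submod[OF A], of _ \<zero>])
    show "set ?ws \<subseteq> carrier R" using vs z by auto
    show "\<zero> \<in> A" by (rule Aprops)
    fix x assume "x \<in> Span A ?ws"
    then obtain y where y: "y \<in> B" "x = z \<otimes> y" using Span_scale[OF Aprops(1) vs z(2)] BV by auto
    from n[OF y(1)] obtain r h where rh: "r \<in> A" "h \<in> B" "z \<otimes> y = r \<oplus> a [^] Suc (Suc n) \<otimes> h"
      unfolding z_def by blast
    have "a [^] Suc (Suc n) \<otimes> h = a \<otimes> (z \<otimes> h)"
      unfolding z_def using ac Bcarr[OF rh(2)] by (simp add: m_assoc m_lcomm)
    then have "(\<one> \<ominus> a \<otimes> \<zero>) \<otimes> x = r \<oplus> a \<otimes> (z \<otimes> h)"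
      using rh y(2) ac z Bcarr[OF y(1)] Bcarr[OF rh(2)] Acarr[OF rh(1)] by (simp add: a_minus_def)
    moreover have "z \<otimes> h \<in> Span A ?ws" using Span_scale[OF Aprops(1) vs z(2)] rh(2) BV by auto
    ultimately show "\<exists>u\<in>A. \<exists>y\<in>Span A ?ws. (\<one> \<ominus> a \<otimes> \<zero>) \<otimes> x = u \<oplus> a \<otimes> y" using rh(1) by blast
  qed
  then obtain c where c: "c \<in> A" and cA: "\<And>x. x \<in> Span A ?ws \<Longrightarrow> (\<one> \<ominus> a \<otimes> c) \<otimes> x \<in> A" by blast
  define s where "s = \<one> \<ominus> a \<otimes> c"
  have s: "s \<in> A" unfolding s_def by (intro A_minus Aprops(3,6) a c)
  then have sB: "s \<in> B" and sc: "s \<in> carrier R" using A_in_B Acarr by blast+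
  have "s \<otimes> z \<in> conductor" unfolding conductor_def
  proof (intro CollectI conjI ballI)
    show "s \<otimes> z \<in> B" by (intro Bprops(6) sB z)
    fix b assume b: "b \<in> B"
    then have "s \<otimes> (z \<otimes> b) \<in> A" unfolding s_def
      using cA Span_scale[OF Aprops(1) vs z(2)] BV b by auto
    then show "s \<otimes> z \<otimes> b \<in> A" using sc z Bcarr[OF b] by (simp add: m_assoc)
  qed
  \<comment> \<open>The extra factor \<open>s [^] n\<close> completes the element to a full power of
    \<open>a \<otimes> s\<close>, to which radicality applies.\<close>
  then have "s \<otimes> z \<otimes> s [^] n \<in> conductor" by (rule conductor_mult) (intro B_pow sB)
  also have "s \<otimes> z \<otimes> s [^] n = (a \<otimes> s) [^] Suc n"
    unfolding z_def using ac sc by (simp add: nat_pow_distrib m_ac)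
  finally have "a \<otimes> s \<in> conductor" by (rule conductor_radical[OF Bprops(6)[OF aB sB]])
  then show ?thesis using that c unfolding s_def by blast
qed

end

text \<open>Since \<open>e \<otimes> q\<close> lies in \<open>Q\<close> as well as in
  \<open>A\<close>, the meaning is that \<open>Q\<close> is generated by \<open>Q \<inter> A\<close>
  once the elements of \<open>A\<close> outside \<open>Q\<close> are inverted. If the conductor is
  not inside \<open>Q\<close>, any of its elements outside \<open>Q\<close> serves as
  \<open>e\<close>; the work lies in the other case.\<close>

theorem t_closed_FCP_prime:
  fixes S (structure)
  assumes "cring S" and A: "subring A S" and "integral_ext A S" and fcp: "FCP A S" and "t_closed A S"
    and Q: "primeideal Q S" and q: "q \<in> Q"
  obtains e where "e \<in> A" "e \<notin> Q" "e \<otimes> q \<in> A"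
proof -
  interpret cring S by fact
  interpret Q: primeideal Q S by fact
  have qc: "q \<in> carrier S" using q by (rule Q.Icarr)
  obtain p where p: "set p \<subseteq> A" "eval (\<one> # p) q = \<zero>" using assms(3) qc unfolding integral_ext_def by blast
  define B where "B = generate_ring S (A \<union> {q})"
  have Aq: "A \<union> {q} \<subseteq> carrier S" using subringE(1)[OF A] qc by auto
  interpret t_closed_extension S A B
  proof (intro t_closed_extension.intro t_closed_extension_axioms.intro)
    show "subring B S" unfolding B_def by (rule generate_ring_is_subring[OF Aq])
    show "A \<subseteq> B" unfolding B_def by (auto intro: generate_ring.incl)
  qed (fact is_cring A \<open>t_closed A S\<close>)+
  have qB: "q \<in> B" unfolding B_def by (auto intro: generate_ring.incl)
  have BV: "B = Span A (exp_base q (length p))" unfolding B_def by (rule integral_imp_finitely_generated[OF A qc p])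
  have vs: "set (exp_base q (length p)) \<subseteq> carrier S" using qc by (auto simp: exp_base_def)
  show ?thesis
  proof (cases "conductor \<subseteq> Q")
    case False
    then obtain e where e: "e \<in> conductor" "e \<notin> Q" by blast
    then have "e \<otimes> q \<in> A" "e \<in> A" using conductor_in_A conductor_mult qB by blast+
    then show ?thesis using that e by blast
  next
    case True
    obtain n where n: "\<And>b. b \<in> B \<Longrightarrow> \<exists>r\<in>A. \<exists>h\<in>B. q [^] Suc n \<otimes> b = r \<oplus> q [^] Suc (Suc n) \<otimes> h"
      using add_multiples_stable[OF fcp qB] by blast
    \<comment> \<open>Stationarity is applied to \<open>b = \<one>\<close>. Both powers of
      \<open>q\<close> lie in \<open>Q\<close>, so the remainder \<open>r\<close> lies in
      \<open>Q \<inter> A\<close>.\<close>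
    from n[OF Bprops(3)] obtain r h where rh: "r \<in> A" "h \<in> B" "q [^] Suc n = r \<oplus> q [^] Suc (Suc n) \<otimes> h" 
      using qc by auto
    note hc = Bcarr[OF rh(2)] and rc = Acarr[OF rh(1)]
    have qpQ: "q [^] Suc k \<otimes> y \<in> Q" if "y \<in> carrier S" for y k
      using Q.I_l_closed[OF q, of "q [^] k"] Q.I_r_closed that qc by simp
    have "r = q [^] Suc n \<otimes> \<one> \<ominus> q [^] Suc (Suc n) \<otimes> h"
    proof -
      have "q [^] Suc n \<otimes> \<one> \<ominus> q [^] Suc (Suc n) \<otimes> h = (r \<oplus> q [^] Suc (Suc n) \<otimes> h) \<ominus> q [^] Suc (Suc n) \<otimes> h"
        using rh(3) qc by simp
      also have "\<dots> = r" using rc m_closed[OF nat_pow_closed[OF qc, of "Suc (Suc n)"] hc] by algebra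
      finally show ?thesis by simp
    qed
    also have "\<dots> \<in> Q" unfolding a_minus_def by (intro Q.a_closed Q.a_inv_closed qpQ hc one_closed)
    finally have rQ: "r \<in> Q" .
    obtain c where c: "c \<in> A" "r \<otimes> (\<one> \<ominus> r \<otimes> c) \<in> conductor"
      using von_Neumann_regular_mod_conductor[OF fcp vs BV rh(1)] by blast
    note cc = Acarr[OF c(1)]
    \<comment> \<open>Modulo the conductor, \<open>r \<otimes> c\<close> is idempotent by
      regularity, and \<open>e\<close> is the complementary idempotent. It kills \<open>r\<close>,
      and it avoids \<open>Q\<close> because \<open>r \<in> Q\<close>.\<close>
    define e where "e = \<one> \<ominus> r \<otimes> c"
    have e: "e \<in> A" unfolding e_def by (intro A_minus Aprops(3,6) rh c)
    then have eB: "e \<in> B" and ec: "e \<in> carrier S" using A_in_B Acarr by auto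
    have not1: "\<one> \<notin> Q" using Q.I_notcarr Q.one_imp_carrier by auto
    have one_minus: "\<one> \<ominus> x \<notin> Q" if "x \<in> Q" for x
    proof
      assume "\<one> \<ominus> x \<in> Q"
      then have "(\<one> \<ominus> x) \<oplus> x \<in> Q" using that by (rule Q.a_closed)
      moreover have "(\<one> \<ominus> x) \<oplus> x = \<one>" using Q.Icarr[OF that] by algebra
      ultimately show False using not1 by simp
    qed
    have eQ: "e \<notin> Q" unfolding e_def by (intro one_minus Q.I_r_closed rQ cc)
    have er: "e \<otimes> r \<in> conductor" using c(2) ec rc unfolding e_def[symmetric] by (simp add: m_comm)
    have ee: "e \<otimes> e \<ominus> e \<in> conductor"
    proof -
      have "e \<otimes> e \<ominus> e = (e \<otimes> r) \<otimes> (\<ominus> c)" unfolding e_def using rc cc by algebra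
      then show ?thesis using conductor_mult[OF er] c(1) A_in_B Bprops(5) by simp
    qed
    have epow: "e [^] Suc k \<ominus> e \<in> conductor" for k
    proof (induction k)
      case 0
      have "e [^] Suc 0 \<ominus> e = \<zero>" using ec by simp
      then show ?case using conductor_zero by simp
    next
      case (Suc k)
      define z where "z = e [^] Suc k"
      have zc: "z \<in> carrier S" using ec z_def by simp
      have "e [^] Suc (Suc k) \<ominus> e = (z \<ominus> e) \<otimes> e \<oplus> (e \<otimes> e \<ominus> e)"
        unfolding nat_pow_Suc[of _ "Suc k"] z_def[symmetric] using ec zc by algebra
      also have "\<dots> \<in> conductor" by (intro conductor_add conductor_mult ee Suc[folded z_def] eB)
      finally show ?case .
    qed
    \<comment> \<open>Multiplying by \<open>e\<close> removes the remainder \<open>r\<close>: since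
      all positive powers of \<open>e\<close> agree with \<open>e\<close> modulo the conductor, the
      relation for \<open>q\<close> becomes \<open>y [^] N\<close> congruent to
      \<open>y [^] Suc N \<otimes> h\<close>.\<close>
    define y where "y = e \<otimes> q"
    have yB: "y \<in> B" and yc: "y \<in> carrier S" unfolding y_def using Bprops(6) eB qB Bcarr by blast+
    define N where "N = Suc n"
    define cong where "cong a b \<longleftrightarrow> a \<ominus> b \<in> conductor" for a b
    have cong_sym: "cong b a" if "cong a b" "a \<in> carrier S" "b \<in> carrier S" for a b
    proof -
      have "b \<ominus> a = \<ominus> (a \<ominus> b)" using that by algebra
      then show ?thesis using conductor_uminus that unfolding cong_def by simp
    qed
    have cong_trans: "cong a d" if "cong a b" "cong b d" "a \<in> carrier S" "b \<in> carrier S" "d \<in> carrier S" for a b d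
    proof -
      have "a \<ominus> d = (a \<ominus> b) \<oplus> (b \<ominus> d)" using that by algebra
      then show ?thesis using conductor_add that unfolding cong_def by simp
    qed
    have cong_mult: "cong (a \<otimes> x) (b \<otimes> x)" if "cong a b" "a \<in> carrier S" "b \<in> carrier S" "x \<in> B" for a b x
    proof -
      have "a \<otimes> x \<ominus> b \<otimes> x = (a \<ominus> b) \<otimes> x" using that(2,3) Bcarr[OF that(4)] by algebra
      then show ?thesis using conductor_mult that unfolding cong_def by simp
    qed
    have y1: "cong (y [^] N) (y [^] Suc N \<otimes> h)"
    proof -
      have ye: "y [^] k = e [^] k \<otimes> q [^] k" for k :: nat unfolding y_def using ec qc by (rule nat_pow_distrib)
      have ce: "cong (e [^] Suc k \<otimes> x) (e \<otimes> x)" if "x \<in> B" for k x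
        by (rule cong_mult) (use epow ec that in \<open>auto simp: cong_def\<close>)
      have 1: "cong (y [^] N) (e \<otimes> q [^] N)" unfolding ye N_def by (rule ce) (intro B_pow qB)
      have "e \<otimes> q [^] N \<ominus> e \<otimes> (q [^] Suc N \<otimes> h) = e \<otimes> r"
      proof -
        define u where "u = q [^] Suc (Suc n) \<otimes> h"
        have uc: "u \<in> carrier S" unfolding u_def using qc hc by blast
        have "e \<otimes> q [^] N \<ominus> e \<otimes> (q [^] Suc N \<otimes> h) = e \<otimes> (r \<oplus> u) \<ominus> e \<otimes> u"
          unfolding N_def u_def using rh(3) by simp
        also have "\<dots> = e \<otimes> r" using uc ec rc by algebra
        finally show ?thesis .
      qed
      then have 2: "cong (e \<otimes> q [^] N) (e \<otimes> (q [^] Suc N \<otimes> h))" unfolding cong_def using er by simp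
      have "cong (e [^] Suc N \<otimes> (q [^] Suc N \<otimes> h)) (e \<otimes> (q [^] Suc N \<otimes> h))"
        by (rule ce) (intro B_pow qB Bprops(6) rh)
      then have 3: "cong (e \<otimes> (q [^] Suc N \<otimes> h)) (y [^] Suc N \<otimes> h)"
        unfolding ye using ec qc hc cong_sym by (simp add: m_assoc del: nat_pow_Suc)
      show ?thesis
        by (rule cong_trans[OF cong_trans[OF 1 2] 3]) (use ec qc hc yc in auto)
    qed
    have ind: "cong (y [^] N) (y [^] (N + k) \<otimes> h [^] k)" for k
    proof (induction k)
      case 0
      then show ?case using yc conductor_zero unfolding cong_def by (simp add: a_minus_def r_neg)
    next
      case (Suc k)
      have "cong (y [^] N \<otimes> (y [^] k \<otimes> h [^] k)) (y [^] Suc N \<otimes> h \<otimes> (y [^] k \<otimes> h [^] k))"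
        by (rule cong_mult[OF y1]) (use yc hc in \<open>auto intro!: Bprops(6) B_pow yB rh\<close>)
      moreover have "y [^] N \<otimes> (y [^] k \<otimes> h [^] k) = y [^] (N + k) \<otimes> h [^] k"
        using yc hc by (simp add: nat_pow_mult[symmetric] m_assoc)
      moreover have "y [^] Suc N \<otimes> h \<otimes> (y [^] k \<otimes> h [^] k) = y [^] (N + Suc k) \<otimes> h [^] Suc k"
        using yc hc by (simp add: nat_pow_mult[symmetric] m_ac)
      ultimately have "cong (y [^] (N + k) \<otimes> h [^] k) (y [^] (N + Suc k) \<otimes> h [^] Suc k)" by simp
      then show ?case by (rule cong_trans[OF Suc.IH]) (use yc hc in auto)
    qed
    \<comment> \<open>Iterating the relation \<open>N\<close> times gives \<open>y [^] N\<close>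
      congruent to \<open>y [^] N \<otimes> w\<close>; multiplying by \<open>h [^] N\<close> shows
      that \<open>w\<close> is idempotent modulo the conductor. Being a multiple of
      \<open>y\<close>, it also lies in \<open>Q\<close>.\<close>
    define w where "w = y [^] N \<otimes> h [^] N"
    have wB: "w \<in> B" unfolding w_def by (intro Bprops(6) B_pow yB rh)
    note wc = Bcarr[OF wB]
    have yw: "cong (y [^] N) (y [^] N \<otimes> w)"
    proof -
      have "y [^] N \<otimes> w = y [^] (N + N) \<otimes> h [^] N" unfolding w_def using yc hc
        by (simp add: nat_pow_mult[symmetric] m_assoc)
      then show ?thesis using ind[of N] by simp
    qed
    have ww: "cong w (w \<otimes> w)"
    proof -
      have "cong (y [^] N \<otimes> h [^] N) (y [^] N \<otimes> w \<otimes> h [^] N)"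
        by (rule cong_mult[OF yw]) (use yc wc in \<open>auto intro!: B_pow rh\<close>)
      moreover have "y [^] N \<otimes> w \<otimes> h [^] N = w \<otimes> w" unfolding w_def using yc hc by (simp add: m_ac)
      ultimately show ?thesis unfolding w_def by simp
    qed
    have ww': "w \<otimes> w \<ominus> w \<in> conductor" using cong_sym[OF ww] wc unfolding cong_def by simp
    have wA: "w \<in> A" by (rule idempotent_mod_conductor[OF wB ww'])
    have "y \<in> Q" unfolding y_def using q ec by (rule Q.I_l_closed)
    then have "y [^] n \<otimes> y \<in> Q" using yc by (intro Q.I_l_closed) auto
    then have wQ: "w \<in> Q" unfolding w_def N_def using yc hc by (auto intro!: Q.I_r_closed)
    \<comment> \<open>The complement of \<open>w\<close> kills \<open>y [^] N\<close> modulo the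
      conductor. So \<open>e' \<otimes> y\<close> is nilpotent there and, by radicality, lies in the
      conductor itself. The witness sought is \<open>e' \<otimes> e\<close>.\<close>
    define e' where "e' = \<one> \<ominus> w"
    have e': "e' \<in> A" unfolding e'_def by (intro A_minus Aprops(3) wA)
    have e'Q: "e' \<notin> Q" unfolding e'_def by (rule one_minus[OF wQ])
    note e'c = Acarr[OF e'] and e'B = A_in_B[OF e']
    have "e' \<otimes> y [^] N \<in> conductor"
    proof -
      define z where "z = y [^] N"
      have zc: "z \<in> carrier S" unfolding z_def using yc by blast
      have "e' \<otimes> z = z \<ominus> z \<otimes> w" unfolding e'_def using zc wc by algebra
      then show ?thesis using yw unfolding cong_def z_def by simp
    qed
    then have "e' \<otimes> y [^] N \<otimes> e' [^] n \<in> conductor" by (rule conductor_mult) (intro B_pow e'B)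
    also have "e' \<otimes> y [^] N \<otimes> e' [^] n = (e' \<otimes> y) [^] Suc n"
      unfolding N_def using e'c yc by (simp add: nat_pow_distrib m_ac)
    finally have "e' \<otimes> y \<in> conductor" by (rule conductor_radical[OF Bprops(6)[OF e'B yB]])
    then have "e' \<otimes> e \<otimes> q \<in> A" using conductor_in_A e'c ec qc unfolding y_def by (simp add: m_assoc)
    moreover have "e' \<otimes> e \<in> A" using Aprops(6) e' e by blast
    moreover have "e' \<otimes> e \<notin> Q" using Q.I_prime[OF e'c ec] e'Q eQ by blast
    ultimately show ?thesis using that by blast
  qed
qed

section \<open>The tensor square\<close>

lemma frag_extend_pointwise_diff:
  "frag_extend (\<lambda>x. u x - v x) f = frag_extend u f - frag_extend v f"
  using subset_UNIV by (induction f rule: frag_induction) (simp_all add: frag_extend_diff)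

lemma pair_ring_simps:
  "carrier (pair_ring S) = {f. Poly_Mapping.keys f \<subseteq> carrier S \<times> carrier S}"
  "\<one>\<^bsub>pair_ring S\<^esub> = frag_of (\<one>\<^bsub>S\<^esub>, \<one>\<^bsub>S\<^esub>)" "\<zero>\<^bsub>pair_ring S\<^esub> = 0" "f \<oplus>\<^bsub>pair_ring S\<^esub> g = f + g"
  by (simp_all add: pair_ring_def)

lemma pair_ring_mult_of:
  "frag_of (a, b) \<otimes>\<^bsub>pair_ring S\<^esub> frag_of (c, d) = frag_of (a \<otimes>\<^bsub>S\<^esub> c, b \<otimes>\<^bsub>S\<^esub> d)"
  by (simp add: pair_ring_def)

lemma pair_ring_mult_diff:
  "(f - g) \<otimes>\<^bsub>pair_ring S\<^esub> h = f \<otimes>\<^bsub>pair_ring S\<^esub> h - g \<otimes>\<^bsub>pair_ring S\<^esub> h"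
  "h \<otimes>\<^bsub>pair_ring S\<^esub> (f - g) = h \<otimes>\<^bsub>pair_ring S\<^esub> f - h \<otimes>\<^bsub>pair_ring S\<^esub> g"
  by (simp_all add: pair_ring_def frag_extend_diff case_prod_unfold frag_extend_pointwise_diff)

lemma pair_ring_mult_0:
  "0 \<otimes>\<^bsub>pair_ring S\<^esub> h = 0" "h \<otimes>\<^bsub>pair_ring S\<^esub> 0 = 0"
  using pair_ring_mult_diff(1)[where f = 0 and g = 0] pair_ring_mult_diff(2)[where f = 0 and g = 0] by simp_all

text \<open>The closure step is a difference, so a single case reaches integer coefficients of both
  signs.\<close>

lemma pair_ring_induct [consumes 1, case_names zero of diff]:
  assumes "f \<in> carrier (pair_ring S)" and "P 0"
    and "\<And>a b. a \<in> carrier S \<Longrightarrow> b \<in> carrier S \<Longrightarrow> P (frag_of (a, b))"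
    and "\<And>f g. P f \<Longrightarrow> P g \<Longrightarrow> P (f - g)"
  shows "P f"
proof -
  have "Poly_Mapping.keys f \<subseteq> carrier S \<times> carrier S" using assms(1) by (simp add: pair_ring_simps)
  then show ?thesis by (induction rule: frag_induction) (use assms in auto)
qed

lemma pair_ring_of_closed:
  "a \<in> carrier S \<Longrightarrow> b \<in> carrier S \<Longrightarrow> frag_of (a, b) \<in> carrier (pair_ring S)"
  by (simp add: pair_ring_simps)

lemma pair_ring_diff_closed:
  "f \<in> carrier (pair_ring S) \<Longrightarrow> g \<in> carrier (pair_ring S) \<Longrightarrow> f - g \<in> carrier (pair_ring S)"
  unfolding pair_ring_simps using keys_diff[of f g] by blast

lemma (in cring) pair_ring_mult_closed:
  assumes "f \<in> carrier (pair_ring R)" "g \<in> carrier (pair_ring R)"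
  shows "f \<otimes>\<^bsub>pair_ring R\<^esub> g \<in> carrier (pair_ring R)"
  using assms(1)
proof (induction rule: pair_ring_induct)
  case (of a b)
  show ?case using assms(2)
    by (induction rule: pair_ring_induct)
      (use of in \<open>simp_all add: pair_ring_mult_0 pair_ring_mult_of pair_ring_mult_diff pair_ring_of_closed pair_ring_diff_closed\<close>,
       simp add: pair_ring_simps)
qed (simp_all add: pair_ring_mult_0 pair_ring_mult_diff pair_ring_diff_closed, simp add: pair_ring_simps)

text \<open>This is the integral monoid ring of the multiplicative monoid
  \<open>S \<times> S\<close>. The product is biadditive, so each law reduces to generators, where
  it is a law of \<open>S\<close> in both components.\<close>

lemma (in cring) pair_ring_cring: "cring (pair_ring R)"
proof (rule cringI)
  let ?F = "pair_ring R"
  have add: "f + g = f - (0 - g)" for f g :: "'a \<times> 'a \<Rightarrow>\<^sub>0 int" by simp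
  have zero: "0 \<in> carrier ?F" by (simp add: pair_ring_simps)
  have acl: "f + g \<in> carrier ?F" if "f \<in> carrier ?F" "g \<in> carrier ?F" for f g
    unfolding add using that zero by (intro pair_ring_diff_closed)
  show "abelian_group ?F"
  proof (rule abelian_groupI)
    fix f assume "f \<in> carrier ?F"
    then have "0 - f \<in> carrier ?F" using zero by (intro pair_ring_diff_closed)
    then show "\<exists>g\<in>carrier ?F. g \<oplus>\<^bsub>?F\<^esub> f = \<zero>\<^bsub>?F\<^esub>" by (auto simp: pair_ring_simps(3,4) intro: bexI[of _ "0 - f"])
  qed (use acl zero in \<open>simp_all add: pair_ring_simps(3,4) add_ac\<close>)
  show "(f \<oplus>\<^bsub>?F\<^esub> g) \<otimes>\<^bsub>?F\<^esub> h = f \<otimes>\<^bsub>?F\<^esub> h \<oplus>\<^bsub>?F\<^esub> g \<otimes>\<^bsub>?F\<^esub> h" for f g h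
    using pair_ring_mult_diff(1)[where f = "f + g" and g = g and S = R and h = h]
    unfolding pair_ring_simps(4) by simp
  note sim = pair_ring_mult_0 pair_ring_mult_of pair_ring_mult_diff
  have comm: "f \<otimes>\<^bsub>?F\<^esub> g = g \<otimes>\<^bsub>?F\<^esub> f" if f: "f \<in> carrier ?F" and g: "g \<in> carrier ?F" for f g
    using f
  proof (induction rule: pair_ring_induct)
    case (of a b)
    show ?case using g by (induction rule: pair_ring_induct) (use of in \<open>simp_all add: sim m_comm\<close>)
  qed (simp_all add: sim)
  have assoc: "f \<otimes>\<^bsub>?F\<^esub> g \<otimes>\<^bsub>?F\<^esub> h = f \<otimes>\<^bsub>?F\<^esub> (g \<otimes>\<^bsub>?F\<^esub> h)"
    if f: "f \<in> carrier ?F" and g: "g \<in> carrier ?F" and h: "h \<in> carrier ?F" for f g h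
    using f
  proof (induction rule: pair_ring_induct)
    case (of a b)
    note ab = of
    show ?case using g
    proof (induction rule: pair_ring_induct)
      case (of c d)
      show ?case using h by (induction rule: pair_ring_induct) (use ab of in \<open>simp_all add: sim m_assoc\<close>)
    qed (simp_all add: sim)
  qed (simp_all add: sim)
  have one: "\<one>\<^bsub>?F\<^esub> \<otimes>\<^bsub>?F\<^esub> f = f" if "f \<in> carrier ?F" for f
    using that unfolding pair_ring_simps(2) by (induction rule: pair_ring_induct) (simp_all add: sim)
  show "Group.comm_monoid ?F"
    by (rule comm_monoidI)
      (use pair_ring_mult_closed comm assoc one in \<open>auto simp: pair_ring_simps(2) pair_ring_of_closed\<close>)
qed

lemma (in cring) pair_ring_minus:
  assumes "f \<in> carrier (pair_ring R)" "g \<in> carrier (pair_ring R)"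
  shows "f \<ominus>\<^bsub>pair_ring R\<^esub> g = f - g"
proof -
  interpret F: cring "pair_ring R" by (rule pair_ring_cring)
  have "0 - g \<in> carrier (pair_ring R)" using assms by (intro pair_ring_diff_closed) (auto simp: pair_ring_simps)
  then have "\<ominus>\<^bsub>pair_ring R\<^esub> g = 0 - g"
    using assms by (intro F.minus_equality) (auto simp: pair_ring_simps(3,4))
  then show ?thesis by (simp add: a_minus_def pair_ring_simps(4))
qed

section \<open>Additive maps out of the tensor square\<close>

definition pair_extend :: "('g, 'n) ring_scheme \<Rightarrow> ('a \<times> 'a \<Rightarrow> 'g) \<Rightarrow> ('a \<times> 'a \<Rightarrow>\<^sub>0 int) \<Rightarrow> 'g" where
  "pair_extend G \<psi> f = (\<Oplus>\<^bsub>G\<^esub>p \<in> Poly_Mapping.keys f. add_pow G (Poly_Mapping.lookup f p) (\<psi> p))"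

text \<open>Makes the multiplication map one instance of a general construction, of which the map
  \<open>a \<otimes> b \<mapsto> a \<theta>(b)\<close> will be another.\<close>

lemma pair_mult_eq_extend: "pair_mult S = pair_extend S (\<lambda>p. fst p \<otimes>\<^bsub>S\<^esub> snd p)"
  by (simp add: pair_mult_def pair_extend_def fun_eq_iff)

context abelian_group begin

lemma int_add_pow:
  assumes "x \<in> carrier G"
  shows "add_pow G (k::int) x \<in> carrier G" "add_pow G (k + l) x = add_pow G k x \<oplus> add_pow G (l::int) x"
    "add_pow G (0::int) x = \<zero>" "add_pow G (1::int) x = x"
  using group.int_pow_closed[OF a_group, of x k] group.int_pow_mult[OF a_group, of x k l]
    group.int_pow_1[OF a_group, of x] assms
  by (simp_all add: add_pow_def)

lemma pair_extend_superset:
  assumes "\<psi> \<in> Y \<rightarrow> carrier G" "finite Z" "Poly_Mapping.keys f \<subseteq> Z" "Z \<subseteq> Y"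
  shows "pair_extend G \<psi> f = (\<Oplus>p \<in> Z. add_pow G (Poly_Mapping.lookup f p) (\<psi> p))"
  unfolding pair_extend_def
  by (rule add.finprod_mono_neutral_cong_left) (use assms in \<open>auto simp: in_keys_iff Pi_iff subset_iff int_add_pow\<close>)

lemma pair_extend_closed:
  assumes "\<psi> \<in> Y \<rightarrow> carrier G" "Poly_Mapping.keys f \<subseteq> Y"
  shows "pair_extend G \<psi> f \<in> carrier G"
  unfolding pair_extend_def by (rule finsum_closed) (use assms in \<open>auto simp: Pi_iff subset_iff int_add_pow\<close>)

lemma pair_extend_diff:
  fixes \<psi> :: "'c \<times> 'c \<Rightarrow> 'a"
  assumes \<psi>: "\<psi> \<in> Y \<rightarrow> carrier G" and f: "Poly_Mapping.keys f \<subseteq> Y" and g: "Poly_Mapping.keys g \<subseteq> Y"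
  shows "pair_extend G \<psi> (f - g) = pair_extend G \<psi> f \<ominus> pair_extend G \<psi> g"
proof -
  let ?Z = "Poly_Mapping.keys f \<union> Poly_Mapping.keys g"
  let ?s = "\<lambda>(f :: 'c \<times> 'c \<Rightarrow>\<^sub>0 int) p. add_pow G (Poly_Mapping.lookup f p) (\<psi> p)"
  have Z: "finite ?Z" "?Z \<subseteq> Y" using f g by auto
  have cl: "?s h \<in> ?Z \<rightarrow> carrier G" for h 
    by (intro Pi_I int_add_pow(1)) (use \<psi> Z in blast)
  have "pair_extend G \<psi> (f - g) \<oplus> pair_extend G \<psi> g = (\<Oplus>p\<in>?Z. ?s (f - g) p) \<oplus> (\<Oplus>p\<in>?Z. ?s g p)"
    using pair_extend_superset[OF \<psi> Z(1) _ Z(2)] keys_diff[of f g] by simp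
  also have "\<dots> = (\<Oplus>p\<in>?Z. ?s (f - g) p \<oplus> ?s g p)" by (rule finsum_addf[symmetric]) (rule cl)+
  also have "\<dots> = (\<Oplus>p\<in>?Z. ?s f p)"
  proof (rule finsum_cong')
    fix p assume "p \<in> ?Z"
    then have "\<psi> p \<in> carrier G" using \<psi> Z by auto
    then show "?s (f - g) p \<oplus> ?s g p = ?s f p"
      by (simp add: int_add_pow(2)[symmetric] lookup_minus)
  qed (use cl in auto)
  also have "\<dots> = pair_extend G \<psi> f" using pair_extend_superset[OF \<psi> Z(1) _ Z(2)] by simp
  finally have e: "pair_extend G \<psi> f = pair_extend G \<psi> (f - g) \<oplus> pair_extend G \<psi> g" ..
  have "Poly_Mapping.keys (f - g) \<subseteq> Y" using keys_diff[of f g] f g by blast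
  then have "pair_extend G \<psi> (f - g) \<in> carrier G" "pair_extend G \<psi> g \<in> carrier G"
    using pair_extend_closed[OF \<psi>] g by auto
  then show ?thesis unfolding e by (simp add: a_minus_def a_assoc r_neg)
qed

lemma pair_extend_of:
  assumes "\<psi> p \<in> carrier G" shows "pair_extend G \<psi> (frag_of p) = \<psi> p"
  using assms unfolding pair_extend_def by (simp add: int_add_pow)

end

locale tensor_ext = cring S for S (structure) +
  fixes A :: "'a set"
  assumes A: "subring A S"
begin

abbreviation "F \<equiv> pair_ring S"
abbreviation "Z \<equiv> Idl\<^bsub>F\<^esub> (bilin_rels A S)"
abbreviation "T \<equiv> tensor_square A S"
abbreviation "I \<equiv> diag_ideal A S"

sublocale F: cring F by (rule pair_ring_cring)

lemma A_carr: "r \<in> A \<Longrightarrow> r \<in> carrier S"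
  using subringE(1)[OF A] by blast

lemma bilin_rels_closed: "bilin_rels A S \<subseteq> carrier F"
  unfolding bilin_rels_def
  by (auto intro!: pair_ring_diff_closed pair_ring_of_closed dest: A_carr)

sublocale Z: ideal Z F by (rule F.genideal_ideal[OF bilin_rels_closed])

sublocale T: cring T
  unfolding tensor_square_def by (rule Z.quotient_is_cring[OF F.is_cring])

definition coset :: "('a \<times> 'a \<Rightarrow>\<^sub>0 int) \<Rightarrow> ('a \<times> 'a \<Rightarrow>\<^sub>0 int) set" where
  "coset f = Z +>\<^bsub>F\<^esub> f"

lemma coset_hom: "coset \<in> ring_hom F T"
  unfolding tensor_square_def coset_def[abs_def] by (rule Z.rcos_ring_hom)

sublocale coset: ring_hom_cring F T coset
  by (intro ring_hom_cringI F.is_cring T.is_cring coset_hom)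

lemma T_carrierE:
  assumes "t \<in> carrier T" obtains f where "f \<in> carrier F" "t = coset f"
  using assms unfolding tensor_square_def FactRing_def A_RCOSETS_def' coset_def by auto

lemma coset_diff: 
  assumes "f \<in> carrier F" "g \<in> carrier F" shows "coset (f - g) = coset f \<ominus>\<^bsub>T\<^esub> coset g"
proof -
  have "coset (f \<ominus>\<^bsub>F\<^esub> g) = coset f \<ominus>\<^bsub>T\<^esub> coset g" using assms unfolding a_minus_def by simp
  then show ?thesis using pair_ring_minus[OF assms] by simp
qed

lemma coset_eqI:
  assumes "f \<in> carrier F" "g \<in> carrier F" "f - g \<in> Z" shows "coset f = coset g"
  using F.quotient_eq_iff_same_a_r_cos[OF Z.is_ideal assms(1,2)] assms(3) pair_ring_minus[OF assms(1,2)]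
  unfolding coset_def by simp

definition i1 :: "'a \<Rightarrow> ('a \<times> 'a \<Rightarrow>\<^sub>0 int) set" where "i1 s = coset (frag_of (s, \<one>))"
definition i2 :: "'a \<Rightarrow> ('a \<times> 'a \<Rightarrow>\<^sub>0 int) set" where "i2 s = coset (frag_of (\<one>, s))"

lemma rels_in_Z: "bilin_rels A S \<subseteq> Z" by (rule F.genideal_self[OF bilin_rels_closed])

text \<open>Treats the two structure maps of the tensor square together: \<open>\<phi>\<close> is
  either \<open>x \<mapsto> (x, \<one>)\<close> or \<open>x \<mapsto> (\<one>, x)\<close>.\<close>

lemma coset_frag_hom:
  assumes closed: "\<And>x. x \<in> carrier S \<Longrightarrow> frag_of (\<phi> x) \<in> carrier F"
    and mult: "\<And>x y. frag_of (\<phi> x) \<otimes>\<^bsub>F\<^esub> frag_of (\<phi> y) = frag_of (\<phi> (x \<otimes> y))" and one: "\<phi> \<one> = (\<one>, \<one>)"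
    and add: "\<And>x y. x \<in> carrier S \<Longrightarrow> y \<in> carrier S \<Longrightarrow>
      frag_of (\<phi> (x \<oplus> y)) - frag_of (\<phi> x) - frag_of (\<phi> y) \<in> bilin_rels A S"
  shows "(\<lambda>x. coset (frag_of (\<phi> x))) \<in> ring_hom S T"
proof (rule ring_hom_memI)
  fix x y assume xy: "x \<in> carrier S" "y \<in> carrier S"
  show "coset (frag_of (\<phi> x)) \<in> carrier T" using closed xy by simp
  show "coset (frag_of (\<phi> (x \<otimes> y))) = coset (frag_of (\<phi> x)) \<otimes>\<^bsub>T\<^esub> coset (frag_of (\<phi> y))"
    using xy unfolding mult[symmetric] by (simp add: closed)
  have "coset (frag_of (\<phi> (x \<oplus> y))) = coset (frag_of (\<phi> x) \<oplus>\<^bsub>F\<^esub> frag_of (\<phi> y))"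
  proof (rule coset_eqI)
    show "frag_of (\<phi> (x \<oplus> y)) - (frag_of (\<phi> x) \<oplus>\<^bsub>F\<^esub> frag_of (\<phi> y)) \<in> Z"
      using add[OF xy] rels_in_Z by (auto simp: pair_ring_simps(4) diff_diff_eq)
  qed (use xy closed in \<open>auto intro!: F.a_closed\<close>)
  then show "coset (frag_of (\<phi> (x \<oplus> y))) = coset (frag_of (\<phi> x)) \<oplus>\<^bsub>T\<^esub> coset (frag_of (\<phi> y))"
    using xy closed by simp
next
  show "coset (frag_of (\<phi> \<one>)) = \<one>\<^bsub>T\<^esub>" unfolding one using coset.hom_one by (simp add: pair_ring_simps(2))
qed

lemma i1_hom: "i1 \<in> ring_hom S T"
  unfolding i1_def[abs_def]
proof (rule coset_frag_hom)
  show "frag_of (x, \<one>) \<otimes>\<^bsub>F\<^esub> frag_of (y, \<one>) = frag_of (x \<otimes> y, \<one>)" for x y by (simp add: pair_ring_mult_of)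
  show "frag_of (x \<oplus> y, \<one>) - frag_of (x, \<one>) - frag_of (y, \<one>) \<in> bilin_rels A S"
    if "x \<in> carrier S" "y \<in> carrier S" for x y unfolding bilin_rels_def using that by blast
qed (simp_all add: pair_ring_of_closed)

lemma i2_hom: "i2 \<in> ring_hom S T"
  unfolding i2_def[abs_def]
proof (rule coset_frag_hom)
  show "frag_of (\<one>, x) \<otimes>\<^bsub>F\<^esub> frag_of (\<one>, y) = frag_of (\<one>, x \<otimes> y)" for x y by (simp add: pair_ring_mult_of)
  show "frag_of (\<one>, x \<oplus> y) - frag_of (\<one>, x) - frag_of (\<one>, y) \<in> bilin_rels A S"
    if "x \<in> carrier S" "y \<in> carrier S" for x y unfolding bilin_rels_def using that by blast
qed (simp_all add: pair_ring_of_closed)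

sublocale i1: ring_hom_cring S T i1 by (intro ring_hom_cringI is_cring T.is_cring i1_hom)
sublocale i2: ring_hom_cring S T i2 by (intro ring_hom_cringI is_cring T.is_cring i2_hom)

lemma i1_i2_base: "r \<in> A \<Longrightarrow> i1 r = i2 r"
proof -
  assume r: "r \<in> A"
  have "frag_of (r \<otimes> \<one>, \<one>) - frag_of (\<one>, r \<otimes> \<one>) \<in> bilin_rels A S"
    unfolding bilin_rels_def using r by blast
  then have "frag_of (r, \<one>) - frag_of (\<one>, r) \<in> Z" using rels_in_Z A_carr[OF r] by auto
  then show ?thesis unfolding i1_def i2_def using A_carr[OF r] by (intro coset_eqI pair_ring_of_closed) auto
qed

lemma coset_of: "a \<in> carrier S \<Longrightarrow> b \<in> carrier S \<Longrightarrow> coset (frag_of (a, b)) = i1 a \<otimes>\<^bsub>T\<^esub> i2 b"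
proof -
  assume ab: "a \<in> carrier S" "b \<in> carrier S"
  have "coset (frag_of (a, \<one>) \<otimes>\<^bsub>F\<^esub> frag_of (\<one>, b)) = i1 a \<otimes>\<^bsub>T\<^esub> i2 b"
    unfolding i1_def i2_def using ab by (simp add: pair_ring_of_closed)
  then show ?thesis using ab by (simp add: pair_ring_mult_of)
qed

lemma T_induct [consumes 1, case_names zero tensor minus]:
  assumes "t \<in> carrier T" and "P \<zero>\<^bsub>T\<^esub>"
    and tens: "\<And>a b. a \<in> carrier S \<Longrightarrow> b \<in> carrier S \<Longrightarrow> P (i1 a \<otimes>\<^bsub>T\<^esub> i2 b)"
    and minus: "\<And>x y. x \<in> carrier T \<Longrightarrow> y \<in> carrier T \<Longrightarrow> P x \<Longrightarrow> P y \<Longrightarrow> P (x \<ominus>\<^bsub>T\<^esub> y)"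
  shows "P t"
proof -
  obtain f where f: "f \<in> carrier F" "t = coset f" using T_carrierE[OF assms(1)] .
  have "f \<in> carrier F \<and> P (coset f)" using f(1)
  proof (induction rule: pair_ring_induct)
    case zero
    then show ?case using coset.hom_zero assms(2) by (simp add: pair_ring_simps)
  next
    case (of a b)
    then show ?case using tens coset_of pair_ring_of_closed by simp
  next
    case (diff f g)
    then have "f - g \<in> carrier F" by (intro pair_ring_diff_closed) auto
    then show ?case using diff coset_diff minus by simp
  qed
  then show ?thesis using f by simp
qed

definition lift :: "('g, 'n) ring_scheme \<Rightarrow> ('a \<times> 'a \<Rightarrow> 'g) \<Rightarrow> ('a \<times> 'a \<Rightarrow>\<^sub>0 int) set \<Rightarrow> 'g" where
  "lift G \<psi> U = the_elem (pair_extend G \<psi> ` U)"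

end

text \<open>The universal property of \<open>S \<otimes> S\<close> as an abelian group. No
  multiplicativity is asked of \<open>\<psi>\<close>, because the map built from a functional is not
  multiplicative; the multiplication map is shown to be a ring homomorphism separately.\<close>

locale balanced_map = tensor_ext S A + G: abelian_group G 
  for S (structure) and A and G :: "('g, 'n) ring_scheme" +
  fixes \<psi> :: "'a \<times> 'a \<Rightarrow> 'g"
  assumes closed: "\<And>x y. x \<in> carrier S \<Longrightarrow> y \<in> carrier S \<Longrightarrow> \<psi> (x, y) \<in> carrier G"
    and add_l: "\<And>x y z. x \<in> carrier S \<Longrightarrow> y \<in> carrier S \<Longrightarrow> z \<in> carrier S \<Longrightarrow> \<psi> (x \<oplus> y, z) = \<psi> (x, z) \<oplus>\<^bsub>G\<^esub> \<psi> (y, z)"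
    and add_r: "\<And>x y z. x \<in> carrier S \<Longrightarrow> y \<in> carrier S \<Longrightarrow> z \<in> carrier S \<Longrightarrow> \<psi> (x, y \<oplus> z) = \<psi> (x, y) \<oplus>\<^bsub>G\<^esub> \<psi> (x, z)"
    and balanced: "\<And>r x y. r \<in> A \<Longrightarrow> x \<in> carrier S \<Longrightarrow> y \<in> carrier S \<Longrightarrow> \<psi> (r \<otimes> x, y) = \<psi> (x, r \<otimes> y)"
begin

abbreviation "E \<equiv> pair_extend G \<psi>"

lemma psi_fun: "\<psi> \<in> carrier S \<times> carrier S \<rightarrow> carrier G"
  using closed by auto

lemma E_closed: "f \<in> carrier F \<Longrightarrow> E f \<in> carrier G"
  using G.pair_extend_closed[OF psi_fun] by (simp add: pair_ring_simps)

lemma E_diff: "f \<in> carrier F \<Longrightarrow> g \<in> carrier F \<Longrightarrow> E (f - g) = E f \<ominus>\<^bsub>G\<^esub> E g"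
  using G.pair_extend_diff[OF psi_fun] by (simp add: pair_ring_simps)

lemma E_of: "a \<in> carrier S \<Longrightarrow> b \<in> carrier S \<Longrightarrow> E (frag_of (a, b)) = \<psi> (a, b)"
  using closed by (simp add: G.pair_extend_of)

lemma E_zero: "E 0 = \<zero>\<^bsub>G\<^esub>"
  by (simp add: pair_extend_def)

lemma minus_eq_zero: "x \<in> carrier G \<Longrightarrow> y \<in> carrier G \<Longrightarrow> x = y \<Longrightarrow> x \<ominus>\<^bsub>G\<^esub> y = \<zero>\<^bsub>G\<^esub>"
  by (simp add: a_minus_def G.r_neg)

lemma minus_minus_zero: "x \<in> carrier G \<Longrightarrow> y \<in> carrier G \<Longrightarrow> x \<oplus>\<^bsub>G\<^esub> y \<ominus>\<^bsub>G\<^esub> x \<ominus>\<^bsub>G\<^esub> y = \<zero>\<^bsub>G\<^esub>"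
  by (simp add: a_minus_def G.a_assoc G.a_comm[of y] G.r_neg)

text \<open>Multiplication by the generator \<open>(c, d)\<close> turns each relation into a
  relation of the same kind between scaled elements, which \<open>\<psi>\<close> respects.\<close>

lemma E_rels:
  assumes "r \<in> bilin_rels A S" "c \<in> carrier S" "d \<in> carrier S"
  shows "E (frag_of (c, d) \<otimes>\<^bsub>F\<^esub> r) = \<zero>\<^bsub>G\<^esub>"
  using assms(1) unfolding bilin_rels_def
proof (elim UnE CollectE exE conjE)
  note ds = E_diff E_of closed pair_ring_of_closed pair_ring_diff_closed pair_ring_mult_diff pair_ring_mult_of
  {
    fix x y z assume xyz: "x \<in> carrier S" "y \<in> carrier S" "z \<in> carrier S"
      and r: "r = frag_of (x \<oplus> y, z) - frag_of (x, z) - frag_of (y, z)"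
    have "\<psi> (c \<otimes> (x \<oplus> y), d \<otimes> z) = \<psi> (c \<otimes> x, d \<otimes> z) \<oplus>\<^bsub>G\<^esub> \<psi> (c \<otimes> y, d \<otimes> z)"
      using add_l[of "c \<otimes> x" "c \<otimes> y" "d \<otimes> z"] xyz assms(2,3) by (simp add: r_distr)
    then show ?thesis
      unfolding r using xyz assms(2,3) by (simp add: ds minus_minus_zero)
  next
    fix x y z assume xyz: "x \<in> carrier S" "y \<in> carrier S" "z \<in> carrier S"
      and r: "r = frag_of (x, y \<oplus> z) - frag_of (x, y) - frag_of (x, z)"
    have "\<psi> (c \<otimes> x, d \<otimes> (y \<oplus> z)) = \<psi> (c \<otimes> x, d \<otimes> y) \<oplus>\<^bsub>G\<^esub> \<psi> (c \<otimes> x, d \<otimes> z)"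
      using add_r[of "c \<otimes> x" "d \<otimes> y" "d \<otimes> z"] xyz assms(2,3) by (simp add: r_distr)
    then show ?thesis
      unfolding r using xyz assms(2,3) by (simp add: ds minus_minus_zero)
  next
    fix s x y assume xyz: "s \<in> A" "x \<in> carrier S" "y \<in> carrier S"
      and r: "r = frag_of (s \<otimes> x, y) - frag_of (x, s \<otimes> y)"
    have "\<psi> (c \<otimes> (s \<otimes> x), d \<otimes> y) = \<psi> (c \<otimes> x, d \<otimes> (s \<otimes> y))"
      using balanced[of s "c \<otimes> x" "d \<otimes> y"] xyz A_carr assms(2,3) by (simp add: m_lcomm)
    then show ?thesis
      unfolding r using xyz assms(2,3) A_carr by (simp add: ds minus_eq_zero)
  }
qed

lemma E_Z:
  assumes "f \<in> Z" shows "E f = \<zero>\<^bsub>G\<^esub>"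
proof -
  \<comment> \<open>The kernel of \<open>E\<close> is not visibly an ideal, so pass to the largest ideal inside it.\<close>
  define J where "J = {f \<in> carrier F. \<forall>g\<in>carrier F. E (g \<otimes>\<^bsub>F\<^esub> f) = \<zero>\<^bsub>G\<^esub>}"
  have "ideal J F"
  proof (intro F.submod_ideal F.submodI)
    show "J \<subseteq> carrier F" unfolding J_def by auto
    show "\<zero>\<^bsub>F\<^esub> \<in> J" unfolding J_def pair_ring_simps(3) by (auto simp: pair_ring_mult_0 E_zero) (simp add: pair_ring_simps)
    show "f \<oplus>\<^bsub>F\<^esub> g \<in> J" if "f \<in> J" "g \<in> J" for f g
    proof -
      have fg: "f \<in> carrier F" "g \<in> carrier F" using that unfolding J_def by auto
      have "E (h \<otimes>\<^bsub>F\<^esub> (f \<oplus>\<^bsub>F\<^esub> g)) = \<zero>\<^bsub>G\<^esub>" if h: "h \<in> carrier F" for h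
      proof -
        have "h \<otimes>\<^bsub>F\<^esub> (f \<oplus>\<^bsub>F\<^esub> g) = h \<otimes>\<^bsub>F\<^esub> f - (\<ominus>\<^bsub>F\<^esub> h) \<otimes>\<^bsub>F\<^esub> g"
          using fg h pair_ring_minus[of "h \<otimes>\<^bsub>F\<^esub> f" "(\<ominus>\<^bsub>F\<^esub> h) \<otimes>\<^bsub>F\<^esub> g"]
          by (simp add: F.r_distr F.l_minus a_minus_def)
        then show ?thesis
          using \<open>f \<in> J\<close> \<open>g \<in> J\<close> h fg unfolding J_def by (simp add: E_diff minus_eq_zero)
      qed
      then show ?thesis unfolding J_def using fg by simp
    qed
    show "x \<otimes>\<^bsub>F\<^esub> f \<in> J" if "x \<in> carrier F" "f \<in> J" for x f
      using that unfolding J_def by (auto simp: F.m_assoc[symmetric])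
  qed
  moreover have "bilin_rels A S \<subseteq> J"
  proof
    fix r assume r: "r \<in> bilin_rels A S"
    then have rF: "r \<in> carrier F" using bilin_rels_closed by blast
    have "E (g \<otimes>\<^bsub>F\<^esub> r) = \<zero>\<^bsub>G\<^esub> \<and> g \<in> carrier F" if "g \<in> carrier F" for g
      using that
    proof (induction rule: pair_ring_induct)
      case zero
      then show ?case by (simp add: pair_ring_mult_0 E_zero) (simp add: pair_ring_simps)
    next
      case (of a b)
      then show ?case using E_rels[OF r] by (simp add: pair_ring_of_closed)
    next
      case (diff f g)
      then show ?case using rF by (simp add: pair_ring_mult_diff E_diff pair_ring_diff_closed minus_eq_zero)
    qed
    then show "r \<in> J" unfolding J_def using rF by blast
  qed
  ultimately have "Z \<subseteq> J" by (rule F.genideal_minimal)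
  then have "f \<in> carrier F" "E (\<one>\<^bsub>F\<^esub> \<otimes>\<^bsub>F\<^esub> f) = \<zero>\<^bsub>G\<^esub>" using assms unfolding J_def by blast+
  then show ?thesis by simp
qed

abbreviation "\<Phi> \<equiv> lift G \<psi>"

lemma lift_coset:
  assumes f: "f \<in> carrier F" shows "\<Phi> (coset f) = E f"
proof -
  have "E g = E f" if "g \<in> coset f" for g
  proof -
    have gF: "g \<in> carrier F" using that f Z.a_subset unfolding coset_def by (meson F.a_r_coset_subset_G subsetD)
    from that obtain z where z: "z \<in> Z" "g = z \<oplus>\<^bsub>F\<^esub> f" unfolding coset_def a_r_coset_def' by blast
    then have "g - f \<in> Z" by (simp add: pair_ring_simps(4))
    then have "E g \<ominus>\<^bsub>G\<^esub> E f = \<zero>\<^bsub>G\<^esub>" using E_Z E_diff[OF gF f] by simp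
    moreover have "E g = (E g \<ominus>\<^bsub>G\<^esub> E f) \<oplus>\<^bsub>G\<^esub> E f"
      using E_closed gF f by (simp add: a_minus_def G.a_assoc G.l_neg)
    ultimately show ?thesis using E_closed f by simp
  qed
  moreover have "f \<in> coset f" unfolding coset_def using f by (rule Z.a_rcos_self)
  ultimately have "E ` coset f = {E f}" by blast
  then show ?thesis unfolding lift_def by simp
qed

lemma lift_closed: "t \<in> carrier T \<Longrightarrow> \<Phi> t \<in> carrier G"
  using lift_coset E_closed by (metis T_carrierE)

lemma lift_zero: "\<Phi> \<zero>\<^bsub>T\<^esub> = \<zero>\<^bsub>G\<^esub>"
  using lift_coset[of 0] coset.hom_zero E_zero by (simp add: pair_ring_simps)

lemma lift_minus:
  assumes "s \<in> carrier T" "t \<in> carrier T" shows "\<Phi> (s \<ominus>\<^bsub>T\<^esub> t) = \<Phi> s \<ominus>\<^bsub>G\<^esub> \<Phi> t"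
proof -
  obtain f g where f: "f \<in> carrier F" "s = coset f" and g: "g \<in> carrier F" "t = coset g"
    using assms by (metis T_carrierE)
  have "\<Phi> (coset (f - g)) = E (f - g)" by (rule lift_coset) (intro pair_ring_diff_closed f g)
  then show ?thesis using f g coset_diff E_diff lift_coset by simp
qed

lemma lift_tensor: "a \<in> carrier S \<Longrightarrow> b \<in> carrier S \<Longrightarrow> \<Phi> (i1 a \<otimes>\<^bsub>T\<^esub> i2 b) = \<psi> (a, b)"
  using lift_coset E_of coset_of pair_ring_of_closed by metis

end

section \<open>Derivations and idempotent diagonal ideals\<close>

lemma (in cring) exists_prime_ideal:
  assumes I: "ideal I R" and proper: "\<one> \<notin> I"
  obtains Q where "primeideal Q R" "I \<subseteq> Q"
proof -
  define \<A> where "\<A> = {J. ideal J R \<and> I \<subseteq> J \<and> \<one> \<notin> J}"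
  have "\<exists>M\<in>\<A>. \<forall>J\<in>\<A>. M \<subseteq> J \<longrightarrow> J = M"
  proof (rule subset_Zorn_nonempty)
    show "\<A> \<noteq> {}" using I proper unfolding \<A>_def by auto
    fix \<C> assume ne: "\<C> \<noteq> {}" and ch: "subset.chain \<A> \<C>"
    have C: "ideal J R \<and> I \<subseteq> J \<and> \<one> \<notin> J" if "J \<in> \<C>" for J
      using ch that unfolding subset.chain_def \<A>_def by blast
    have lin: "J \<subseteq> J' \<or> J' \<subseteq> J" if "J \<in> \<C>" "J' \<in> \<C>" for J J'
      using ch that unfolding subset.chain_def by blast
    have "ideal (\<Union>\<C>) R"
      by (rule submod_ideal[OF submod_Union_chain[OF ne _ lin]]) (use C ideal_submod in auto)
    then show "\<Union>\<C> \<in> \<A>" using ne C unfolding \<A>_def by blast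
  qed
  then obtain M where MA: "M \<in> \<A>" and max: "\<And>J. J \<in> \<A> \<Longrightarrow> M \<subseteq> J \<Longrightarrow> J = M" by blast
  then have M: "ideal M R" "I \<subseteq> M" "\<one> \<notin> M" unfolding \<A>_def by simp_all
  have "maximalideal M R"
  proof (rule maximalidealI[OF M(1)])
    show "carrier R \<noteq> M" using M(3) by auto
    fix J assume J: "ideal J R" "M \<subseteq> J" "J \<subseteq> carrier R"
    show "J = M \<or> J = carrier R"
    proof (cases "\<one> \<in> J")
      case True
      then show ?thesis using ideal.one_imp_carrier[OF J(1)] by blast
    next
      case False
      then have "J \<in> \<A>" using J M(2) unfolding \<A>_def by simp
      then show ?thesis using max J(2) by simp
    qed
  qed
  then show ?thesis using that maximalideal_prime M(2) by blast
qed

text \<open>The value at \<open>x\<close> of the formal derivative, read off a raw coefficient list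
  (leading coefficient first) without normalizing. For the constant term the exponent
  \<open>length p - 1\<close> is cut off at 0, which is harmless because the multiplier
  \<open>length p\<close> is 0 there.\<close>

fun (in ring) deriv_eval :: "'a list \<Rightarrow> 'a \<Rightarrow> 'a" where
  "deriv_eval [] x = \<zero>"
| "deriv_eval (a # p) x = a \<otimes> ([length p] \<cdot> (x [^] (length p - 1))) \<oplus> deriv_eval p x"

lemma (in ring) deriv_eval_closed:
  "set p \<subseteq> carrier R \<Longrightarrow> x \<in> carrier R \<Longrightarrow> deriv_eval p x \<in> carrier R"
  by (induction p) auto

lemma (in cring) mult_minus_distrib:
  assumes "z \<in> carrier R" "x \<in> carrier R" "y \<in> carrier R"
  shows "z \<otimes> (x \<ominus> y) = z \<otimes> x \<ominus> z \<otimes> y"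
  using assms by algebra

lemma (in cring) minus_mult_distrib:
  assumes "z \<in> carrier R" "x \<in> carrier R" "y \<in> carrier R"
  shows "(x \<ominus> y) \<otimes> z = x \<otimes> z \<ominus> y \<otimes> z"
  using assms by algebra

text \<open>An \<open>A\<close>-derivation of \<open>S\<close> whose values lie in an
  \<open>S\<close>-algebra \<open>N\<close> instead of a mere module. The instance in mind is the
  quotient of the tensor square by the square of the diagonal ideal, with \<open>h\<close> induced
  by the first factor.\<close>

locale derivation = h: ring_hom_cring S N h for S (structure) and N (structure) and h +
  fixes A and D
  assumes A: "subring A S"
    and D_closed: "x \<in> carrier S \<Longrightarrow> D x \<in> carrier N"
    and D_add: "x \<in> carrier S \<Longrightarrow> y \<in> carrier S \<Longrightarrow> D (x \<oplus>\<^bsub>S\<^esub> y) = D x \<oplus>\<^bsub>N\<^esub> D y"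
    and D_mult: "x \<in> carrier S \<Longrightarrow> y \<in> carrier S \<Longrightarrow> D (x \<otimes>\<^bsub>S\<^esub> y) = h x \<otimes>\<^bsub>N\<^esub> D y \<oplus>\<^bsub>N\<^esub> h y \<otimes>\<^bsub>N\<^esub> D x"
    and D_base: "r \<in> A \<Longrightarrow> D r = \<zero>\<^bsub>N\<^esub>"
begin

lemma D_base_mult: "r \<in> A \<Longrightarrow> y \<in> carrier S \<Longrightarrow> D (r \<otimes>\<^bsub>S\<^esub> y) = h r \<otimes>\<^bsub>N\<^esub> D y"
  using D_mult[of r y] D_base subringE(1)[OF A] D_closed by auto

lemma D_pow:
  assumes s: "s \<in> carrier S" shows "D (s [^]\<^bsub>S\<^esub> (n::nat)) = h (add_pow S n (s [^]\<^bsub>S\<^esub> (n - 1))) \<otimes>\<^bsub>N\<^esub> D s"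
proof (induction n)
  case 0
  then show ?case using D_base subringE(3)[OF A] D_closed[OF s] by simp
next
  case (Suc n)
  let ?t = "add_pow S n (s [^]\<^bsub>S\<^esub> (n - 1))"
  have t: "?t \<in> carrier S" using s by simp
  have e: "s \<otimes>\<^bsub>S\<^esub> ?t = add_pow S n (s [^]\<^bsub>S\<^esub> n)"
  proof (cases n)
    case (Suc m)
    have "s \<otimes>\<^bsub>S\<^esub> add_pow S (Suc m) (s [^]\<^bsub>S\<^esub> m) = add_pow S (Suc m) (s \<otimes>\<^bsub>S\<^esub> s [^]\<^bsub>S\<^esub> m)"
      by (rule h.R.add_pow_rdistr) (use s in auto)
    then show ?thesis using Suc s by (simp add: h.R.m_comm)
  qed (use s in simp)
  have "D (s [^]\<^bsub>S\<^esub> Suc n) = h (s [^]\<^bsub>S\<^esub> n) \<otimes>\<^bsub>N\<^esub> D s \<oplus>\<^bsub>N\<^esub> h s \<otimes>\<^bsub>N\<^esub> (h ?t \<otimes>\<^bsub>N\<^esub> D s)"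
    using D_mult[of "s [^]\<^bsub>S\<^esub> n" s] s Suc by simp
  also have "\<dots> = h (s [^]\<^bsub>S\<^esub> n \<oplus>\<^bsub>S\<^esub> s \<otimes>\<^bsub>S\<^esub> ?t) \<otimes>\<^bsub>N\<^esub> D s"
    using s t D_closed[OF s] by (simp add: h.S.l_distr h.S.m_assoc del: h.R.add_pow_ldistr)
  also have "s [^]\<^bsub>S\<^esub> n \<oplus>\<^bsub>S\<^esub> s \<otimes>\<^bsub>S\<^esub> ?t = add_pow S (Suc n) (s [^]\<^bsub>S\<^esub> n)"
    unfolding e using s by (simp add: h.R.a_comm)
  finally show ?case by simp
qed

lemma D_eval:
  assumes s: "s \<in> carrier S" and "set p \<subseteq> A"
  shows "D (h.R.eval p s) = h (h.R.deriv_eval p s) \<otimes>\<^bsub>N\<^esub> D s"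
  using assms(2)
proof (induction p)
  case Nil
  then show ?case using D_base subringE(2)[OF A] D_closed[OF s] by simp
next
  case (Cons a p)
  have a: "a \<in> A" "a \<in> carrier S" "set p \<subseteq> carrier S" using Cons.prems subringE(1)[OF A] by auto
  have ev: "h.R.eval p s \<in> carrier S" "h.R.deriv_eval p s \<in> carrier S"
    using h.R.eval_in_carrier h.R.deriv_eval_closed a s by auto
  let ?t = "add_pow S (length p) (s [^]\<^bsub>S\<^esub> (length p - 1))"
  have t: "?t \<in> carrier S" using s by simp
  have "D (h.R.eval (a # p) s) = h a \<otimes>\<^bsub>N\<^esub> (h ?t \<otimes>\<^bsub>N\<^esub> D s) \<oplus>\<^bsub>N\<^esub> h (h.R.deriv_eval p s) \<otimes>\<^bsub>N\<^esub> D s"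
    using a ev s Cons D_pow[OF s] by (simp add: D_add D_base_mult)
  also have "\<dots> = h (h.R.deriv_eval (a # p) s) \<otimes>\<^bsub>N\<^esub> D s"
    using a ev s t D_closed[OF s] by (simp add: h.S.l_distr h.S.m_assoc)
  finally show ?case .
qed

end

text \<open>If \<open>I\<close> lies in \<open>J + (g [^] n)\<close> and in \<open>J + (g)\<close>,
  then \<open>I \<cdot> I\<close> lies in \<open>J + (g [^] (n + 1))\<close>, and so does
  \<open>I\<close>. The exponent can thus be raised until the power of \<open>g\<close> is absorbed
  by \<open>J\<close>. This replaces the description of finitely generated idempotent ideals by
  idempotents.\<close>

lemma (in cring) idempotent_ideal_step:
  assumes I: "ideal I R" and II: "I \<subseteq> I \<cdot> I" and J: "ideal J R" and g: "g \<in> carrier R"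
    and IJ: "I \<subseteq> J <+>\<^bsub>R\<^esub> PIdl g" and gk: "g [^] (k::nat) \<in> J"
  shows "I \<subseteq> J"
proof -
  interpret I: ideal I R by fact
  interpret J: ideal J R by fact
  have mem: "x \<in> J <+>\<^bsub>R\<^esub> PIdl z \<longleftrightarrow> (\<exists>a\<in>J. \<exists>u\<in>carrier R. x = a \<oplus> u \<otimes> z)" for x z
    unfolding set_add_def' cgenideal_def by blast
  have "I \<subseteq> J <+>\<^bsub>R\<^esub> PIdl (g [^] Suc n)" for n
  proof (induction n)
    case 0
    then show ?case using IJ g by simp
  next
    case (Suc n)
    define z where "z = g [^] Suc n"
    have z: "z \<in> carrier R" unfolding z_def using g by blast
    have id: "ideal (J <+>\<^bsub>R\<^esub> PIdl (g [^] Suc (Suc n))) R"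
      by (intro add_ideals J cgenideal_ideal nat_pow_closed g)
    have "I \<cdot> I \<subseteq> J <+>\<^bsub>R\<^esub> PIdl (g [^] Suc (Suc n))"
    proof
      fix x assume "x \<in> I \<cdot> I"
      then show "x \<in> J <+>\<^bsub>R\<^esub> PIdl (g [^] Suc (Suc n))"
      proof (induction rule: ideal_prod.induct)
        case (prod i j)
        obtain a u where a: "a \<in> J" "u \<in> carrier R" "i = a \<oplus> u \<otimes> z"
          using prod(1) Suc mem unfolding z_def by blast
        obtain b v where b: "b \<in> J" "v \<in> carrier R" "j = b \<oplus> v \<otimes> g" using prod(2) IJ mem by blast
        note car = J.Icarr[OF a(1)] a(2) J.Icarr[OF b(1)] b(2) z g
        have "i \<otimes> j = (a \<otimes> (b \<oplus> v \<otimes> g) \<oplus> (u \<otimes> z) \<otimes> b) \<oplus> (u \<otimes> v) \<otimes> (z \<otimes> g)"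
          unfolding a(3) b(3) using car by algebra
        moreover have "a \<otimes> (b \<oplus> v \<otimes> g) \<oplus> (u \<otimes> z) \<otimes> b \<in> J"
          by (intro J.a_closed J.I_r_closed[OF a(1)] J.I_l_closed[OF b(1)] a_closed m_closed car)
        moreover have "z \<otimes> g = g [^] Suc (Suc n)" unfolding z_def by simp
        ultimately show ?case using mem car m_closed[OF a(2) b(2)] by metis
      next
        case (sum s1 s2)
        then show ?case using additive_subgroup.a_closed[OF ideal.axioms(1)[OF id]] by blast
      qed
    qed
    then show ?case using II by blast
  qed
  then have sub: "I \<subseteq> J <+>\<^bsub>R\<^esub> PIdl (g [^] Suc k)" .
  have gk': "g [^] Suc k \<in> J" using J.I_r_closed[OF gk g] by simp
  show ?thesis
  proof
    fix x assume "x \<in> I"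
    then have "x \<in> J <+>\<^bsub>R\<^esub> PIdl (g [^] Suc k)" using sub by blast
    then obtain a u where "a \<in> J" "u \<in> carrier R" "x = a \<oplus> u \<otimes> g [^] Suc k" unfolding mem by blast
    then show "x \<in> J" using J.a_closed J.I_l_closed[OF gk'] by simp
  qed
qed

section \<open>The diagonal ideal and its generators\<close>

context tensor_ext begin

lemma balanced_mult: "balanced_map S A S (\<lambda>p. fst p \<otimes> snd p)"
proof (intro balanced_map.intro balanced_map_axioms.intro tensor_ext_axioms is_abelian_group)
  fix r x y assume "r \<in> A" "x \<in> carrier S" "y \<in> carrier S"
  then show "fst (r \<otimes> x, y) \<otimes> snd (r \<otimes> x, y) = fst (x, r \<otimes> y) \<otimes> snd (x, r \<otimes> y)"
    using A_carr[of r] by (simp add: m_ac)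
qed (simp_all add: l_distr r_distr)

interpretation bm: balanced_map S A S "\<lambda>p. fst p \<otimes> snd p" by (rule balanced_mult)

lemma tensor_mult_eq: "tensor_mult S = lift S (\<lambda>p. fst p \<otimes> snd p)"
  unfolding tensor_mult_def lift_def pair_mult_eq_extend by (simp add: fun_eq_iff)

lemmas tm_closed = bm.lift_closed[folded tensor_mult_eq]
  and tm_zero = bm.lift_zero[folded tensor_mult_eq]
  and tm_minus = bm.lift_minus[folded tensor_mult_eq]

lemma tm_tensor: "a \<in> carrier S \<Longrightarrow> b \<in> carrier S \<Longrightarrow> tensor_mult S (i1 a \<otimes>\<^bsub>T\<^esub> i2 b) = a \<otimes> b"
  unfolding tensor_mult_eq by (simp add: bm.lift_tensor)

lemma tm_i1: "a \<in> carrier S \<Longrightarrow> tensor_mult S (i1 a) = a"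
  using tm_tensor[of a \<one>] by simp

lemma tm_i2: "a \<in> carrier S \<Longrightarrow> tensor_mult S (i2 a) = a"
  using tm_tensor[of \<one> a] by simp

lemma tm_hom: "tensor_mult S \<in> ring_hom T S"
proof (rule ring_hom_memI)
  fix x y assume x: "x \<in> carrier T" and y: "y \<in> carrier T"
  show "tensor_mult S x \<in> carrier S" by (rule tm_closed[OF x])
  have "x \<oplus>\<^bsub>T\<^esub> y = x \<ominus>\<^bsub>T\<^esub> (\<zero>\<^bsub>T\<^esub> \<ominus>\<^bsub>T\<^esub> y)" using x y by (simp add: a_minus_def)
  then show "tensor_mult S (x \<oplus>\<^bsub>T\<^esub> y) = tensor_mult S x \<oplus> tensor_mult S y"
    using x y by (simp add: tm_minus tm_zero tm_closed) (simp add: tm_closed a_minus_def)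
  show "tensor_mult S (x \<otimes>\<^bsub>T\<^esub> y) = tensor_mult S x \<otimes> tensor_mult S y"
    using x
  proof (induction rule: T_induct)
    case zero
    then show ?case using y by (simp add: tm_zero tm_closed)
  next
    case (tensor a b)
    show ?case using y
    proof (induction rule: T_induct)
      case (tensor c d)
      have "i1 a \<otimes>\<^bsub>T\<^esub> i2 b \<otimes>\<^bsub>T\<^esub> (i1 c \<otimes>\<^bsub>T\<^esub> i2 d) = i1 (a \<otimes> c) \<otimes>\<^bsub>T\<^esub> i2 (b \<otimes> d)"
        using tensor \<open>a \<in> _\<close> \<open>b \<in> _\<close> by (simp add: T.m_ac)
      then have "tensor_mult S (i1 a \<otimes>\<^bsub>T\<^esub> i2 b \<otimes>\<^bsub>T\<^esub> (i1 c \<otimes>\<^bsub>T\<^esub> i2 d)) = (a \<otimes> c) \<otimes> (b \<otimes> d)"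
        using tm_tensor[of "a \<otimes> c" "b \<otimes> d"] tensor \<open>a \<in> _\<close> \<open>b \<in> _\<close> by (metis m_closed)
      then show ?case using tensor \<open>a \<in> _\<close> \<open>b \<in> _\<close> by (simp add: tm_tensor m_ac)
    next
      case (minus u v)
      have z: "i1 a \<otimes>\<^bsub>T\<^esub> i2 b \<in> carrier T" using tensor by simp
      show ?case
        using minus by (simp only: T.mult_minus_distrib[OF z minus(1,2)] tm_minus T.m_closed[OF z]
          mult_minus_distrib[OF tm_closed[OF z] tm_closed[OF minus(1)] tm_closed[OF minus(2)]])
    qed (use tensor in \<open>simp add: tm_zero tm_closed\<close>)
  next
    case (minus u v)
    then show ?case
      by (simp only: T.minus_mult_distrib[OF y minus(1,2)] tm_minus T.m_closed[OF _ y]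
        minus_mult_distrib[OF tm_closed[OF y] tm_closed[OF minus(1)] tm_closed[OF minus(2)]])
  qed
next
  show "tensor_mult S \<one>\<^bsub>T\<^esub> = \<one>" using tm_i1[of \<one>] by simp
qed

sublocale tm: ring_hom_cring T S "tensor_mult S" by (intro ring_hom_cringI is_cring T.is_cring tm_hom)

lemma I_iff: "t \<in> I \<longleftrightarrow> t \<in> carrier T \<and> tensor_mult S t = \<zero>"
  unfolding diag_ideal_def a_kernel_def' by simp

sublocale I: ideal I T
  unfolding diag_ideal_def by (rule ring_hom_ring.kernel_is_ideal) (unfold_locales)

text \<open>Modulo the square of \<open>I\<close> this is the universal differential of
  \<open>s\<close>, up to the sign convention.\<close>

definition \<gamma> :: "'a \<Rightarrow> ('a \<times> 'a \<Rightarrow>\<^sub>0 int) set" where "\<gamma> s = i1 s \<ominus>\<^bsub>T\<^esub> i2 s"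

lemma gamma_closed: "s \<in> carrier S \<Longrightarrow> \<gamma> s \<in> carrier T"
  unfolding \<gamma>_def by simp

lemma gamma_I: "s \<in> carrier S \<Longrightarrow> \<gamma> s \<in> I"
  unfolding I_iff \<gamma>_def by (simp add: tm_minus tm_i1 tm_i2)

lemma gamma_add: "s \<in> carrier S \<Longrightarrow> t \<in> carrier S \<Longrightarrow> \<gamma> (s \<oplus> t) = \<gamma> s \<oplus>\<^bsub>T\<^esub> \<gamma> t"
proof -
  assume st: "s \<in> carrier S" "t \<in> carrier S"
  note car = i1.hom_closed[OF st(1)] i1.hom_closed[OF st(2)] i2.hom_closed[OF st(1)] i2.hom_closed[OF st(2)]
  show ?thesis unfolding \<gamma>_def i1.hom_add[OF st] i2.hom_add[OF st] using car by algebra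
qed

lemma gamma_base: "r \<in> A \<Longrightarrow> \<gamma> r = \<zero>\<^bsub>T\<^esub>"
  unfolding \<gamma>_def using i1_i2_base[of r] A_carr by simp

text \<open>The Leibniz rule holds exactly in the tensor square if the two factors act through
  different structure maps; on \<open>I\<close> modulo its square the two actions agree.\<close>

lemma gamma_mult:
  assumes "s \<in> carrier S" "t \<in> carrier S"
  shows "\<gamma> (s \<otimes> t) = i1 s \<otimes>\<^bsub>T\<^esub> \<gamma> t \<oplus>\<^bsub>T\<^esub> i2 t \<otimes>\<^bsub>T\<^esub> \<gamma> s"
proof -
  note car = i1.hom_closed[OF assms(1)] i1.hom_closed[OF assms(2)] i2.hom_closed[OF assms(1)] i2.hom_closed[OF assms(2)]
  show ?thesis unfolding \<gamma>_def i1.hom_mult[OF assms] i2.hom_mult[OF assms] using car by algebra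
qed

text \<open>Allows membership of \<open>\<gamma> s\<close> in an ideal to be checked on ring
  generators of \<open>S\<close> over \<open>A\<close> only.\<close>

lemma gamma_subring:
  assumes J: "ideal J T" shows "subring {s \<in> carrier S. \<gamma> s \<in> J} S"
proof -
  interpret J: ideal J T by fact
  show ?thesis
  proof (rule subringI)
    show "\<one> \<in> {s \<in> carrier S. \<gamma> s \<in> J}" using gamma_base subringE(3)[OF A] J.zero_closed by simp
    fix s assume s: "s \<in> {s \<in> carrier S. \<gamma> s \<in> J}"
    have "\<gamma> (\<ominus> s) = \<ominus>\<^bsub>T\<^esub> \<gamma> s" using s unfolding \<gamma>_def by (simp add: a_minus_def T.minus_add)
    then show "\<ominus> s \<in> {s \<in> carrier S. \<gamma> s \<in> J}" using s by simp
    fix t assume t: "t \<in> {s \<in> carrier S. \<gamma> s \<in> J}"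
    show "s \<oplus> t \<in> {s \<in> carrier S. \<gamma> s \<in> J}" using s t by (simp add: gamma_add)
    show "s \<otimes> t \<in> {s \<in> carrier S. \<gamma> s \<in> J}"
      using s t J.I_l_closed by (simp add: gamma_mult)
  qed auto
qed

text \<open>Every \<open>t\<close> is congruent modulo \<open>J\<close> to
  \<open>i1 (tensor_mult S t)\<close>: for the tensor of \<open>a\<close> and \<open>b\<close> the
  difference is \<open>i1 a\<close> times \<open>\<gamma> b\<close>, up to sign. On \<open>I\<close>
  the subtracted term is zero.\<close>

lemma I_minimal:
  assumes J: "ideal J T" and g: "\<And>s. s \<in> carrier S \<Longrightarrow> \<gamma> s \<in> J"
  shows "I \<subseteq> J"
proof
  interpret J: ideal J T by fact
  fix t assume t: "t \<in> I"
  then have "t \<in> carrier T" using I_iff by blast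
  then have "t \<ominus>\<^bsub>T\<^esub> i1 (tensor_mult S t) \<in> J"
  proof (induction rule: T_induct)
    case zero
    then show ?case by (simp add: tm_zero a_minus_def)
  next
    case (tensor a b)
    note car = i1.hom_closed[OF tensor(1)] i1.hom_closed[OF tensor(2)] i2.hom_closed[OF tensor(2)]
    have "i1 a \<otimes>\<^bsub>T\<^esub> i2 b \<ominus>\<^bsub>T\<^esub> i1 (tensor_mult S (i1 a \<otimes>\<^bsub>T\<^esub> i2 b)) = \<ominus>\<^bsub>T\<^esub> (i1 a \<otimes>\<^bsub>T\<^esub> \<gamma> b)"
      unfolding \<gamma>_def tm_tensor[OF tensor] i1.hom_mult[OF tensor] using car by algebra
    then show ?case using J.I_l_closed g tensor by simp
  next
    case (minus x y)
    define u v where "u = i1 (tensor_mult S x)" and "v = i1 (tensor_mult S y)"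
    have uv: "u \<in> carrier T" "v \<in> carrier T" using minus tm_closed unfolding u_def v_def by auto
    have "i1 (tensor_mult S (x \<ominus>\<^bsub>T\<^esub> y)) = u \<ominus>\<^bsub>T\<^esub> v"
      using minus tm_closed unfolding u_def v_def by (simp add: tm_minus)
    moreover have "x \<ominus>\<^bsub>T\<^esub> y \<ominus>\<^bsub>T\<^esub> (u \<ominus>\<^bsub>T\<^esub> v) = (x \<ominus>\<^bsub>T\<^esub> u) \<ominus>\<^bsub>T\<^esub> (y \<ominus>\<^bsub>T\<^esub> v)"
      using minus(1,2) uv by algebra
    moreover have "(x \<ominus>\<^bsub>T\<^esub> u) \<ominus>\<^bsub>T\<^esub> (y \<ominus>\<^bsub>T\<^esub> v) \<in> J"
      unfolding a_minus_def[of T "x \<ominus>\<^bsub>T\<^esub> u"] by (intro J.a_closed J.a_inv_closed minus(3,4)[folded u_def v_def])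
    ultimately show ?case by simp
  qed
  then show "t \<in> J" using t unfolding I_iff by (simp add: a_minus_def)
qed

lemma kaehler_trivial_iff:
  "carrier (kaehler A S) = {\<one>\<^bsub>kaehler A S\<^esub>} \<longleftrightarrow> I \<subseteq> ideal_prod T I I"
proof -
  let ?W = "ideal_prod T I I"
  interpret W: ideal ?W T by (rule T.ideal_prod_is_ideal[OF I.is_ideal I.is_ideal])
  have c: "carrier (kaehler A S) = {?W +>\<^bsub>T\<^esub> x | x. x \<in> I}"
    unfolding kaehler_def Let_def A_FactGroup_def' A_RCOSETS_def' a_r_coset_def' by auto
  have o: "\<one>\<^bsub>kaehler A S\<^esub> = ?W"
    unfolding kaehler_def Let_def A_FactGroup_def' by simp
  show ?thesis
  proof
    assume l: "carrier (kaehler A S) = {\<one>\<^bsub>kaehler A S\<^esub>}"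
    show "I \<subseteq> ?W"
    proof
      fix x assume x: "x \<in> I"
      then have "?W +>\<^bsub>T\<^esub> x = ?W" using l unfolding c o by blast
      then show "x \<in> ?W" using W.rcos_const_imp_mem I.Icarr[OF x] by blast
    qed
  next
    assume sub: "I \<subseteq> ?W"
    then have "?W +>\<^bsub>T\<^esub> x = ?W" if "x \<in> I" for x using T.a_rcos_zero[OF W.is_ideal] that by blast
    then show "carrier (kaehler A S) = {\<one>\<^bsub>kaehler A S\<^esub>}" unfolding c o using I.zero_closed by blast
  qed
qed

text \<open>The generators are handled one at a time. Adding \<open>\<gamma> g\<close> to
  \<open>J\<close> leaves fewer generators to treat, and the enlarged ideal contains
  \<open>I\<close> by induction; \<open>idempotent_ideal_step\<close> then removes
  \<open>\<gamma> g\<close> again, since a power of it lies in \<open>J\<close>. The induction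
  therefore runs over all \<open>J\<close>, with the hypothesis that any ideal containing
  \<open>J\<close> and the remaining \<open>\<gamma>\<close> values contains
  \<open>I\<close>.\<close>

lemma idempotent_diag_ideal_subset:
  assumes II: "I \<subseteq> ideal_prod T I I" and "finite G" "G \<subseteq> carrier S" and gen: "generate_ring S (A \<union> G) = carrier S"
    and J: "ideal J T" and nil: "\<And>g. g \<in> G \<Longrightarrow> \<exists>k::nat. \<gamma> g [^]\<^bsub>T\<^esub> k \<in> J"
  shows "I \<subseteq> J"
proof -
  have claim: "I \<subseteq> J" if "finite H" "H \<subseteq> carrier S" "ideal J T" "\<And>g. g \<in> H \<Longrightarrow> \<exists>k::nat. \<gamma> g [^]\<^bsub>T\<^esub> k \<in> J"
    "\<And>J'. ideal J' T \<Longrightarrow> J \<subseteq> J' \<Longrightarrow> \<gamma> ` H \<subseteq> J' \<Longrightarrow> I \<subseteq> J'" for H J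
    using that
  proof (induction H arbitrary: J rule: finite_induct)
    case empty
    then show ?case by blast
  next
    case (insert g H)
    have g: "\<gamma> g \<in> carrier T" using insert.prems(1) gamma_closed by blast
    let ?J = "J <+>\<^bsub>T\<^esub> PIdl\<^bsub>T\<^esub> (\<gamma> g)"
    have idP: "ideal (PIdl\<^bsub>T\<^esub> (\<gamma> g)) T" by (rule T.cgenideal_ideal[OF g])
    have id: "ideal ?J T" by (rule T.add_ideals[OF insert.prems(2) idP])
    have un: "J \<union> PIdl\<^bsub>T\<^esub> (\<gamma> g) \<subseteq> ?J"
      using T.union_genideal[OF insert.prems(2) idP] T.genideal_self[of "J \<union> PIdl\<^bsub>T\<^esub> (\<gamma> g)"]
        ideal.Icarr[OF insert.prems(2)] ideal.Icarr[OF idP] by blast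
    have gJ: "\<gamma> g \<in> ?J" using un T.cgenideal_self[OF g] by blast
    have "I \<subseteq> ?J"
    proof (rule insert.IH[OF _ id])
      show "H \<subseteq> carrier S" using insert.prems by blast
      show "\<exists>k::nat. \<gamma> h [^]\<^bsub>T\<^esub> k \<in> ?J" if "h \<in> H" for h using insert.prems(3)[of h] that un by blast
      show "I \<subseteq> J'" if "ideal J' T" "?J \<subseteq> J'" "\<gamma> ` H \<subseteq> J'" for J'
        using insert.prems(4)[OF that(1)] that un gJ by blast
    qed
    moreover obtain k :: nat where "\<gamma> g [^]\<^bsub>T\<^esub> k \<in> J" using insert.prems(3) by blast
    ultimately show ?case by (intro T.idempotent_ideal_step[OF I.is_ideal II insert.prems(2) g])
  qed
  show ?thesis
  proof (rule claim[OF assms(2,3) J nil])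
    fix J' assume J': "ideal J' T" "J \<subseteq> J'" "\<gamma> ` G \<subseteq> J'"
    have "A \<union> G \<subseteq> {s \<in> carrier S. \<gamma> s \<in> J'}"
      using J' assms(3) A_carr gamma_base additive_subgroup.zero_closed[OF ideal.axioms(1)[OF J'(1)]] by auto
    moreover have "A \<union> G \<subseteq> carrier S" using assms(3) A_carr by blast
    ultimately have "carrier S \<subseteq> {s \<in> carrier S. \<gamma> s \<in> J'}"
      using generate_ring_min_subring1[OF _ gamma_subring[OF J'(1)]] gen by blast
    then show "I \<subseteq> J'" by (intro I_minimal[OF J'(1)]) blast
  qed
qed

end

text \<open>The difference of two homomorphisms that agree on \<open>A\<close> is an
  \<open>A\<close>-derivation modulo any ideal containing the products of its values. It kills
  \<open>e \<otimes> f(s)\<close>, which lies in \<open>A\<close>, while the chain rule evaluates it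
  as \<open>e \<otimes> f'(s)\<close> times the difference at \<open>s\<close>.\<close>

lemma derivation_modulo_ideal:
  fixes S (structure) and T (structure)
  assumes "ring_hom_cring S T i1" "ring_hom_cring S T i2" and A: "subring A S"
    and base: "\<And>r. r \<in> A \<Longrightarrow> i1 r = i2 r" and W: "ideal W T"
    and prod: "\<And>x y. x \<in> carrier S \<Longrightarrow> y \<in> carrier S \<Longrightarrow>
      (i1 x \<ominus>\<^bsub>T\<^esub> i2 x) \<otimes>\<^bsub>T\<^esub> (i1 y \<ominus>\<^bsub>T\<^esub> i2 y) \<in> W"
    and s: "s \<in> carrier S" and p: "set p \<subseteq> A" and e: "e \<in> A" "e \<otimes>\<^bsub>S\<^esub> ring.eval S p s \<in> A"
  shows "i1 (e \<otimes>\<^bsub>S\<^esub> ring.deriv_eval S p s) \<otimes>\<^bsub>T\<^esub> (i1 s \<ominus>\<^bsub>T\<^esub> i2 s) \<in> W"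
proof -
  interpret i1: ring_hom_cring S T i1 by fact
  interpret i2: ring_hom_cring S T i2 by fact
  interpret W: ideal W T by fact
  define N where "N = T Quot W"
  define \<rho> where "\<rho> x = W +>\<^bsub>T\<^esub> x" for x
  have "ring_hom_cring T N \<rho>"
    unfolding N_def \<rho>_def[abs_def] by (rule W.rcos_ring_hom_cring[OF i1.S.is_cring])
  then interpret \<rho>: ring_hom_cring T N \<rho> .
  have \<rho>0: "\<rho> x = \<zero>\<^bsub>N\<^esub> \<longleftrightarrow> x \<in> W" if "x \<in> carrier T" for x
  proof -
    have "\<zero>\<^bsub>N\<^esub> = W" by (simp add: N_def FactRing_def)
    then show ?thesis
      unfolding \<rho>_def using W.rcos_const_imp_mem[OF that] i1.S.a_rcos_zero[OF W, of x] by auto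
  qed
  define \<gamma> where "\<gamma> x = i1 x \<ominus>\<^bsub>T\<^esub> i2 x" for x
  have gc: "x \<in> carrier S \<Longrightarrow> \<gamma> x \<in> carrier T" for x unfolding \<gamma>_def by simp
  interpret D: derivation S N "\<lambda>s. \<rho> (i1 s)" A "\<lambda>s. \<rho> (\<gamma> s)"
  proof (intro derivation.intro derivation_axioms.intro ring_hom_cringI)
    show "(\<lambda>s. \<rho> (i1 s)) \<in> ring_hom S N" by (rule ring_hom_memI) auto
    show "\<rho> (\<gamma> r) = \<zero>\<^bsub>N\<^esub>" if "r \<in> A" for r
    proof -
      have "r \<in> carrier S" using subringE(1)[OF A] that by blast
      then have "i2 r \<in> carrier T" by simp
      then have "\<gamma> r = \<zero>\<^bsub>T\<^esub>" unfolding \<gamma>_def base[OF that] by simp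
      then show ?thesis by simp
    qed
    fix x y assume xy: "x \<in> carrier S" "y \<in> carrier S"
    note car = i1.hom_closed[OF xy(1)] i1.hom_closed[OF xy(2)] i2.hom_closed[OF xy(1)] i2.hom_closed[OF xy(2)]
      and g = gc[OF xy(1)] gc[OF xy(2)]
    have "\<gamma> (x \<oplus>\<^bsub>S\<^esub> y) = \<gamma> x \<oplus>\<^bsub>T\<^esub> \<gamma> y"
      unfolding \<gamma>_def i1.hom_add[OF xy] i2.hom_add[OF xy] using car by algebra
    then show "\<rho> (\<gamma> (x \<oplus>\<^bsub>S\<^esub> y)) = \<rho> (\<gamma> x) \<oplus>\<^bsub>N\<^esub> \<rho> (\<gamma> y)" using g by simp
    \<comment> \<open>Substituting \<open>i2 y\<close> by \<open>i1 y\<close> minus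
      \<open>\<gamma> y\<close> in the exact product rule makes both factors act through
      \<open>i1\<close>, at the cost of a product of two differences, which \<open>W\<close>
      absorbs.\<close>
    have "\<gamma> (x \<otimes>\<^bsub>S\<^esub> y) = i1 x \<otimes>\<^bsub>T\<^esub> \<gamma> y \<oplus>\<^bsub>T\<^esub> (i1 y \<otimes>\<^bsub>T\<^esub> \<gamma> x \<ominus>\<^bsub>T\<^esub> \<gamma> y \<otimes>\<^bsub>T\<^esub> \<gamma> x)"
      unfolding \<gamma>_def i1.hom_mult[OF xy] i2.hom_mult[OF xy] using car by algebra
    moreover have "\<rho> (\<gamma> y \<otimes>\<^bsub>T\<^esub> \<gamma> x) = \<zero>\<^bsub>N\<^esub>"
      using \<rho>0[of "\<gamma> y \<otimes>\<^bsub>T\<^esub> \<gamma> x"] g prod[OF xy(2,1)] unfolding \<gamma>_def by blast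
    ultimately show "\<rho> (\<gamma> (x \<otimes>\<^bsub>S\<^esub> y)) = \<rho> (i1 x) \<otimes>\<^bsub>N\<^esub> \<rho> (\<gamma> y) \<oplus>\<^bsub>N\<^esub> \<rho> (i1 y) \<otimes>\<^bsub>N\<^esub> \<rho> (\<gamma> x)"
      using car g by (simp add: a_minus_def)
  qed (use A gc i1.R.is_cring \<rho>.S.is_cring in auto)
  have pc: "set p \<subseteq> carrier S" "e \<in> carrier S" using p e subringE(1)[OF A] by auto
  have ev: "i1.R.eval p s \<in> carrier S" "i1.R.deriv_eval p s \<in> carrier S"
    using i1.R.eval_in_carrier i1.R.deriv_eval_closed s pc by auto
  have "\<zero>\<^bsub>N\<^esub> = \<rho> (\<gamma> (e \<otimes>\<^bsub>S\<^esub> i1.R.eval p s))" using D.D_base[OF e(2)] by simp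
  also have "\<dots> = \<rho> (i1 e) \<otimes>\<^bsub>N\<^esub> (\<rho> (i1 (i1.R.deriv_eval p s)) \<otimes>\<^bsub>N\<^esub> \<rho> (\<gamma> s))"
    using D.D_base_mult[OF e(1) ev(1)] D.D_eval[OF s p] by simp
  also have "\<dots> = \<rho> (i1 (e \<otimes>\<^bsub>S\<^esub> i1.R.deriv_eval p s) \<otimes>\<^bsub>T\<^esub> \<gamma> s)"
    using pc ev s gc by (simp add: \<rho>.S.m_assoc)
  finally show ?thesis
    using \<rho>0[of "i1 (e \<otimes>\<^bsub>S\<^esub> i1.R.deriv_eval p s) \<otimes>\<^bsub>T\<^esub> \<gamma> s"] pc ev gc[OF s] unfolding \<gamma>_def by auto
qed

context tensor_ext begin

text \<open>For fixed \<open>s\<close>, the ideal \<open>K\<close> is the annihilator of the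
  differential of \<open>s\<close>. If it were proper it would lie in a prime \<open>Q\<close>; but
  the data given for this \<open>Q\<close> put \<open>e \<otimes> f'(s)\<close> into
  \<open>K\<close>, and that product is outside \<open>Q\<close>. Hence \<open>p\<close> and
  \<open>e\<close> may depend on \<open>Q\<close>.\<close>

lemma idempotent_diag_ideal:
  assumes "\<And>s Q. s \<in> carrier S \<Longrightarrow> primeideal Q S \<Longrightarrow>
    \<exists>p e. set p \<subseteq> A \<and> e \<in> A - Q \<and> e \<otimes> eval p s \<in> A \<and> deriv_eval p s \<notin> Q"
  shows "I \<subseteq> ideal_prod T I I"
proof (rule I_minimal)
  let ?W = "ideal_prod T I I"
  show W: "ideal ?W T" by (rule T.ideal_prod_is_ideal[OF I.is_ideal I.is_ideal])
  interpret W: ideal ?W T by (rule W)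
  fix s assume s: "s \<in> carrier S"
  note gs = gamma_closed[OF s]
  define K where "K = {x \<in> carrier S. i1 x \<otimes>\<^bsub>T\<^esub> \<gamma> s \<in> ?W}"
  have Kid: "ideal K S"
  proof (intro submod_ideal submodI)
    show "K \<subseteq> carrier S" "\<zero> \<in> K" unfolding K_def using gs by auto
    show "a \<oplus> b \<in> K" if "a \<in> K" "b \<in> K" for a b using that unfolding K_def using gs by (simp add: T.l_distr)
    show "x \<otimes> a \<in> K" if x: "x \<in> carrier S" and a: "a \<in> K" for a x
      using W.I_l_closed[of "i1 a \<otimes>\<^bsub>T\<^esub> \<gamma> s" "i1 x"] a x gs unfolding K_def by (simp add: T.m_assoc)
  qed
  have "\<one> \<in> K"
  proof (rule ccontr)
    assume "\<one> \<notin> K"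
    then obtain Q where Q: "primeideal Q S" "K \<subseteq> Q" using exists_prime_ideal[OF Kid] by blast
    from assms[OF s Q(1)] obtain p e where
      p: "set p \<subseteq> A" "e \<in> A" "e \<notin> Q" "e \<otimes> eval p s \<in> A" "deriv_eval p s \<notin> Q" by blast
    have ec: "e \<in> carrier S" "set p \<subseteq> carrier S" using p A_carr by blast+
    then have dc: "deriv_eval p s \<in> carrier S" using deriv_eval_closed s by blast
    have "i1 (e \<otimes> deriv_eval p s) \<otimes>\<^bsub>T\<^esub> \<gamma> s \<in> ?W"
      unfolding \<gamma>_def
      by (rule derivation_modulo_ideal[OF i1.ring_hom_cring_axioms i2.ring_hom_cring_axioms A i1_i2_base W
            _ s p(1,2,4)])
        (auto intro!: ideal_prod.prod gamma_I[unfolded \<gamma>_def])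
    then have "e \<otimes> deriv_eval p s \<in> Q" using Q(2) ec dc unfolding K_def by auto
    then show False using primeideal.I_prime[OF Q(1) ec(1) dc] p by blast
  qed
  then show "\<gamma> s \<in> ?W" unfolding K_def using gs by simp
qed

end

section \<open>Localizations and residue fields\<close>

locale localized_ring = primeideal P A for P and A (structure)
begin

definition den :: "'a set" where "den = carrier A - P"

lemma den_carr: "s \<in> den \<Longrightarrow> s \<in> carrier A" unfolding den_def by blast
lemma den_mult: "s \<in> den \<Longrightarrow> t \<in> den \<Longrightarrow> s \<otimes> t \<in> den" unfolding den_def using I_prime by blast
lemma den_one: "\<one> \<in> den" unfolding den_def using I_notcarr one_imp_carrier by blast
lemma den_not: "s \<in> den \<Longrightarrow> s \<notin> P" unfolding den_def by blast

lemmas P_zero = additive_subgroup.zero_closed[OF is_additive_subgroup]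
  and P_add = additive_subgroup.a_closed[OF is_additive_subgroup]

abbreviation "fr \<equiv> fraction A P"
abbreviation "Loc \<equiv> localization A P"
abbreviation "J \<equiv> local_ideal A P"
abbreviation "L \<equiv> residue_field A P"

lemma fr_mem: "(b, t) \<in> fr a s \<longleftrightarrow> b \<in> carrier A \<and> t \<in> den \<and> (\<exists>u\<in>den. u \<otimes> (t \<otimes> a) = u \<otimes> (s \<otimes> b))"
  unfolding fraction_def den_def by simp

lemma fr_trans:
  assumes "a \<in> carrier A" "s \<in> den" "b \<in> carrier A" "t \<in> den" "c \<in> carrier A" "w \<in> den"
    and "(b, t) \<in> fr a s" "(c, w) \<in> fr b t" shows "(c, w) \<in> fr a s"
proof -
  obtain u v where u: "u \<in> den" "u \<otimes> (t \<otimes> a) = u \<otimes> (s \<otimes> b)" and v: "v \<in> den" "v \<otimes> (w \<otimes> b) = v \<otimes> (t \<otimes> c)"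
    using assms(7,8) unfolding fr_mem by auto
  note car = assms(1,3,5) den_carr[OF assms(2)] den_carr[OF assms(4)] den_carr[OF assms(6)] den_carr[OF u(1)] den_carr[OF v(1)]
  have "(u \<otimes> v \<otimes> t) \<otimes> (w \<otimes> a) = (v \<otimes> w) \<otimes> (u \<otimes> (t \<otimes> a))" using car by algebra
  also have "\<dots> = (u \<otimes> s) \<otimes> (v \<otimes> (w \<otimes> b))" unfolding u(2) using car by algebra
  also have "\<dots> = (u \<otimes> v \<otimes> t) \<otimes> (s \<otimes> c)" unfolding v(2) using car by algebra
  finally have "(u \<otimes> v \<otimes> t) \<otimes> (w \<otimes> a) = (u \<otimes> v \<otimes> t) \<otimes> (s \<otimes> c)" .
  moreover have "u \<otimes> v \<otimes> t \<in> den" by (intro den_mult u v assms)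
  ultimately show ?thesis unfolding fr_mem using assms(5,6) by blast
qed

lemma fr_sym: "a \<in> carrier A \<Longrightarrow> s \<in> den \<Longrightarrow> (b, t) \<in> fr a s \<Longrightarrow> (a, s) \<in> fr b t"
  unfolding fr_mem by metis

lemma fr_self: "a \<in> carrier A \<Longrightarrow> s \<in> den \<Longrightarrow> (a, s) \<in> fr a s"
  unfolding fr_mem using den_one by blast

lemma fr_eqI:
  assumes "a \<in> carrier A" "s \<in> den" "(b, t) \<in> fr a s" shows "fr b t = fr a s"
proof -
  have b: "b \<in> carrier A" "t \<in> den" using assms(3) fr_mem by blast+
  have "p \<in> fr b t \<longleftrightarrow> p \<in> fr a s" for p
  proof -
    obtain c w where p: "p = (c, w)" by fastforce
    show ?thesis
    proof
      assume l: "p \<in> fr b t"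
      then have "c \<in> carrier A" "w \<in> den" unfolding p fr_mem by blast+
      then show "p \<in> fr a s" using fr_trans[OF assms(1,2) b _ _ assms(3)] l unfolding p by blast
    next
      assume l: "p \<in> fr a s"
      then have "c \<in> carrier A" "w \<in> den" unfolding p fr_mem by blast+
      then show "p \<in> fr b t" using fr_trans[OF b assms(1,2) _ _ fr_sym[OF assms]] l unfolding p by blast
    qed
  qed
  then show ?thesis by blast
qed

lemma fr_eq_iff:
  assumes "a \<in> carrier A" "s \<in> den" "b \<in> carrier A" "t \<in> den"
  shows "fr a s = fr b t \<longleftrightarrow> (\<exists>u\<in>den. u \<otimes> (t \<otimes> a) = u \<otimes> (s \<otimes> b))"
proof -
  have "fr a s = fr b t \<longleftrightarrow> (b, t) \<in> fr a s"
    using fr_eqI[OF assms(1,2), of b t] fr_self[OF assms(3,4)] by auto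
  then show ?thesis using assms unfolding fr_mem by simp
qed

lemma fr_eqI':
  assumes "a \<in> carrier A" "s \<in> den" "b \<in> carrier A" "t \<in> den" "t \<otimes> a = s \<otimes> b"
  shows "fr a s = fr b t"
  using fr_eq_iff[OF assms(1-4)] assms(5) den_one by metis

lemma fr_mult:
  assumes "a \<in> carrier A" "s \<in> den" "b \<in> carrier A" "t \<in> den"
  shows "fr a s \<otimes>\<^bsub>Loc\<^esub> fr b t = fr (a \<otimes> b) (s \<otimes> t)"
proof -
  have "fr (c \<otimes> d) (v \<otimes> w) = fr (a \<otimes> b) (s \<otimes> t)" if cv: "(c, v) \<in> fr a s" and dw: "(d, w) \<in> fr b t" for c v d w
  proof (rule fr_eqI)
    obtain u u' where u: "u \<in> den" "u \<otimes> (v \<otimes> a) = u \<otimes> (s \<otimes> c)" "c \<in> carrier A" "v \<in> den"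
      and u': "u' \<in> den" "u' \<otimes> (w \<otimes> b) = u' \<otimes> (t \<otimes> d)" "d \<in> carrier A" "w \<in> den"
      using cv dw fr_mem by metis
    note car = assms(1,3) den_carr[OF assms(2)] den_carr[OF assms(4)] den_carr[OF u(1)] den_carr[OF u'(1)]
      u(3) u'(3) den_carr[OF u(4)] den_carr[OF u'(4)]
    have "(u \<otimes> u') \<otimes> ((v \<otimes> w) \<otimes> (a \<otimes> b)) = (u \<otimes> (v \<otimes> a)) \<otimes> (u' \<otimes> (w \<otimes> b))" using car by algebra
    also have "\<dots> = (u \<otimes> u') \<otimes> ((s \<otimes> t) \<otimes> (c \<otimes> d))" unfolding u(2) u'(2) using car by algebra
    finally show "(c \<otimes> d, v \<otimes> w) \<in> fr (a \<otimes> b) (s \<otimes> t)"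
      unfolding fr_mem using den_mult[OF u(1) u'(1)] den_mult[OF u(4) u'(4)] car by blast
  qed (use assms den_mult in auto)
  moreover have "(a, s) \<in> fr a s" "(b, t) \<in> fr b t" using assms fr_self by auto
  ultimately have "(\<Union>(a, s)\<in>fr a s. \<Union>(b, t)\<in>fr b t. fr (a \<otimes> b) (s \<otimes> t)) = fr (a \<otimes> b) (s \<otimes> t)" by fast
  then show ?thesis unfolding localization_def by simp
qed

lemma fr_add:
  assumes "a \<in> carrier A" "s \<in> den" "b \<in> carrier A" "t \<in> den"
  shows "fr a s \<oplus>\<^bsub>Loc\<^esub> fr b t = fr (a \<otimes> t \<oplus> b \<otimes> s) (s \<otimes> t)"
proof -
  have "fr (c \<otimes> w \<oplus> d \<otimes> v) (v \<otimes> w) = fr (a \<otimes> t \<oplus> b \<otimes> s) (s \<otimes> t)"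
    if cv: "(c, v) \<in> fr a s" and dw: "(d, w) \<in> fr b t" for c v d w
  proof (rule fr_eqI)
    obtain u u' where u: "u \<in> den" "u \<otimes> (v \<otimes> a) = u \<otimes> (s \<otimes> c)" "c \<in> carrier A" "v \<in> den"
      and u': "u' \<in> den" "u' \<otimes> (w \<otimes> b) = u' \<otimes> (t \<otimes> d)" "d \<in> carrier A" "w \<in> den"
      using cv dw fr_mem by metis
    note car = assms(1,3) den_carr[OF assms(2)] den_carr[OF assms(4)] den_carr[OF u(1)] den_carr[OF u'(1)]
      u(3) u'(3) den_carr[OF u(4)] den_carr[OF u'(4)]
    have "(u \<otimes> u') \<otimes> ((v \<otimes> w) \<otimes> (a \<otimes> t \<oplus> b \<otimes> s)) =
        (u' \<otimes> w \<otimes> t) \<otimes> (u \<otimes> (v \<otimes> a)) \<oplus> (u \<otimes> v \<otimes> s) \<otimes> (u' \<otimes> (w \<otimes> b))" using car by algebra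
    also have "\<dots> = (u \<otimes> u') \<otimes> ((s \<otimes> t) \<otimes> (c \<otimes> w \<oplus> d \<otimes> v))" unfolding u(2) u'(2) using car by algebra
    finally show "(c \<otimes> w \<oplus> d \<otimes> v, v \<otimes> w) \<in> fr (a \<otimes> t \<oplus> b \<otimes> s) (s \<otimes> t)"
      unfolding fr_mem using den_mult[OF u(1) u'(1)] den_mult[OF u(4) u'(4)] car by blast
  qed (use assms den_mult den_carr in auto)
  moreover have "(a, s) \<in> fr a s" "(b, t) \<in> fr b t" using assms fr_self by auto
  ultimately have "(\<Union>(a, s)\<in>fr a s. \<Union>(b, t)\<in>fr b t. fr (a \<otimes> t \<oplus> b \<otimes> s) (s \<otimes> t)) = fr (a \<otimes> t \<oplus> b \<otimes> s) (s \<otimes> t)" by fast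
  then show ?thesis unfolding localization_def by simp
qed

lemma Loc_carrier: "carrier Loc = {fr a s | a s. a \<in> carrier A \<and> s \<in> den}"
  unfolding localization_def den_def by simp

lemma Loc_closed: "a \<in> carrier A \<Longrightarrow> s \<in> den \<Longrightarrow> fr a s \<in> carrier Loc"
  unfolding Loc_carrier by blast

lemma Loc_one: "\<one>\<^bsub>Loc\<^esub> = fr \<one> \<one>" and Loc_zero: "\<zero>\<^bsub>Loc\<^esub> = fr \<zero> \<one>"
  unfolding localization_def by simp_all

lemma LocE:
  assumes "x \<in> carrier Loc" obtains a s where "a \<in> carrier A" "s \<in> den" "x = fr a s"
  using assms unfolding Loc_carrier by blast

lemma Loc_cring: "cring Loc"
proof (rule cringI)
  note cl = den_mult den_one den_carr
  show "abelian_group Loc"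
  proof (rule abelian_groupI)
    show "\<zero>\<^bsub>Loc\<^esub> \<in> carrier Loc" unfolding Loc_zero by (intro Loc_closed) (use cl in auto)
    fix x assume "x \<in> carrier Loc"
    then obtain a s where x: "a \<in> carrier A" "s \<in> den" "x = fr a s" by (rule LocE)
    note sc = den_carr[OF x(2)]
    show "\<zero>\<^bsub>Loc\<^esub> \<oplus>\<^bsub>Loc\<^esub> x = x"
      unfolding x(3) Loc_zero using fr_add[of \<zero> \<one> a s] x sc cl by simp
    have "fr (\<ominus> a) s \<oplus>\<^bsub>Loc\<^esub> fr a s = fr (\<ominus> a \<otimes> s \<oplus> a \<otimes> s) (s \<otimes> s)" using x by (intro fr_add) auto
    also have "\<dots> = fr \<zero> \<one>" by (rule fr_eqI') (use x sc cl in \<open>auto simp: l_minus l_neg\<close>)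
    finally show "\<exists>y\<in>carrier Loc. y \<oplus>\<^bsub>Loc\<^esub> x = \<zero>\<^bsub>Loc\<^esub>"
      unfolding x(3) Loc_zero using Loc_closed[of "\<ominus> a" s] x by auto
    fix y assume "y \<in> carrier Loc"
    then obtain b t where y: "b \<in> carrier A" "t \<in> den" "y = fr b t" by (rule LocE)
    note tc = den_carr[OF y(2)]
    show "x \<oplus>\<^bsub>Loc\<^esub> y \<in> carrier Loc" unfolding x(3) y(3) fr_add[OF x(1,2) y(1,2)]
      by (intro Loc_closed) (use x y sc tc cl in auto)
    show "x \<oplus>\<^bsub>Loc\<^esub> y = y \<oplus>\<^bsub>Loc\<^esub> x"
      unfolding x(3) y(3) fr_add[OF x(1,2) y(1,2)] fr_add[OF y(1,2) x(1,2)]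
      using x y sc tc by (simp add: m_comm a_comm)
    fix z assume "z \<in> carrier Loc"
    then obtain c w where z: "c \<in> carrier A" "w \<in> den" "z = fr c w" by (rule LocE)
    note wc = den_carr[OF z(2)]
    have 1: "a \<otimes> t \<oplus> b \<otimes> s \<in> carrier A" "b \<otimes> w \<oplus> c \<otimes> t \<in> carrier A" using x y z sc tc wc by auto
    have "(a \<otimes> t \<oplus> b \<otimes> s) \<otimes> w \<oplus> c \<otimes> (s \<otimes> t) = a \<otimes> (t \<otimes> w) \<oplus> (b \<otimes> w \<oplus> c \<otimes> t) \<otimes> s"
      using x(1) y(1) z(1) sc tc wc by algebra
    then show "x \<oplus>\<^bsub>Loc\<^esub> y \<oplus>\<^bsub>Loc\<^esub> z = x \<oplus>\<^bsub>Loc\<^esub> (y \<oplus>\<^bsub>Loc\<^esub> z)"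
      unfolding x(3) y(3) z(3) fr_add[OF x(1,2) y(1,2)] fr_add[OF y(1,2) z(1,2)]
        fr_add[OF 1(1) den_mult[OF x(2) y(2)] z(1,2)] fr_add[OF x(1,2) 1(2) den_mult[OF y(2) z(2)]]
      using sc tc wc by (simp add: m_assoc)
  qed
  show "Group.comm_monoid Loc"
  proof (rule comm_monoidI)
    show "\<one>\<^bsub>Loc\<^esub> \<in> carrier Loc" unfolding Loc_one by (intro Loc_closed) (use cl in auto)
    fix x assume "x \<in> carrier Loc"
    then obtain a s where x: "a \<in> carrier A" "s \<in> den" "x = fr a s" by (rule LocE)
    note sc = den_carr[OF x(2)]
    show "\<one>\<^bsub>Loc\<^esub> \<otimes>\<^bsub>Loc\<^esub> x = x"
      unfolding x(3) Loc_one using fr_mult[of \<one> \<one> a s] x sc cl by simp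
    fix y assume "y \<in> carrier Loc"
    then obtain b t where y: "b \<in> carrier A" "t \<in> den" "y = fr b t" by (rule LocE)
    note tc = den_carr[OF y(2)]
    show "x \<otimes>\<^bsub>Loc\<^esub> y \<in> carrier Loc" unfolding x(3) y(3) fr_mult[OF x(1,2) y(1,2)]
      by (intro Loc_closed) (use x y sc tc cl in auto)
    show "x \<otimes>\<^bsub>Loc\<^esub> y = y \<otimes>\<^bsub>Loc\<^esub> x"
      unfolding x(3) y(3) fr_mult[OF x(1,2) y(1,2)] fr_mult[OF y(1,2) x(1,2)]
      using x y sc tc by (simp add: m_comm)
    fix z assume "z \<in> carrier Loc"
    then obtain c w where z: "c \<in> carrier A" "w \<in> den" "z = fr c w" by (rule LocE)
    note wc = den_carr[OF z(2)]
    show "x \<otimes>\<^bsub>Loc\<^esub> y \<otimes>\<^bsub>Loc\<^esub> z = x \<otimes>\<^bsub>Loc\<^esub> (y \<otimes>\<^bsub>Loc\<^esub> z)"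
      unfolding x(3) y(3) z(3) fr_mult[OF x(1,2) y(1,2)] fr_mult[OF y(1,2) z(1,2)]
        fr_mult[OF m_closed[OF x(1) y(1)] den_mult[OF x(2) y(2)] z(1,2)]
        fr_mult[OF x(1,2) m_closed[OF y(1) z(1)] den_mult[OF y(2) z(2)]]
      using x y z sc tc wc by (simp add: m_assoc)
  qed
  fix x y z assume "x \<in> carrier Loc" "y \<in> carrier Loc" "z \<in> carrier Loc"
  then obtain a s b t c w where x: "a \<in> carrier A" "s \<in> den" "x = fr a s"
    and y: "b \<in> carrier A" "t \<in> den" "y = fr b t" and z: "c \<in> carrier A" "w \<in> den" "z = fr c w"
    by (metis LocE)
  note car = x(1) y(1) z(1) den_carr[OF x(2)] den_carr[OF y(2)] den_carr[OF z(2)]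
  have 1: "a \<otimes> t \<oplus> b \<otimes> s \<in> carrier A" using car by auto
  show "(x \<oplus>\<^bsub>Loc\<^esub> y) \<otimes>\<^bsub>Loc\<^esub> z = x \<otimes>\<^bsub>Loc\<^esub> z \<oplus>\<^bsub>Loc\<^esub> y \<otimes>\<^bsub>Loc\<^esub> z"
    unfolding x(3) y(3) z(3) fr_add[OF x(1,2) y(1,2)] fr_mult[OF y(1,2) z(1,2)] fr_mult[OF x(1,2) z(1,2)]
      fr_mult[OF 1 den_mult[OF x(2) y(2)] z(1,2)]
      fr_add[OF m_closed[OF x(1) z(1)] den_mult[OF x(2) z(2)] m_closed[OF y(1) z(1)] den_mult[OF y(2) z(2)]]
  proof (rule fr_eqI')
    show "(s \<otimes> w) \<otimes> (t \<otimes> w) \<otimes> ((a \<otimes> t \<oplus> b \<otimes> s) \<otimes> c) =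
      s \<otimes> t \<otimes> w \<otimes> (a \<otimes> c \<otimes> (t \<otimes> w) \<oplus> b \<otimes> c \<otimes> (s \<otimes> w))"
      using car by algebra
  qed (use car x y z cl in auto)
qed

sublocale Loc: cring Loc by (rule Loc_cring)

text \<open>The fractions having some numerator in \<open>P\<close> form an ideal \<open>M\<close>,
  which contains the generators of the extended ideal. Primeness of \<open>P\<close> shows that the
  choice of the fraction does not matter: \<open>u \<otimes> t \<otimes> a \<in> P\<close> with
  denominators \<open>u\<close> and \<open>t\<close> forces \<open>a \<in> P\<close>.\<close>

lemma local_ideal_iff:
  assumes "a \<in> carrier A" "s \<in> den" shows "fr a s \<in> J \<longleftrightarrow> a \<in> P"
proof
  have gens: "(\<lambda>x. fr x \<one>) ` P \<subseteq> carrier Loc" using Loc_closed den_one Icarr by auto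
  have Jid: "ideal J Loc" unfolding local_ideal_def by (rule Loc.genideal_ideal[OF gens])
  {
    assume "a \<in> P"
    then have "fr a \<one> \<in> J" unfolding local_ideal_def using Loc.genideal_self[OF gens] by blast
    then have "fr \<one> s \<otimes>\<^bsub>Loc\<^esub> fr a \<one> \<in> J" using assms by (intro ideal.I_l_closed[OF Jid] Loc_closed) auto
    then show "fr a s \<in> J" using fr_mult[of \<one> s a \<one>] assms den_one den_carr by simp
  }
  define M where "M = {fr a s | a s. a \<in> P \<and> s \<in> den}"
  have "ideal M Loc"
  proof (intro Loc.submod_ideal Loc.submodI)
    show "M \<subseteq> carrier Loc" unfolding M_def using Loc_closed Icarr by blast
    show "\<zero>\<^bsub>Loc\<^esub> \<in> M" unfolding M_def Loc_zero using P_zero den_one by blast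
  next
    fix x y assume "x \<in> M" "y \<in> M"
    then obtain b t c w where x: "b \<in> P" "t \<in> den" "x = fr b t" and y: "c \<in> P" "w \<in> den" "y = fr c w"
      unfolding M_def by blast
    have "x \<oplus>\<^bsub>Loc\<^esub> y = fr (b \<otimes> w \<oplus> c \<otimes> t) (t \<otimes> w)" unfolding x(3) y(3) by (rule fr_add) (use x y Icarr in auto)
    moreover have "b \<otimes> w \<oplus> c \<otimes> t \<in> P" using x y den_carr by (intro P_add I_r_closed) auto
    ultimately show "x \<oplus>\<^bsub>Loc\<^esub> y \<in> M" unfolding M_def using den_mult[OF x(2) y(2)] by blast
  next
    fix x y assume yL: "y \<in> carrier Loc" and "x \<in> M"
    then obtain b t where x: "b \<in> P" "t \<in> den" "x = fr b t" unfolding M_def by blast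
    obtain c w where y: "c \<in> carrier A" "w \<in> den" "y = fr c w" using yL by (rule LocE)
    have "y \<otimes>\<^bsub>Loc\<^esub> x = fr (c \<otimes> b) (w \<otimes> t)" unfolding x(3) y(3) by (rule fr_mult) (use x y Icarr in auto)
    then show "y \<otimes>\<^bsub>Loc\<^esub> x \<in> M" unfolding M_def using I_l_closed[OF x(1) y(1)] den_mult[OF y(2) x(2)] by blast
  qed
  moreover have "(\<lambda>x. fr x \<one>) ` P \<subseteq> M" unfolding M_def using den_one by blast
  ultimately have JM: "J \<subseteq> M" unfolding local_ideal_def by (rule Loc.genideal_minimal)
  assume "fr a s \<in> J"
  then obtain b t where b: "fr a s = fr b t" "b \<in> P" "t \<in> den" using JM unfolding M_def by blast
  then obtain u where u: "u \<in> den" "u \<otimes> (t \<otimes> a) = u \<otimes> (s \<otimes> b)" using fr_eq_iff[OF assms Icarr[OF b(2)] b(3)] by blast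
  have "u \<otimes> (s \<otimes> b) \<in> P" using b(2) u(1) assms(2) den_carr by (intro I_l_closed) auto
  then have "u \<otimes> t \<otimes> a \<in> P" using u(2) assms(1) den_carr[OF u(1)] den_carr[OF b(3)] by (simp add: m_assoc)
  then show "a \<in> P" using I_prime[of "u \<otimes> t" a] den_mult[OF u(1) b(3)] den_carr den_not assms(1) by blast
qed

lemma local_ideal_ideal: "ideal J Loc"
  unfolding local_ideal_def using Loc_closed den_one Icarr by (intro Loc.genideal_ideal) auto

sublocale J: ideal J Loc by (rule local_ideal_ideal)

sublocale L: cring L unfolding residue_field_def by (rule J.quotient_is_cring[OF Loc.is_cring])

section \<open>The residue field and the canonical map to it\<close>

definition cls :: "'a \<Rightarrow> 'a \<Rightarrow> ('a \<times> 'a) set set" where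
  "cls a s = J +>\<^bsub>Loc\<^esub> fr a s"

lemma cls_hom: "(\<lambda>x. J +>\<^bsub>Loc\<^esub> x) \<in> ring_hom Loc L"
  unfolding residue_field_def by (rule J.rcos_ring_hom)

lemma L_carrier: "carrier L = {cls a s | a s. a \<in> carrier A \<and> s \<in> den}"
  unfolding residue_field_def FactRing_def A_RCOSETS_def' cls_def by (auto simp: Loc_carrier)

lemma LE:
  assumes "x \<in> carrier L" obtains a s where "a \<in> carrier A" "s \<in> den" "x = cls a s"
  using assms unfolding L_carrier by blast

lemma cls_closed: "a \<in> carrier A \<Longrightarrow> s \<in> den \<Longrightarrow> cls a s \<in> carrier L"
  unfolding L_carrier by blast

lemma cls_mult:
  assumes "a \<in> carrier A" "s \<in> den" "b \<in> carrier A" "t \<in> den"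
  shows "cls a s \<otimes>\<^bsub>L\<^esub> cls b t = cls (a \<otimes> b) (s \<otimes> t)"
  using ring_hom_mult[OF cls_hom Loc_closed[OF assms(1,2)] Loc_closed[OF assms(3,4)]] fr_mult[OF assms]
  unfolding cls_def by simp

lemma cls_add:
  assumes "a \<in> carrier A" "s \<in> den" "b \<in> carrier A" "t \<in> den"
  shows "cls a s \<oplus>\<^bsub>L\<^esub> cls b t = cls (a \<otimes> t \<oplus> b \<otimes> s) (s \<otimes> t)"
  using ring_hom_add[OF cls_hom Loc_closed[OF assms(1,2)] Loc_closed[OF assms(3,4)]] fr_add[OF assms]
  unfolding cls_def by simp

lemma cls_one: "cls \<one> \<one> = \<one>\<^bsub>L\<^esub>"
  using ring_hom_one[OF cls_hom] unfolding cls_def Loc_one .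

lemma cls_zero_iff:
  assumes "a \<in> carrier A" "s \<in> den" shows "cls a s = \<zero>\<^bsub>L\<^esub> \<longleftrightarrow> a \<in> P"
proof -
  have "\<zero>\<^bsub>L\<^esub> = J" unfolding residue_field_def FactRing_def by simp
  then show ?thesis
    using J.rcos_const_imp_mem[OF Loc_closed[OF assms]] Loc.a_rcos_zero[OF J.is_ideal, of "fr a s"]
      local_ideal_iff[OF assms] unfolding cls_def by auto
qed

lemma cls_cancel: "s \<in> den \<Longrightarrow> cls s s = \<one>\<^bsub>L\<^esub>"
proof -
  assume s: "s \<in> den"
  then have "fr s s = fr \<one> \<one>" using den_carr[OF s] by (intro fr_eqI') (auto simp: den_one)
  then show ?thesis using cls_one unfolding cls_def by simp
qed

lemma L_field: "field L"
proof (rule L.cring_fieldI2)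
  have "\<one> \<notin> P" using den_one den_not by blast
  then show "\<zero>\<^bsub>L\<^esub> \<noteq> \<one>\<^bsub>L\<^esub>" using cls_zero_iff[OF one_closed den_one] cls_one by metis
  fix x assume "x \<in> carrier L" "x \<noteq> \<zero>\<^bsub>L\<^esub>"
  then obtain a s where x: "a \<in> carrier A" "s \<in> den" "x = cls a s" using LE by metis
  then have a: "a \<in> den" using cls_zero_iff \<open>x \<noteq> _\<close> unfolding den_def by blast
  have "x \<otimes>\<^bsub>L\<^esub> cls s a = cls (a \<otimes> s) (a \<otimes> s)"
    unfolding x(3) using cls_mult[OF x(1,2) den_carr[OF x(2)] a] m_comm x a den_carr by simp
  then have "x \<otimes>\<^bsub>L\<^esub> cls s a = \<one>\<^bsub>L\<^esub>" using cls_cancel[OF den_mult[OF a x(2)]] by simp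
  then show "\<exists>y\<in>carrier L. x \<otimes>\<^bsub>L\<^esub> y = \<one>\<^bsub>L\<^esub>" using cls_closed[OF den_carr[OF x(2)] a] by blast
qed

sublocale L: field L by (rule L_field)

definition \<pi> :: "'a \<Rightarrow> ('a \<times> 'a) set set" where "\<pi> a = cls a \<one>"

lemma pi_hom: "\<pi> \<in> ring_hom A L"
  by (rule ring_hom_memI) (auto simp: \<pi>_def den_one cls_closed cls_mult cls_add cls_one)

sublocale \<pi>: ring_hom_cring A L \<pi> by (intro ring_hom_cringI is_cring L.is_cring pi_hom)

lemma pi_zero_iff: "a \<in> carrier A \<Longrightarrow> \<pi> a = \<zero>\<^bsub>L\<^esub> \<longleftrightarrow> a \<in> P"
  unfolding \<pi>_def using cls_zero_iff den_one by blast

text \<open>Characterizes the class of a fraction by an equation between images under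
  \<open>\<pi>\<close>, so that later computations in the residue field need no
  representatives.\<close>

lemma cls_iff:
  assumes "a \<in> carrier A" "s \<in> den" "x \<in> carrier L"
  shows "x = cls a s \<longleftrightarrow> \<pi> s \<otimes>\<^bsub>L\<^esub> x = \<pi> a"
proof -
  have "fr (s \<otimes> a) s = fr a \<one>"
    by (rule fr_eqI') (use assms den_one den_carr in auto)
  then have e: "\<pi> s \<otimes>\<^bsub>L\<^esub> cls a s = \<pi> a"
    unfolding \<pi>_def using assms den_one den_carr cls_mult[of s \<one> a s] by (simp add: cls_def)
  have "\<pi> s \<noteq> \<zero>\<^bsub>L\<^esub>" using assms(2) pi_zero_iff den_carr den_not by blast
  then show ?thesis
    using L.m_lcancel[of "\<pi> s" x "cls a s"] e assms cls_closed den_carr by auto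
qed

end

text \<open>Replaces the abstractly given base field by an explicit set of classes. Both maps
  involved are unions over representatives, so the point is that the value is constant: a member of
  the class of \<open>a/s\<close> is \<open>c/w + a/s\<close> with
  \<open>c \<in> Q \<inter> R\<close>, and \<open>c/w\<close> dies in the residue field of
  \<open>S\<close>.\<close>

lemma residual_map_image:
  fixes S (structure)
  assumes Q: "primeideal Q S" and R: "subring R S"
  shows "residual_map S Q ` carrier (residue_field (S\<lparr>carrier := R\<rparr>) (Q \<inter> R)) =
    {localized_ring.cls Q S a s | a s. a \<in> R \<and> s \<in> R - Q}"
proof -
  interpret Q: localized_ring Q S unfolding localized_ring_def by (rule Q)
  note Rs = subringE[OF R]
  have Rc: "x \<in> R \<Longrightarrow> x \<in> carrier S" for x using Rs(1) by blast
  have cR: "cring (S\<lparr>carrier := R\<rparr>)"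
    using Q.subcringI'[OF R] Q.subcring_iff[OF Rs(1)] by simp
  have not1: "\<one> \<notin> Q" using Q.den_one Q.den_not by blast
  have "primeideal (Q \<inter> R) (S\<lparr>carrier := R\<rparr>)"
  proof (rule primeidealI)
    interpret RR: cring "S\<lparr>carrier := R\<rparr>" by (rule cR)
    show "ideal (Q \<inter> R) (S\<lparr>carrier := R\<rparr>)"
      by (intro RR.submod_ideal RR.submodI) (use Q.P_zero Rs(2,6,7) Q.P_add Rc Q.I_l_closed in auto)
    show "carrier (S\<lparr>carrier := R\<rparr>) \<noteq> Q \<inter> R" using not1 Rs(3) by auto
    show "a \<in> Q \<inter> R \<or> b \<in> Q \<inter> R" if "a \<in> carrier (S\<lparr>carrier := R\<rparr>)" "b \<in> carrier (S\<lparr>carrier := R\<rparr>)"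
      "a \<otimes>\<^bsub>S\<lparr>carrier := R\<rparr>\<^esub> b \<in> Q \<inter> R" for a b using that Q.I_prime Rc by auto
  qed (rule cR)
  then interpret P: localized_ring "Q \<inter> R" "S\<lparr>carrier := R\<rparr>" unfolding localized_ring_def .
  have den: "P.den = R - Q" unfolding P.den_def by auto
  have den_sub: "s \<in> P.den \<Longrightarrow> s \<in> Q.den" for s unfolding den Q.den_def using Rc by auto
  have lm: "local_map S Q (P.fr a s) = Q.fr a s" if a: "a \<in> R" and s: "s \<in> P.den" for a s
  proof -
    have "Q.fr b t = Q.fr a s" if "(b, t) \<in> P.fr a s" for b t
    proof (rule Q.fr_eqI)
      show "(b, t) \<in> Q.fr a s" using that den_sub Rc unfolding P.fr_mem Q.fr_mem by auto
    qed (use a s Rc den_sub in auto)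
    moreover have "(a, s) \<in> P.fr a s" using P.fr_self a s by simp
    ultimately show ?thesis unfolding local_map_def by fast
  qed
  have rm: "residual_map S Q (P.cls a s) = Q.cls a s" if a: "a \<in> R" and s: "s \<in> P.den" for a s
  proof -
    note as = Rc[OF a] den_sub[OF s]
    have "Q.J +>\<^bsub>Q.Loc\<^esub> local_map S Q U = Q.cls a s" if "U \<in> P.cls a s" for U
    proof -
      from that obtain j where j: "j \<in> P.J" "U = j \<oplus>\<^bsub>P.Loc\<^esub> P.fr a s" unfolding P.cls_def a_r_coset_def' by auto
      from P.J.Icarr[OF j(1)] obtain c w where c0: "c \<in> carrier (S\<lparr>carrier := R\<rparr>)" "w \<in> P.den" "j = P.fr c w" by (rule P.LocE)
      then have c: "c \<in> R" "w \<in> P.den" "j = P.fr c w" by simp_all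
      have cQ: "c \<in> Q" using P.local_ideal_iff[OF c0(1,2)] j(1) unfolding c(3) by simp
      note cw = Rc[OF c(1)] den_sub[OF c(2)]
      have "U = P.fr (c \<otimes> s \<oplus> a \<otimes> w) (w \<otimes> s)" using P.fr_add[of c w a s] c a s j(2) by simp
      moreover have "c \<otimes> s \<oplus> a \<otimes> w \<in> R" "w \<otimes> s \<in> P.den" using c a s Rs(6,7) P.den_mult[OF c(2) s] unfolding den by auto
      ultimately have "local_map S Q U = Q.fr (c \<otimes> s \<oplus> a \<otimes> w) (w \<otimes> s)" using lm by simp
      also have "\<dots> = Q.fr c w \<oplus>\<^bsub>Q.Loc\<^esub> Q.fr a s" using Q.fr_add[OF cw as] by simp
      finally have e: "local_map S Q U = Q.fr c w \<oplus>\<^bsub>Q.Loc\<^esub> Q.fr a s" .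
      have "Q.J +>\<^bsub>Q.Loc\<^esub> (Q.fr c w \<oplus>\<^bsub>Q.Loc\<^esub> Q.fr a s) = Q.cls c w \<oplus>\<^bsub>Q.L\<^esub> Q.cls a s"
        using Q.cls_add[OF cw as] Q.fr_add[OF cw as] unfolding Q.cls_def by simp
      also have "\<dots> = Q.cls a s" using Q.cls_zero_iff[OF cw] cQ Q.cls_closed[OF as] by simp
      finally show ?thesis unfolding e .
    qed
    \<comment> \<open>A union of a constant value equals that value only over a nonempty
      class.\<close>
    moreover have "P.cls a s \<noteq> {}" using P.J.a_rcos_self[OF P.Loc_closed[of a s]] a s unfolding P.cls_def by auto
    ultimately show ?thesis unfolding residual_map_def by auto
  qed
  have "residual_map S Q ` carrier P.L = {residual_map S Q (P.cls a s) | a s. a \<in> R \<and> s \<in> P.den}"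
    unfolding P.L_carrier by auto
  also have "\<dots> = {Q.cls a s | a s. a \<in> R \<and> s \<in> R - Q}" unfolding den[symmetric] using rm by (metis (no_types, lifting))
  finally show ?thesis .
qed

section \<open>Derivatives of polynomials and separability\<close>

context ring begin

lemma normalize_eq_Nil: "normalize p = [] \<Longrightarrow> set p \<subseteq> {\<zero>}"
  by (induction p) (auto split: if_splits)

lemma length_normalize: "length (normalize p) \<le> length p"
  by (induction p) auto

lemma deriv_coeffs_Cons:
  assumes "q \<noteq> []"
  shows "map (\<lambda>i. [i] \<cdot> coeff (a # q) i) (rev [1..<length (a # q)]) =
    ([length q] \<cdot> a) # map (\<lambda>i. [i] \<cdot> coeff q i) (rev [1..<length q])"
proof -
  have "length q \<ge> 1" using assms by (cases q) auto
  then have "[1..<length (a # q)] = [1..<length q] @ [length q]" by simp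
  moreover have "map (\<lambda>i. [i] \<cdot> coeff (a # q) i) (rev [1..<length q]) = map (\<lambda>i. [i] \<cdot> coeff q i) (rev [1..<length q])"
    by (rule map_cong) auto
  ultimately show ?thesis by simp
qed

lemma coeff_in_subset: "set p \<subseteq> K \<Longrightarrow> \<zero> \<in> K \<Longrightarrow> coeff p i \<in> K"
  by (induction p) auto

lemma subring_add_pow: "subring K R \<Longrightarrow> a \<in> K \<Longrightarrow> [(n::nat)] \<cdot> a \<in> K"
  by (induction n) (auto simp: subringE)

lemma poly_deriv_closed:
  assumes K: "subring K R" and p: "set p \<subseteq> K"
  shows "poly_deriv R p \<in> carrier (K[X])"
proof -
  have "set (map (\<lambda>i. [i] \<cdot> coeff p i) (rev [1..<length p])) \<subseteq> K"
    using coeff_in_subset[OF p subringE(2)[OF K]] subring_add_pow[OF K] by auto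
  then show ?thesis
    unfolding poly_deriv_def univ_poly_def using normalize_gives_polynomial subringE(1)[OF K] by auto
qed

lemma length_poly_deriv: "length (poly_deriv R p) \<le> length p - 1"
  unfolding poly_deriv_def using length_normalize[of "map (\<lambda>i. [i] \<cdot> coeff p i) (rev [1..<length p])"] by simp

lemma eval_poly_deriv:
  assumes p: "set p \<subseteq> carrier R" and x: "x \<in> carrier R"
  shows "eval (poly_deriv R p) x = deriv_eval p x"
proof -
  have "eval (map (\<lambda>i. [i] \<cdot> coeff p i) (rev [1..<length p])) x = deriv_eval p x"
    using p
  proof (induction p)
    case (Cons a q)
    show ?case
    proof (cases "q = []")
      case True
      then show ?thesis using Cons.prems by simp
    next
      case False
      have a: "a \<in> carrier R" using Cons.prems by simp
      have "[length q] \<cdot> a \<otimes> x [^] (length q - 1) = a \<otimes> ([length q] \<cdot> (x [^] (length q - 1)))"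
        using a x add_pow_ldistr[of a "x [^] (length q - 1)" "length q"] add_pow_rdistr[of a "x [^] (length q - 1)" "length q"] by simp
      then show ?thesis unfolding deriv_coeffs_Cons[OF False] using Cons by simp
    qed
  qed simp
  moreover have "set (map (\<lambda>i. [i] \<cdot> coeff p i) (rev [1..<length p])) \<subseteq> carrier R"
    using coeff_in_subset[OF p] by auto
  ultimately show ?thesis unfolding poly_deriv_def using eval_normalize x by simp
qed

lemma eval_scale:
  assumes "c \<in> carrier R" "set p \<subseteq> carrier R" "x \<in> carrier R"
  shows "eval (map ((\<otimes>) c) p) x = c \<otimes> eval p x"
  using assms(2) by (induction p) (use assms in \<open>auto simp: r_distr m_assoc eval_in_carrier\<close>)

lemma deriv_eval_scale:
  assumes "c \<in> carrier R" "set p \<subseteq> carrier R" "x \<in> carrier R"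
  shows "deriv_eval (map ((\<otimes>) c) p) x = c \<otimes> deriv_eval p x"
  using assms(2) by (induction p) (use assms in \<open>auto simp: r_distr m_assoc deriv_eval_closed\<close>)

end

context ring_hom_cring begin

lemma hom_add_pow: "a \<in> carrier R \<Longrightarrow> h ([(n::nat)] \<cdot> a) = [n] \<cdot>\<^bsub>S\<^esub> h a"
  by (induction n) auto

lemma hom_eval:
  assumes "set p \<subseteq> carrier R" "x \<in> carrier R"
  shows "h (R.eval p x) = S.eval (map h p) (h x)"
  using assms(1) by (induction p) (use assms in \<open>auto simp: R.eval_in_carrier hom_nat_pow\<close>)

lemma hom_deriv_eval:
  assumes "set p \<subseteq> carrier R" "x \<in> carrier R"
  shows "h (R.deriv_eval p x) = S.deriv_eval (map h p) (h x)"
  using assms(1) by (induction p) (use assms in \<open>auto simp: R.deriv_eval_closed hom_nat_pow hom_add_pow\<close>)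

end

text \<open>If the derivative of the minimal polynomial \<open>f\<close> vanishes at
  \<open>x\<close>, then \<open>f\<close> divides it and is a common divisor that is not a unit.
  Conversely, a common divisor that is not a unit is associated to the irreducible \<open>f\<close>,
  so \<open>f\<close> divides its derivative, which then vanishes at \<open>x\<close>.\<close>

lemma (in field) separable_Irr_iff:
  assumes K: "subfield K R" and x: "x \<in> carrier R" and alg: "algebraic K x"
  shows "separable_poly R K (Irr K x) \<longleftrightarrow> deriv_eval (Irr K x) x \<noteq> \<zero>"
proof -
  let ?f = "Irr K x" and ?d = "poly_deriv R (Irr K x)"
  interpret UP: principal_domain "K[X]" by (rule univ_poly_is_principal[OF K])
  have alg': "(algebraic over K) x" using alg by (simp add: over_def)
  note Irr = IrrE[OF K x alg']
  have fK: "set ?f \<subseteq> K" using Irr(1) unfolding univ_poly_def polynomial_def by auto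
  then have fc: "set ?f \<subseteq> carrier R" using subfieldE(3)[OF K] by blast
  have d: "?d \<in> carrier (K[X])" by (rule poly_deriv_closed[OF subfieldE(1)[OF K] fK])
  have ed: "eval ?d x = deriv_eval ?f x" by (rule eval_poly_deriv[OF fc x])
  have irr: "irreducible (K[X]) ?f" using Irr(2) unfolding ring_irreducible_def by simp
  then have not_unit: "?f \<notin> Units (K[X])" unfolding irreducible_def by simp
  show ?thesis
  proof
    assume sep: "separable_poly R K ?f"
    show "deriv_eval ?f x \<noteq> \<zero>"
    proof
      assume "deriv_eval ?f x = \<zero>"
      then have "?f pdivides ?d" using Irr_minimal[OF K x alg' d] ed by simp
      then have "?f divides\<^bsub>K[X]\<^esub> ?d" using pdivides_iff_shell[OF K Irr(1) d] by simp
      then have "?f \<in> Units (K[X])" using sep Irr(1) UP.divides_refl[OF Irr(1)] unfolding separable_poly_def by blast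
      then show False using not_unit by simp
    qed
  next
    assume ne: "deriv_eval ?f x \<noteq> \<zero>"
    show "separable_poly R K ?f"
      unfolding separable_poly_def
    proof (intro ballI impI)
      fix g assume g: "g \<in> carrier (K[X])" and div: "g divides\<^bsub>K[X]\<^esub> ?f \<and> g divides\<^bsub>K[X]\<^esub> ?d"
      show "g \<in> Units (K[X])"
      proof (cases "?f divides\<^bsub>K[X]\<^esub> g")
        case True
        then have "?f divides\<^bsub>K[X]\<^esub> ?d" using div UP.divides_trans Irr(1) by blast
        then obtain q where q: "q \<in> carrier (K[X])" "?d = ?f \<otimes>\<^bsub>K[X]\<^esub> q" unfolding factor_def by blast
        have "eval ?d x = eval ?f x \<otimes> eval q x"
          unfolding q(2) using ring_hom_mult[OF eval_is_hom[OF subfieldE(1)[OF K] x] Irr(1) q(1)] by simp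
        also have "\<dots> = \<zero>" using Irr(4) ring_hom_closed[OF eval_is_hom[OF subfieldE(1)[OF K] x] q(1)] by simp
        finally show ?thesis using ne ed by simp
      next
        case False
        then show ?thesis using irr div g unfolding irreducible_def properfactor_def by simp
      qed
    qed
  qed
qed

section \<open>Prime powers of sums in a commutative ring\<close>

context cring begin

lemma binomial_sum:
  assumes x: "x \<in> carrier R" and y: "y \<in> carrier R"
  shows "(x \<oplus> y) [^] n = (\<Oplus>k\<in>{..n}. add_pow R (n choose k) (x [^] k \<otimes> y [^] (n - k)))"
proof (induction n)
  case (Suc n)
  let ?g = "\<lambda>n k. add_pow R (n choose k) (x [^] k \<otimes> y [^] (n - k))"
  let ?h = "\<lambda>k. add_pow R (n choose k) (x [^] k \<otimes> y [^] (Suc n - k))"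
  have gc: "?g n \<in> Y \<rightarrow> carrier R" "?h \<in> Y \<rightarrow> carrier R" for n Y using x y by auto
  have s1: "x \<otimes> (x \<oplus> y) [^] n = (\<Oplus>k\<in>{..n}. add_pow R (n choose k) (x [^] Suc k \<otimes> y [^] (n - k)))"
    unfolding Suc.IH using x gc
    by (subst finsum_rdistr) (auto intro!: finsum_cong' simp: add_pow_rdistr x y m_ac)
  have s2: "y \<otimes> (x \<oplus> y) [^] n = (\<Oplus>k\<in>{..n}. ?h k)"
    unfolding Suc.IH using y gc
    by (subst finsum_rdistr) (auto intro!: finsum_cong' simp: add_pow_rdistr x y m_ac Suc_diff_le)
  have "(\<Oplus>k\<in>{..Suc n}. ?h k) = (\<Oplus>k\<in>{..n}. ?h k)"
    using finsum_Suc[of ?h n] gc x y by (simp add: binomial_eq_0)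
  moreover have "(\<Oplus>k\<in>{..Suc n}. ?h k) = (\<Oplus>k\<in>{..n}. ?h (Suc k)) \<oplus> ?h 0"
    using finsum_Suc2[of ?h n] gc by simp
  ultimately have s3: "(\<Oplus>k\<in>{..n}. ?h k) = (\<Oplus>k\<in>{..n}. ?h (Suc k)) \<oplus> ?h 0" by simp
  have "(\<Oplus>k\<in>{..Suc n}. ?g (Suc n) k) = (\<Oplus>k\<in>{..n}. ?g (Suc n) (Suc k)) \<oplus> ?g (Suc n) 0"
    using finsum_Suc2[of "?g (Suc n)" n] gc by simp
  also have "(\<Oplus>k\<in>{..n}. ?g (Suc n) (Suc k)) =
      (\<Oplus>k\<in>{..n}. add_pow R (n choose k) (x [^] Suc k \<otimes> y [^] (n - k)) \<oplus> ?h (Suc k))"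
    by (rule finsum_cong') (use x y in \<open>auto simp: add.nat_pow_mult simp del: nat_pow_Suc\<close>)
  also have "\<dots> = (\<Oplus>k\<in>{..n}. add_pow R (n choose k) (x [^] Suc k \<otimes> y [^] (n - k))) \<oplus> (\<Oplus>k\<in>{..n}. ?h (Suc k))"
    by (rule finsum_addf) (use x y in auto)
  finally have "(\<Oplus>k\<in>{..Suc n}. ?g (Suc n) k) = x \<otimes> (x \<oplus> y) [^] n \<oplus> ((\<Oplus>k\<in>{..n}. ?h (Suc k)) \<oplus> ?h 0)"
    unfolding s1 using x y by (simp add: a_assoc)
  also have "\<dots> = (x \<oplus> y) [^] n \<otimes> (x \<oplus> y)"
    unfolding s3[symmetric] s2[symmetric] using x y l_distr[of x y "(x \<oplus> y) [^] n"] m_comm[of "x \<oplus> y" "(x \<oplus> y) [^] n"] by simp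
  finally show ?case by simp
qed (simp add: x y)

text \<open>The error term \<open>p z\<close> is kept because the tensor square, where the formula
  is applied, need not have characteristic \<open>p\<close>. Only the residue field has it, and the
  error disappears after mapping there.\<close>

lemma freshman_dream:
  assumes x: "x \<in> carrier R" and y: "y \<in> carrier R" and p: "Factorial_Ring.prime (p::nat)"
  obtains z where "z \<in> carrier R" "(x \<oplus> y) [^] p = x [^] p \<oplus> y [^] p \<oplus> [p] \<cdot> z"
proof -
  let ?g = "\<lambda>k. add_pow R (p choose k) (x [^] k \<otimes> y [^] (p - k))"
  \<comment> \<open>With \<open>p = m + 2\<close> the inner binomial coefficients are those at
    \<open>Suc k\<close> for \<open>k \<le> m\<close>; each is divisible by \<open>p\<close>, and
    the quotients are collected in \<open>?z\<close>.\<close>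
  obtain m where m: "p = Suc (Suc m)"
    using prime_ge_2_nat[OF p] by (metis add_2_eq_Suc le_Suc_ex)
  let ?z = "\<Oplus>k\<in>{..m}. add_pow R ((p choose Suc k) div p) (x [^] Suc k \<otimes> y [^] (p - Suc k))"
  have z: "?z \<in> carrier R" using x y by (intro finsum_closed) auto
  have gc: "?g \<in> Y \<rightarrow> carrier R" for Y using x y by auto
  have "(x \<oplus> y) [^] p = (\<Oplus>k\<in>{..Suc (Suc m)}. ?g k)" using binomial_sum[OF x y, of p] m by simp
  also have "\<dots> = ?g p \<oplus> (\<Oplus>k\<in>{..Suc m}. ?g k)" using finsum_Suc[of ?g "Suc m"] gc m by simp
  also have "(\<Oplus>k\<in>{..Suc m}. ?g k) = (\<Oplus>k\<in>{..m}. ?g (Suc k)) \<oplus> ?g 0" using finsum_Suc2[of ?g m] gc by simp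
  also have "(\<Oplus>k\<in>{..m}. ?g (Suc k)) = (\<Oplus>k\<in>{..m}. ([p] \<cdot> \<one>) \<otimes> (add_pow R ((p choose Suc k) div p) (x [^] Suc k \<otimes> y [^] (p - Suc k))))"
  proof (rule finsum_cong')
    fix k assume "k \<in> {..m}"
    then have "p dvd (p choose Suc k)" using p m by (intro dvd_choose_prime) auto
    then have e: "p choose Suc k = (p choose Suc k) div p * p" by simp
    have w: "x [^] Suc k \<otimes> y [^] (p - Suc k) \<in> carrier R" using x y by simp
    show "?g (Suc k) = ([p] \<cdot> \<one>) \<otimes> (add_pow R ((p choose Suc k) div p) (x [^] Suc k \<otimes> y [^] (p - Suc k)))"
      using w by (subst e) (simp add: add_pow_ldistr add.nat_pow_pow del: nat_pow_Suc)
  qed (use x y in auto)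
  also have "\<dots> = ([p] \<cdot> \<one>) \<otimes> ?z" by (rule finsum_rdistr[symmetric]) (use x y in auto)
  also have "\<dots> = [p] \<cdot> ?z" using z add_pow_ldistr[of \<one> ?z p] by simp
  finally have "(x \<oplus> y) [^] p = x [^] p \<oplus> y [^] p \<oplus> [p] \<cdot> ?z"
    using x y z m by (simp add: a_ac del: nat_pow_Suc)
  then show ?thesis using that z by blast
qed

text \<open>Obtained from the sum \<open>x = (x \<ominus> y) \<oplus> y\<close>, so that no sign of
  the form \<open>(-1)^p\<close> has to be discussed.\<close>

lemma freshman_dream_minus:
  assumes x: "x \<in> carrier R" and y: "y \<in> carrier R" and p: "Factorial_Ring.prime (p::nat)"
  obtains z where "z \<in> carrier R" "(x \<ominus> y) [^] p = (x [^] p \<ominus> y [^] p) \<ominus> [p] \<cdot> z"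
proof -
  obtain z where z: "z \<in> carrier R" "((x \<ominus> y) \<oplus> y) [^] p = (x \<ominus> y) [^] p \<oplus> y [^] p \<oplus> [p] \<cdot> z"
    using freshman_dream[of "x \<ominus> y" y p] x y p by blast
  have "(x \<ominus> y) \<oplus> y = x" using x y by algebra
  then have e: "x [^] p = (x \<ominus> y) [^] p \<oplus> y [^] p \<oplus> [p] \<cdot> z" using z(2) by simp
  define a b c where "a = (x \<ominus> y) [^] p" and "b = y [^] p" and "c = [p] \<cdot> z"
  have abc: "a \<in> carrier R" "b \<in> carrier R" "c \<in> carrier R" unfolding a_def b_def c_def using x y z by auto
  have "a = ((a \<oplus> b \<oplus> c) \<ominus> b) \<ominus> c" using abc by algebra
  then have "(x \<ominus> y) [^] p = (x [^] p \<ominus> y [^] p) \<ominus> [p] \<cdot> z" using e unfolding a_def b_def c_def by simp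
  then show ?thesis using that z by blast
qed

end

section \<open>Inseparable extensions\<close>

lemma (in ring) dependent_shorter_base:
  assumes K: "subfield K R" and "set Us \<subseteq> carrier R"
  shows "\<exists>Vs. independent K Vs \<and> Span K Vs = Span K Us \<and> length Vs \<le> length Us \<and>
    (dependent K Us \<longrightarrow> length Vs < length Us)"
  using assms(2)
proof (induction Us)
  case Nil
  then show ?case by auto
next
  case (Cons u Us)
  then obtain Vs where Vs: "independent K Vs" "Span K Vs = Span K Us" "length Vs \<le> length Us"
    "dependent K Us \<longrightarrow> length Vs < length Us" by auto
  have u: "u \<in> carrier R" using Cons.prems by simp
  show ?case
  proof (cases "u \<in> Span K Us")
    case True
    then have "Span K (u # Us) = Span K Us"
      using Span_base_incl[OF K] mono_Span_subset[OF K] Cons.prems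
      by (metis insert_subset list.simps(15) subset_antisym)
    then show ?thesis using Vs by (intro exI[of _ Vs]) auto
  next
    case False
    have "Span K (u # Vs) = Span K (u # Us)" using Vs(2) by simp
    moreover have "independent K (u # Vs)" using li_Cons[OF u _ Vs(1)] False Vs(2) by simp
    moreover have "dependent K (u # Us) \<longrightarrow> length Vs < length Us"
      using Vs(4) li_Cons[OF u False] by blast
    ultimately show ?thesis using Vs(3) by (intro exI[of _ "u # Vs"]) auto
  qed
qed

text \<open>A dependent spanning list could be thinned out to a strictly shorter basis,
  contradicting uniqueness of the dimension.\<close>

lemma (in ring) spanning_imp_independent:
  assumes K: "subfield K R" and "dimension n K E" and "set Us \<subseteq> carrier R" "Span K Us = E" "length Us = n"
  shows "independent K Us"
proof (rule ccontr)
  assume "dependent K Us"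
  then obtain Vs where "independent K Vs" "Span K Vs = E" "length Vs < n"
    using dependent_shorter_base[OF K assms(3)] assms(4,5) by auto
  then show False using dimensionI[OF K, of Vs E] dimension_is_inj[OF K assms(2)] by auto
qed

text \<open>Coefficient lists run from the highest index down, hence \<open>rev\<close>. Sums over
  index sets are needed because the relation between p-th powers arises by the reindexing
  \<open>i \<mapsto> p * i\<close>.\<close>

lemma (in ring) combine_eq_finsum:
  assumes "\<And>i. i < k \<Longrightarrow> c i \<in> carrier R" "\<And>i. i < k \<Longrightarrow> u i \<in> carrier R"
  shows "combine (map c (rev [0..<k])) (map u (rev [0..<k])) = (\<Oplus>i\<in>{..<k}. c i \<otimes> u i)"
  using assms
proof (induction k)
  case (Suc k)
  have "{..<Suc k} = insert k {..<k}" by auto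
  moreover have "(\<Oplus>i\<in>insert k {..<k}. c i \<otimes> u i) = c k \<otimes> u k \<oplus> (\<Oplus>i\<in>{..<k}. c i \<otimes> u i)"
    using Suc.prems by (intro finsum_insert) auto
  ultimately show ?case using Suc by simp
qed simp

lemma (in ring) eval_eq_finsum:
  assumes "set p \<subseteq> carrier R" "x \<in> carrier R"
  shows "eval p x = (\<Oplus>i\<in>{..<length p}. coeff p i \<otimes> x [^] i)"
proof -
  have "eval p x = combine p (exp_base x (length p))" by (simp add: combine_eq_eval)
  also have "\<dots> = combine (map (coeff p) (rev [0..<length p])) (map (\<lambda>i. x [^] i) (rev [0..<length p]))"
    using coeff_list[of p] by (simp add: exp_base_def)
  also have "\<dots> = (\<Oplus>i\<in>{..<length p}. coeff p i \<otimes> x [^] i)"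
    by (rule combine_eq_finsum) (use assms coeff_in_carrier in auto)
  finally show ?thesis .
qed

section \<open>Fields of positive characteristic\<close>

context field begin

lemma add_pow_one_mult: "[(m * n :: nat)] \<cdot> \<one> = [m] \<cdot> \<one> \<otimes> [n] \<cdot> \<one>"
proof (induction m)
  case (Suc m)
  have "[(Suc m * n)] \<cdot> \<one> = [n] \<cdot> \<one> \<oplus> [(m * n)] \<cdot> \<one>" by (simp add: add.nat_pow_mult)
  then show ?case unfolding Suc by (simp add: l_distr a_comm)
qed simp

lemma add_pow_eq_mult: "a \<in> carrier R \<Longrightarrow> [(n::nat)] \<cdot> a = [n] \<cdot> \<one> \<otimes> a"
  using add_pow_ldistr[of \<one> a n] by simp

lemma prime_characteristic:
  assumes "n > 0" "[(n::nat)] \<cdot> \<one> = \<zero>"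
  obtains p where "Factorial_Ring.prime (p::nat)" "[p] \<cdot> \<one> = \<zero>"
  using assms
proof (induction n arbitrary: thesis rule: less_induct)
  case (less n)
  have "n \<noteq> 1" using less.prems(3) by auto
  then obtain p where p: "Factorial_Ring.prime p" "p dvd n" using prime_factor_nat by blast
  then obtain k where k: "n = p * k" by auto
  have "[p] \<cdot> \<one> = \<zero> \<or> [k] \<cdot> \<one> = \<zero>"
    using less.prems(3) unfolding k add_pow_one_mult by (simp add: integral_iff)
  then show ?case
  proof
    assume "[k] \<cdot> \<one> = \<zero>"
    moreover have "k < n" "k > 0" using k less.prems(2) prime_gt_1_nat[OF p(1)] by auto
    ultimately show ?thesis using less.IH less.prems(1) by blast
  qed (use less.prems(1) p in blast)
qed

lemma characteristic_dvd:
  assumes p: "Factorial_Ring.prime (p::nat)" "[p] \<cdot> \<one> = \<zero>" and i: "[(i::nat)] \<cdot> \<one> = \<zero>"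
  shows "p dvd i"
proof (rule ccontr)
  assume "\<not> p dvd i"
  then obtain a b where "i * a = Suc (p * b)" using bezout_prime[OF p(1)] by blast
  then have "[(i * a)] \<cdot> \<one> = [(p * b)] \<cdot> \<one> \<oplus> \<one>" by simp
  then show False unfolding add_pow_one_mult p(2) i by simp
qed

end

context field begin

lemma frobenius_add:
  assumes "Factorial_Ring.prime (p::nat)" "[p] \<cdot> \<one> = \<zero>" "x \<in> carrier R" "y \<in> carrier R"
  shows "(x \<oplus> y) [^] p = x [^] p \<oplus> y [^] p"
proof -
  obtain z where z: "z \<in> carrier R" "(x \<oplus> y) [^] p = x [^] p \<oplus> y [^] p \<oplus> [p] \<cdot> z"
    using freshman_dream[OF assms(3,4,1)] .
  then show ?thesis using add_pow_eq_mult[OF z(1), of p] assms by simp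
qed

text \<open>\<open>M\<close> is the compositum of \<open>K\<close> and the field of p-th powers.
  Frobenius is additive and maps \<open>K\<close> into \<open>K\<close>, so the p-th power of a
  combination of \<open>Ws\<close> is a combination of the p-th powers, and the span contains them
  all. Closure under products follows because a product of two p-th powers is again a p-th
  power.\<close>

lemma Span_powers_subfield:
  assumes p: "Factorial_Ring.prime (p::nat)" "[p] \<cdot> \<one> = \<zero>" and K: "subfield K R"
    and Ws: "set Ws \<subseteq> carrier R" "Span K Ws = carrier R"
  defines "M \<equiv> Span K (map (\<lambda>w. w [^] p) Ws)"
  shows "subfield M R" "K \<subseteq> M" "\<And>y. y \<in> carrier R \<Longrightarrow> y [^] p \<in> M"
proof -
  let ?Ps = "map (\<lambda>w. w [^] p) Ws"
  have Ps: "set ?Ps \<subseteq> carrier R" using Ws(1) by auto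
  note Ks = subringE[OF subfieldE(1)[OF K]]
  have Kc: "k \<in> K \<Longrightarrow> k \<in> carrier R" for k using Ks(1) by blast
  have sub: "subgroup M (add_monoid R)" unfolding M_def by (rule Span_is_add_subgroup[OF K Ps])
  have Mc: "m \<in> carrier R" if "m \<in> M" for m using subgroup.mem_carrier[OF sub that] by simp
  have Madd: "a \<oplus> b \<in> M" if "a \<in> M" "b \<in> M" for a b using subgroup.m_closed[OF sub that] by simp
  have Mneg: "\<ominus> a \<in> M" if "a \<in> M" for a using subgroup.m_inv_closed[OF sub that] by (simp add: a_inv_def)
  have M0: "\<zero> \<in> M" using subgroup.one_closed[OF sub] by simp
  have MK: "k \<otimes> m \<in> M" if "k \<in> K" "m \<in> M" for k m using Span_smult_closed[OF K Ps] that unfolding M_def by blast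
  have Kpow: "k [^] p \<in> K" if "k \<in> K" for k by (induction p) (use Ks(3,6) that in auto)
  have Mw: "w [^] p \<in> M" if "w \<in> set Ws" for w using Span_base_incl[OF K Ps] that unfolding M_def by auto
  have p0: "p \<noteq> 0" using p(1) prime_gt_0_nat by blast
  have pow_minus: "(\<ominus> y) [^] p = \<ominus> (y [^] p)" if "y \<in> carrier R" for y
  proof -
    have "(\<ominus> y \<oplus> y) [^] p = (\<ominus> y) [^] p \<oplus> y [^] p" using frobenius_add[OF p] that by simp
    moreover have "\<zero> [^] p = \<zero>" using p0 by (simp add: nat_pow_zero)
    ultimately have "(\<ominus> y) [^] p \<oplus> y [^] p = \<zero>" using that by (simp add: l_neg)
    then show ?thesis using that by (intro minus_equality[symmetric]) auto
  qed
  have E0: "subgroup {y \<in> carrier R. y [^] p \<in> M} (add_monoid R)"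
  proof (rule add.subgroupI)
    show "{y \<in> carrier R. y [^] p \<in> M} \<noteq> {}" using M0 p0 nat_pow_zero[of p] by force
    show "\<ominus> a \<in> {y \<in> carrier R. y [^] p \<in> M}" if "a \<in> {y \<in> carrier R. y [^] p \<in> M}" for a
      using that Mneg pow_minus by simp
    show "a \<oplus> b \<in> {y \<in> carrier R. y [^] p \<in> M}"
      if "a \<in> {y \<in> carrier R. y [^] p \<in> M}" "b \<in> {y \<in> carrier R. y [^] p \<in> M}" for a b
      using that Madd frobenius_add[OF p] by simp
  qed auto
  have "K <#> set Ws \<subseteq> {y \<in> carrier R. y [^] p \<in> M}"
  proof
    fix z assume "z \<in> K <#> set Ws"
    then obtain k w where kw: "k \<in> K" "w \<in> set Ws" "z = k \<otimes> w" unfolding set_mult_def by blast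
    have c: "k \<in> carrier R" "w \<in> carrier R" using kw Kc Ws(1) by auto
    have "z [^] p = k [^] p \<otimes> w [^] p" unfolding kw(3) using c by (rule nat_pow_distrib)
    then show "z \<in> {y \<in> carrier R. y [^] p \<in> M}" using MK[OF Kpow[OF kw(1)] Mw[OF kw(2)]] c kw(3) by simp
  qed
  then have "Span K Ws \<subseteq> {y \<in> carrier R. y [^] p \<in> M}" by (rule Span_min[OF K Ws(1) E0])
  then show Mpow: "y [^] p \<in> M" if "y \<in> carrier R" for y using that Ws(2) by blast
  have M1: "\<one> \<in> M" using Mpow[of \<one>] by simp
  show KM: "K \<subseteq> M" using MK[OF _ M1] Kc by force
  have mult_of_pow: "c \<otimes> m \<in> M" if c: "c \<in> carrier R" and m: "m \<in> M"
    and cw: "\<And>w. w \<in> set Ws \<Longrightarrow> c \<otimes> w [^] p \<in> M" for c m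
  proof -
    have E: "subgroup {z \<in> carrier R. c \<otimes> z \<in> M} (add_monoid R)"
    proof (rule add.subgroupI)
      have "\<zero> \<in> {z \<in> carrier R. c \<otimes> z \<in> M}" using M0 c by simp
      then show "{z \<in> carrier R. c \<otimes> z \<in> M} \<noteq> {}" by blast
    qed (use Mneg Madd c in \<open>auto simp: r_minus r_distr\<close>)
    have "K <#> set ?Ps \<subseteq> {z \<in> carrier R. c \<otimes> z \<in> M}"
    proof
      fix z assume "z \<in> K <#> set ?Ps"
      then obtain k w where kw: "k \<in> K" "w \<in> set Ws" "z = k \<otimes> w [^] p" unfolding set_mult_def by auto
      have kc: "k \<in> carrier R" "w \<in> carrier R" using kw Kc Ws(1) by auto
      have "c \<otimes> z = k \<otimes> (c \<otimes> w [^] p)" unfolding kw(3) using c kc by (simp add: m_lcomm)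
      then show "z \<in> {z \<in> carrier R. c \<otimes> z \<in> M}" using MK[OF kw(1) cw[OF kw(2)]] kc kw(3) by simp
    qed
    then have "M \<subseteq> {z \<in> carrier R. c \<otimes> z \<in> M}" unfolding M_def by (rule Span_min[OF K Ps E[unfolded M_def]])
    then show ?thesis using m by blast
  qed
  have mult_pow: "m \<otimes> y [^] p \<in> M" if m: "m \<in> M" and y: "y \<in> carrier R" for m y
  proof -
    have "y [^] p \<otimes> w [^] p \<in> M" if "w \<in> set Ws" for w
      using Mpow[of "y \<otimes> w"] nat_pow_distrib[of y w p] that y Ws(1) by auto
    then have "y [^] p \<otimes> m \<in> M" using mult_of_pow[OF _ m] y by simp
    then show ?thesis using m_comm[OF Mc[OF m], of "y [^] p"] y by simp
  qed
  have mult: "m \<otimes> m' \<in> M" if "m \<in> M" "m' \<in> M" for m m'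
    using mult_of_pow[OF Mc[OF that(1)] that(2)] mult_pow[OF that(1)] Ws(1) by auto
  have sr: "subring M R" by (rule subringI) (use Mc M1 Mneg mult Madd in auto)
  show "subfield M R"
  proof (rule subfieldI'[OF sr])
    fix m assume m: "m \<in> M - {\<zero>}"
    then have mc: "m \<in> carrier R" "m \<noteq> \<zero>" using Mc by auto
    then have mU: "m \<in> Units R" using field_Units by blast
    note ic = Units_inv_closed[OF mU]
    \<comment> \<open>The inverse of \<open>m\<close> is the product of
      \<open>m [^] (p - 1)\<close>, which lies in \<open>M\<close>, and the p-th power of the
      inverse.\<close>
    obtain q where q: "p = Suc q" using p0 not0_implies_Suc by blast
    have mq: "m [^] q \<in> M" by (induction q) (use M1 mult m in auto)
    have "m [^] q \<otimes> (inv m) [^] p = (m \<otimes> inv m) [^] q \<otimes> inv m"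
      unfolding q nat_pow_distrib[OF mc(1) ic] using mc ic by (simp add: m_assoc)
    also have "\<dots> = inv m" using Units_r_inv[OF mU] ic by simp
    finally show "inv m \<in> M" using mult_pow[OF mq ic] by simp
  qed
qed

text \<open>The minimal polynomial \<open>f\<close> divides its derivative, which has smaller degree
  and so is zero. This yields both a prime characteristic \<open>p\<close> and the fact that only
  exponents divisible by \<open>p\<close> occur in \<open>f\<close>. Raising a basis that contains
  the powers of \<open>x\<close> to p-th powers then creates a linear relation, so the p-th powers
  cannot span.\<close>

lemma inseparable_imp_subfield:
  assumes K: "subfield K R" and x: "x \<in> carrier R" and alg: "algebraic K x"
    and fd: "finite_dimension K (carrier R)" and ins: "deriv_eval (Irr K x) x = \<zero>"
  obtains p M where "Factorial_Ring.prime (p::nat)" "[p] \<cdot> \<one> = \<zero>" "subfield M R" "K \<subseteq> M"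
    "\<And>y. y \<in> carrier R \<Longrightarrow> y [^] p \<in> M" "M \<noteq> carrier R"
proof -
  define f where "f = Irr K x"
  let ?d = "poly_deriv R f"
  have alg': "(algebraic over K) x" using alg by (simp add: over_def)
  note Irr = IrrE[OF K x alg', folded f_def]
  have f0: "f \<noteq> []" using Irr(3) Irr(2) unfolding ring_irreducible_def by (auto simp: univ_poly_zero)
  have fK: "set f \<subseteq> K" using Irr(1) unfolding univ_poly_def polynomial_def by auto
  then have fc: "set f \<subseteq> carrier R" using subfieldE(3)[OF K] by blast
  have d: "?d \<in> carrier (K[X])" by (rule poly_deriv_closed[OF subfieldE(1)[OF K] fK])
  have "eval ?d x = \<zero>" using eval_poly_deriv[OF fc x] ins unfolding f_def by simp
  then have div: "f pdivides ?d" using Irr_minimal[OF K x alg' d] unfolding f_def by simp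
  define n where "n = degree f"
  have len: "length f = Suc n" unfolding n_def using f0 by (cases f) auto
  have n0: "n > 0"
  proof (rule ccontr)
    assume "\<not> n > 0"
    then have "f = [\<one>]" using len Irr(3) by (cases f) auto
    then show False using Irr(4) x by simp
  qed
  have "?d = []"
  proof (rule ccontr)
    assume ne: "?d \<noteq> []"
    have "degree f \<le> degree ?d" by (rule pdivides_imp_degree_le[OF subfieldE(1)[OF K] Irr(1) d ne div])
    moreover have "degree ?d < degree f" using length_poly_deriv[of f] ne len n0 by (cases ?d) auto
    ultimately show False by simp
  qed
  then have "set (map (\<lambda>i. [i] \<cdot> coeff f i) (rev [1..<length f])) \<subseteq> {\<zero>}"
    unfolding poly_deriv_def by (rule normalize_eq_Nil)
  then have cf: "[i] \<cdot> coeff f i = \<zero>" if "1 \<le> i" "i \<le> n" for i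
  proof -
    have "i \<in> set (rev [1..<length f])" using that len by (auto simp: le_less)
    then have "[i] \<cdot> coeff f i \<in> set (map (\<lambda>i. [i] \<cdot> coeff f i) (rev [1..<length f]))"
      unfolding set_map by (rule imageI)
    then show ?thesis using \<open>set (map _ _) \<subseteq> {\<zero>}\<close> by blast
  qed
  have cn: "coeff f n = \<one>" unfolding n_def using Irr(3) f0 lead_coeff_simp by metis
  \<comment> \<open>The characteristic is read off the leading coefficient: it is
    \<open>\<one>\<close>, and the derivative multiplies it by \<open>n\<close>.\<close>
  have cn1: "[n] \<cdot> \<one> = \<zero>" using cf[of n] n0 unfolding cn by simp
  obtain p where p: "Factorial_Ring.prime (p::nat)" "[p] \<cdot> \<one> = \<zero>"
    using prime_characteristic[OF n0 cn1] .
  have cz: "coeff f i = \<zero>" if "\<not> p dvd i" for i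
  proof (cases "i \<le> n")
    case True
    have "i \<noteq> 0" using that by (cases i) auto
    then have "[i] \<cdot> coeff f i = \<zero>" using cf True by simp
    moreover have "coeff f i \<in> carrier R" using coeff_in_carrier[OF fc] .
    ultimately have "[i] \<cdot> \<one> \<otimes> coeff f i = \<zero>" by (simp only: add_pow_eq_mult[symmetric])
    moreover have "[i] \<cdot> \<one> \<noteq> \<zero>" using characteristic_dvd[OF p, of i] that by auto
    ultimately show ?thesis using integral_iff[of "[i] \<cdot> \<one>" "coeff f i"] coeff_in_carrier[OF fc] by simp
  next
    case False
    then show ?thesis using coeff_length[of f i] len by simp
  qed
  have "p dvd n" using cz[of n] cn by auto
  then obtain m where m: "n = p * m" by auto
  have p1: "p > 1" using p(1) prime_gt_1_nat by blast
  have mn: "m < n" using m n0 p1 by auto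
  define Us where "Us = exp_base x n"
  have Us: "independent K Us" using exp_base_independent[OF K x alg'] unfolding Us_def n_def f_def .
  obtain N where N: "dimension N K (carrier R)" using fd unfolding finite_dimension_def by blast
  obtain Vs where Vs: "length (Vs @ Us) = N" "independent K (Vs @ Us)" "Span K (Vs @ Us) = carrier R"
    using complete_base[OF K N Us independent_in_carrier[OF Us]] by auto
  have Wc: "set (Vs @ Us) \<subseteq> carrier R" by (rule independent_in_carrier[OF Vs(2)])
  define M where "M = Span K (map (\<lambda>w. w [^] p) (Vs @ Us))"
  note Mprops = Span_powers_subfield[OF p K Wc Vs(3), folded M_def]
  have "M \<noteq> carrier R"
  proof
    assume "M = carrier R"
    \<comment> \<open>The p-th powers of the \<open>N\<close> basis elements would span a space of
      dimension \<open>N\<close>, so they would be independent, and in particular those of the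
      powers of \<open>x\<close>.\<close>
    then have "independent K (map (\<lambda>w. w [^] p) (Vs @ Us))"
      using Wc Vs(1) by (intro spanning_imp_independent[OF K N]) (auto simp: M_def)
    then have ind: "independent K (map (\<lambda>w. w [^] p) Us)" using independent_split(1)[OF K] by simp
    \<comment> \<open>These are the coefficients of \<open>f\<close> as a polynomial in the p-th
      power of the variable. As \<open>m < n\<close>, the equation \<open>f(x) = 0\<close> is a
      relation among the p-th powers of \<open>x [^] i\<close> with \<open>i < n\<close>, and it is
      nontrivial because \<open>c m = \<one>\<close>.\<close>
    define c where "c i = coeff f (p * i)" for i
    define u where "u i = (x [^] i) [^] p" for i :: nat
    have cK: "c i \<in> K" for i unfolding c_def by (rule coeff_in_subset[OF fK subringE(2)[OF subfieldE(1)[OF K]]])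
    have cc: "c i \<in> carrier R" for i using cK subfieldE(3)[OF K] by blast
    have uc: "u i \<in> carrier R" for i unfolding u_def using x by simp
    have ux: "u i = x [^] (p * i)" for i unfolding u_def using x by (simp add: nat_pow_pow mult.commute)
    let ?Ks = "map c (rev [0..<n])"
    have Um: "map (\<lambda>w. w [^] p) Us = map u (rev [0..<n])" unfolding Us_def exp_base_def u_def by simp
    have "combine ?Ks (map u (rev [0..<n])) = (\<Oplus>i\<in>{..<n}. c i \<otimes> u i)"
      by (rule combine_eq_finsum) (use cc uc in auto)
    also have "\<dots> = (\<Oplus>i\<in>{..m}. c i \<otimes> u i)"
    proof (rule add.finprod_mono_neutral_cong_right)
      show "c i \<otimes> u i = \<zero>" if "i \<in> {..<n} - {..m}" for i
      proof -
        from that have "length f \<le> p * i" using len m p1 by (simp add: Suc_le_eq)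
        then have "c i = \<zero>" unfolding c_def by (rule coeff_length)
        then show "c i \<otimes> u i = \<zero>" using uc by simp
      qed
    qed (use mn cc uc in auto)
    also have "\<dots> = (\<Oplus>j\<in>(*) p ` {..m}. coeff f j \<otimes> x [^] j)"
      using p1 x coeff_in_carrier[OF fc]
      by (subst add.finprod_reindex) (auto simp: c_def ux inj_on_def)
    also have "\<dots> = (\<Oplus>j\<in>{..<length f}. coeff f j \<otimes> x [^] j)"
    proof (rule add.finprod_mono_neutral_cong_left)
      show "(*) p ` {..m} \<subseteq> {..<length f}" using len m by (auto simp: less_Suc_eq_le)
      show "coeff f j \<otimes> x [^] j = \<zero>" if j: "j \<in> {..<length f} - (*) p ` {..m}" for j
      proof -
        have "\<not> p dvd j"
        proof
          assume "p dvd j"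
          then obtain l where l: "j = p * l" by auto
          have "p * l \<le> p * m" using j unfolding l len m by (simp add: less_Suc_eq_le)
          then have "l \<le> m" using p1 by simp
          then show False using j l by auto
        qed
        then show "coeff f j \<otimes> x [^] j = \<zero>" using cz x by simp
      qed
    qed (use x coeff_in_carrier[OF fc] in auto)
    also have "\<dots> = \<zero>" using eval_eq_finsum[OF fc x] Irr(4) by simp
    finally have comb: "combine ?Ks (map (\<lambda>w. w [^] p) Us) = \<zero>" unfolding Um .
    have "set (take (length (map (\<lambda>w. w [^] p) Us)) ?Ks) \<subseteq> {\<zero>}"
      by (rule independent_imp_trivial_combine[OF K ind _ comb]) (use cK in auto)
    then have "set ?Ks \<subseteq> {\<zero>}" unfolding Um by simp
    moreover have "c m \<in> set ?Ks" using mn by simp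
    ultimately have "c m = \<zero>" by blast
    then show False using cn unfolding c_def m[symmetric] by simp
  qed
  then show ?thesis using that[OF p Mprops] by blast
qed

text \<open>Let \<open>V\<close> be an \<open>M\<close>-subspace maximal among those containing
  \<open>\<one>\<close> but not \<open>y0\<close>. Every element is then uniquely
  \<open>v + m y0\<close> with \<open>v \<in> V\<close> and \<open>m \<in> M\<close>, and
  \<open>\<theta>\<close> is the coordinate \<open>m\<close>. No basis over \<open>M\<close> is
  chosen.\<close>

lemma exists_functional:
  assumes M: "subfield M R" and y0: "y0 \<in> carrier R" "y0 \<notin> M"
  obtains \<theta> where "\<And>z. z \<in> carrier R \<Longrightarrow> \<theta> z \<in> carrier R"
    "\<And>z w. z \<in> carrier R \<Longrightarrow> w \<in> carrier R \<Longrightarrow> \<theta> (z \<oplus> w) = \<theta> z \<oplus> \<theta> w"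
    "\<And>m z. m \<in> M \<Longrightarrow> z \<in> carrier R \<Longrightarrow> \<theta> (m \<otimes> z) = m \<otimes> \<theta> z"
    "\<theta> \<one> = \<zero>" "\<theta> y0 = \<one>"
proof -
  note sr = subfieldE(1)[OF M]
  note Ms = subringE[OF sr]
  have Mc: "m \<in> M \<Longrightarrow> m \<in> carrier R" for m using Ms(1) by blast
  define \<V> where "\<V> = {V. submod M V \<and> \<one> \<in> V \<and> y0 \<notin> V}"
  have "\<exists>V\<in>\<V>. \<forall>W\<in>\<V>. V \<subseteq> W \<longrightarrow> W = V"
  proof (rule subset_Zorn_nonempty)
    show "\<V> \<noteq> {}" using subring_submod[OF sr] Ms(3) y0(2) unfolding \<V>_def by auto
    fix \<C> assume ne: "\<C> \<noteq> {}" and ch: "subset.chain \<V> \<C>"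
    have C: "submod M V" "\<one> \<in> V" "y0 \<notin> V" if "V \<in> \<C>" for V
      using ch that unfolding subset.chain_def \<V>_def by auto
    have lin: "V \<subseteq> W \<or> W \<subseteq> V" if "V \<in> \<C>" "W \<in> \<C>" for V W
      using ch that unfolding subset.chain_def by auto
    have "submod M (\<Union>\<C>)" by (rule submod_Union_chain[OF ne C(1) lin])
    then show "\<Union>\<C> \<in> \<V>" unfolding \<V>_def using ne C by auto
  qed
  then obtain V where VV: "V \<in> \<V>" and max: "\<And>W. W \<in> \<V> \<Longrightarrow> V \<subseteq> W \<Longrightarrow> W = V" by blast
  then have V: "submod M V" "\<one> \<in> V" "y0 \<notin> V" unfolding \<V>_def by auto
  note Vs = submodD[OF V(1)]
  have Vm: "v \<ominus> w \<in> V" if "v \<in> V" "w \<in> V" for v w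
    unfolding a_minus_def by (intro Vs(3) submod_minus[OF sr V(1)] that)
  have ex: "\<exists>m\<in>M. z \<ominus> m \<otimes> y0 \<in> V" if z: "z \<in> carrier R" for z
  proof (cases "z \<in> V")
    case True
    have "z \<ominus> \<zero> \<otimes> y0 = z" using z y0 by algebra
    then show ?thesis using Ms(2) True by force
  next
    case False
    define W where "W = line_extension M z V"
    note ext = line_extension_submod[OF sr V(1) z, folded W_def]
    \<comment> \<open>By maximality, enlarging \<open>V\<close> by \<open>z\<close> captures
      \<open>y0\<close>; the coefficient of \<open>z\<close> in that expression is nonzero, so the
      expression can be solved for \<open>z\<close>.\<close>
    have "y0 \<in> W"
    proof (rule ccontr)
      assume "y0 \<notin> W"
      then have "W \<in> \<V>" unfolding \<V>_def using ext(1,2) V(2) by auto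
      then have "W = V" using max ext(2) by simp
      then show False using ext(3) False by simp
    qed
    then obtain v m where vm: "v \<in> V" "m \<in> M" "y0 = m \<otimes> z \<oplus> v" unfolding W_def line_extension_mem_iff by blast
    note vc = Vs(5)[OF vm(1)]
    have m0: "m \<in> M - {\<zero>}"
    proof -
      have "m \<noteq> \<zero>" using vm V(3) vc z by auto
      then show ?thesis using vm(2) by simp
    qed
    note im = subfield_m_inv[OF M m0]
    have ic: "inv m \<in> M" "inv m \<in> carrier R" using im(1) Mc by auto
    define i where "i = inv m"
    have i: "i \<in> M" "i \<in> carrier R" "i \<otimes> m = \<one>" unfolding i_def using ic im by auto
    have "z \<ominus> i \<otimes> y0 = z \<ominus> ((i \<otimes> m) \<otimes> z \<oplus> i \<otimes> v)"
      unfolding vm(3) using i vc z Mc[OF vm(2)] by (simp add: r_distr m_assoc[symmetric])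
    also have "\<dots> = \<ominus> (i \<otimes> v)" unfolding i(3) using i(2) vc z by algebra
    finally have "z \<ominus> i \<otimes> y0 = \<ominus> (i \<otimes> v)" .
    moreover have "\<ominus> (i \<otimes> v) \<in> V" by (intro submod_minus[OF sr V(1)] Vs(4) i(1) vm(1))
    ultimately have "z \<ominus> i \<otimes> y0 \<in> V" by simp
    then show ?thesis using i(1) by blast
  qed
  have uniq: "m = k" if m: "m \<in> M" and k: "k \<in> M" and z: "z \<in> carrier R"
    and mz: "z \<ominus> m \<otimes> y0 \<in> V" and kz: "z \<ominus> k \<otimes> y0 \<in> V" for m k z
  proof (rule ccontr)
    assume ne: "m \<noteq> k"
    note c = Mc[OF m] Mc[OF k]
    have "(z \<ominus> k \<otimes> y0) \<ominus> (z \<ominus> m \<otimes> y0) = (m \<ominus> k) \<otimes> y0" using c z y0(1) by algebra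
    then have d: "(m \<ominus> k) \<otimes> y0 \<in> V" using Vm[OF kz mz] by simp
    have "m \<ominus> k \<in> M" unfolding a_minus_def using Ms(5,7) m k by blast
    moreover have "m \<ominus> k \<noteq> \<zero>" using ne c by simp
    ultimately have mk: "m \<ominus> k \<in> M - {\<zero>}" by simp
    note im = subfield_m_inv[OF M mk]
    have "inv (m \<ominus> k) \<otimes> ((m \<ominus> k) \<otimes> y0) \<in> V" using Vs(4)[OF _ d] im(1) by simp
    moreover have "inv (m \<ominus> k) \<otimes> ((m \<ominus> k) \<otimes> y0) = (inv (m \<ominus> k) \<otimes> (m \<ominus> k)) \<otimes> y0"
      using c y0(1) im(1) Mc by (intro m_assoc[symmetric]) auto
    ultimately have "y0 \<in> V" unfolding im(3) using y0(1) by simp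
    then show False using V(3) by simp
  qed
  define \<theta> where "\<theta> z = (SOME m. m \<in> M \<and> z \<ominus> m \<otimes> y0 \<in> V)" for z
  have lam: "\<theta> z \<in> M" "z \<ominus> \<theta> z \<otimes> y0 \<in> V" if "z \<in> carrier R" for z
    using someI_ex[of "\<lambda>m. m \<in> M \<and> z \<ominus> m \<otimes> y0 \<in> V"] ex[OF that] unfolding \<theta>_def by auto
  have lamI: "\<theta> z = m" if "z \<in> carrier R" "m \<in> M" "z \<ominus> m \<otimes> y0 \<in> V" for z m
    using uniq[OF lam(1)[OF that(1)] that(2,1) lam(2)[OF that(1)] that(3)] .
  show ?thesis
  proof (rule that[of \<theta>])
    show "\<theta> z \<in> carrier R" if "z \<in> carrier R" for z using lam(1)[OF that] Mc by blast
    show "\<theta> (z \<oplus> w) = \<theta> z \<oplus> \<theta> w" if z: "z \<in> carrier R" and w: "w \<in> carrier R" for z w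
    proof (rule lamI)
      note c = Mc[OF lam(1)[OF z]] Mc[OF lam(1)[OF w]]
      have "(z \<oplus> w) \<ominus> (\<theta> z \<oplus> \<theta> w) \<otimes> y0 = (z \<ominus> \<theta> z \<otimes> y0) \<oplus> (w \<ominus> \<theta> w \<otimes> y0)"
        using c z w y0(1) by algebra
      then show "(z \<oplus> w) \<ominus> (\<theta> z \<oplus> \<theta> w) \<otimes> y0 \<in> V" using Vs(3)[OF lam(2)[OF z] lam(2)[OF w]] by simp
    qed (use z w lam(1) Ms(7) in auto)
    show "\<theta> (m \<otimes> z) = m \<otimes> \<theta> z" if m: "m \<in> M" and z: "z \<in> carrier R" for m z
    proof (rule lamI)
      note c = Mc[OF lam(1)[OF z]] Mc[OF m]
      have "m \<otimes> z \<ominus> (m \<otimes> \<theta> z) \<otimes> y0 = m \<otimes> (z \<ominus> \<theta> z \<otimes> y0)" using c z y0(1) by algebra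
      then show "m \<otimes> z \<ominus> (m \<otimes> \<theta> z) \<otimes> y0 \<in> V" using Vs(4)[OF m lam(2)[OF z]] by simp
    qed (use z m Mc lam(1) Ms(6) in auto)
    show "\<theta> \<one> = \<zero>"
    proof (rule lamI)
      have "\<one> \<ominus> \<zero> \<otimes> y0 = \<one>" using y0(1) by algebra
      then show "\<one> \<ominus> \<zero> \<otimes> y0 \<in> V" using V(2) by simp
    qed (use Ms(2) in auto)
    show "\<theta> y0 = \<one>"
    proof (rule lamI)
      have "y0 \<ominus> \<one> \<otimes> y0 = \<zero>" using y0(1) by algebra
      then show "y0 \<ominus> \<one> \<otimes> y0 \<in> V" using Vs(2) by simp
    qed (use Ms(3) y0 in auto)
  qed
qed

end

section \<open>Residue fields of a finite type extension\<close>

text \<open>A chain of finitely generated subalgebras is finite by FCP and so has a greatest member.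
  Zorn's lemma gives a maximal finitely generated subalgebra; adjoining one more element cannot
  enlarge it, so it is all of \<open>S\<close>.\<close>

lemma FCP_imp_finite_type:
  assumes "cring S" and A: "subring A S" and fcp: "FCP A S" shows "finite_type A S"
proof -
  interpret cring S by fact
  define \<G> where "\<G> = {generate_ring S (A \<union> G) | G. finite G \<and> G \<subseteq> carrier S}"
  have Ac: "A \<subseteq> carrier S" by (rule subringE(1)[OF A])
  have "\<exists>M\<in>\<G>. \<forall>N\<in>\<G>. M \<subseteq> N \<longrightarrow> N = M"
  proof (rule subset_Zorn_nonempty)
    show "\<G> \<noteq> {}" unfolding \<G>_def by auto
    fix \<C> assume ne: "\<C> \<noteq> {}" and ch: "subset.chain \<G> \<C>"
    have sub: "N \<in> subalgs A S" if N: "N \<in> \<G>" for N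
    proof -
      obtain G where G: "finite G" "G \<subseteq> carrier S" "N = generate_ring S (A \<union> G)" using N unfolding \<G>_def by auto
      have "A \<union> G \<subseteq> carrier S" using G Ac by auto
      then have "subring N S" unfolding G(3) by (rule generate_ring_is_subring)
      moreover have "A \<subseteq> N" unfolding G(3) by (auto intro: generate_ring.incl)
      ultimately show ?thesis unfolding subalgs_def by simp
    qed
    have lin: "N \<subseteq> M \<or> M \<subseteq> N" if "M \<in> \<C>" "N \<in> \<C>" for M N
      using ch that unfolding subset.chain_def by auto
    have "\<C> \<subseteq> \<G>" using ch unfolding subset.chain_def by auto
    then have "\<C> \<in> chains (subalgs A S)"
      unfolding chains_def chain_subset_def using sub lin by auto
    then have "finite \<C>" using fcp unfolding FCP_def by simp
    then obtain M where M: "M \<in> \<C>" "\<And>N. N \<in> \<C> \<Longrightarrow> M \<subseteq> N \<Longrightarrow> M = N"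
      using finite_has_maximal[OF _ ne] by metis
    have "N \<subseteq> M" if "N \<in> \<C>" for N using lin[OF M(1) that] M(2)[OF that] by auto
    then have "\<Union>\<C> = M" using M(1) by auto
    then show "\<Union>\<C> \<in> \<G>" using M(1) \<open>\<C> \<subseteq> \<G>\<close> by auto
  qed
  then obtain M where M: "M \<in> \<G>" "\<And>N. N \<in> \<G> \<Longrightarrow> M \<subseteq> N \<Longrightarrow> N = M" by auto
  then obtain G where G: "finite G" "G \<subseteq> carrier S" "M = generate_ring S (A \<union> G)" unfolding \<G>_def by auto
  have AG: "A \<union> G \<subseteq> carrier S" using G Ac by auto
  have "carrier S \<subseteq> M"
  proof
    fix s assume s: "s \<in> carrier S"
    let ?N = "generate_ring S (A \<union> insert s G)"
    have "A \<union> insert s G \<subseteq> carrier S" using AG s by auto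
    then have "M \<subseteq> ?N" unfolding G(3) by (intro mono_generate_ring) auto
    moreover have "?N \<in> \<G>" unfolding \<G>_def
      by (rule CollectI, rule exI[of _ "insert s G"]) (use G s in auto)
    ultimately have "?N = M" using M(2) by simp
    moreover have "s \<in> ?N" by (rule generate_ring.incl) simp
    ultimately show "s \<in> M" by simp
  qed
  then have "generate_ring S (A \<union> G) = carrier S" using generate_ring_incl[OF AG] G(3) by auto
  then show ?thesis unfolding finite_type_def using G by blast
qed

section \<open>The base field inside a residue field\<close>

context localized_ring begin

text \<open>For a subring \<open>B\<close> this is the image in the residue field at
  \<open>P\<close> of the residue field of \<open>B\<close> at \<open>P \<inter> B\<close>.\<close>

definition subfractions :: "'a set \<Rightarrow> ('a \<times> 'a) set set set" where
  "subfractions B = {cls a s | a s. a \<in> B \<and> s \<in> B - P}"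

context
  fixes B assumes B: "subring B A"
begin

lemma B_carr: "b \<in> B \<Longrightarrow> b \<in> carrier A" using subringE(1)[OF B] by blast
lemma B_den: "b \<in> B - P \<Longrightarrow> b \<in> den" unfolding den_def using B_carr by auto
lemma B_den_mult: "s \<in> B - P \<Longrightarrow> t \<in> B - P \<Longrightarrow> s \<otimes> t \<in> B - P"
  using I_prime[of s t] B_carr subringE(6)[OF B, of s t] by auto
lemma B_one: "\<one> \<in> B - P" using subringE(3)[OF B] den_one den_not by auto

lemma subfractionsI: "a \<in> B \<Longrightarrow> s \<in> B - P \<Longrightarrow> cls a s \<in> subfractions B"
  unfolding subfractions_def by auto

lemma pi_subfractions: "a \<in> B \<Longrightarrow> \<pi> a \<in> subfractions B"
  unfolding \<pi>_def by (rule subfractionsI[OF _ B_one])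

lemma subfractions_subfield: "subfield (subfractions B) L"
proof (rule L.subfieldI'[OF L.subringI])
  note Bs = subringE[OF B]
  have carr: "x \<in> carrier L" if "x \<in> subfractions B" for x
    using that cls_closed B_carr B_den unfolding subfractions_def by auto
  then show "subfractions B \<subseteq> carrier L" by auto
  show "\<one>\<^bsub>L\<^esub> \<in> subfractions B" using subfractionsI[of \<one> \<one>] B_one cls_one by simp
  fix x assume "x \<in> subfractions B"
  then obtain a s where x: "a \<in> B" "s \<in> B - P" "x = cls a s" unfolding subfractions_def by auto
  note xc = B_carr[OF x(1)] B_den[OF x(2)]
  note sc = den_carr[OF xc(2)]
  have "cls (\<ominus> a) s \<oplus>\<^bsub>L\<^esub> cls a s = cls (\<ominus> a \<otimes> s \<oplus> a \<otimes> s) (s \<otimes> s)" using xc by (intro cls_add) auto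
  also have "\<dots> = \<zero>\<^bsub>L\<^esub>"
  proof -
    have "\<ominus> a \<otimes> s \<oplus> a \<otimes> s = \<zero>" using xc sc by (simp add: l_minus l_neg)
    then show ?thesis using cls_zero_iff[of \<zero> "s \<otimes> s"] den_mult[OF xc(2) xc(2)] P_zero by simp
  qed
  finally have "\<ominus>\<^bsub>L\<^esub> x = cls (\<ominus> a) s" unfolding x(3) using xc cls_closed by (intro L.minus_equality) auto
  then show "\<ominus>\<^bsub>L\<^esub> x \<in> subfractions B" using subfractionsI[OF Bs(5)[OF x(1)] x(2)] by simp
  fix y assume "y \<in> subfractions B"
  then obtain b t where y: "b \<in> B" "t \<in> B - P" "y = cls b t" unfolding subfractions_def by auto
  note yc = B_carr[OF y(1)] B_den[OF y(2)]
  have st: "s \<in> B" "t \<in> B" using x y by auto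
  show "x \<otimes>\<^bsub>L\<^esub> y \<in> subfractions B"
    unfolding x(3) y(3) cls_mult[OF xc yc] by (intro subfractionsI Bs(6) x y B_den_mult)
  show "x \<oplus>\<^bsub>L\<^esub> y \<in> subfractions B"
    unfolding x(3) y(3) cls_add[OF xc yc] by (intro subfractionsI Bs(6,7) x y B_den_mult st)
next
  fix x assume "x \<in> subfractions B - {\<zero>\<^bsub>L\<^esub>}"
  then obtain a s where x: "a \<in> B" "s \<in> B - P" "x = cls a s" "x \<noteq> \<zero>\<^bsub>L\<^esub>" unfolding subfractions_def by auto
  note xc = B_carr[OF x(1)] B_den[OF x(2)]
  have aP: "a \<in> B - P" using cls_zero_iff[OF xc] x by auto
  note ad = B_den[OF aP]
  have "cls a s \<otimes>\<^bsub>L\<^esub> cls s a = \<one>\<^bsub>L\<^esub>"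
    using cls_mult[OF xc den_carr[OF xc(2)] ad] cls_cancel[OF den_mult[OF ad xc(2)]] xc den_carr[OF xc(2)]
    by (simp add: m_comm)
  then have "inv\<^bsub>L\<^esub> x = cls s a"
    unfolding x(3) using cls_closed[OF xc] cls_closed[OF den_carr[OF xc(2)] ad]
    by (intro L.inv_char) (auto simp: L.m_comm)
  then show "inv\<^bsub>L\<^esub> x \<in> subfractions B" using subfractionsI[of s a] x aP by simp
qed

text \<open>Lists are compared entry by entry without normalizing, so that evaluation and evaluation
  of the derivative are both scaled by exactly \<open>\<pi> t\<close>.\<close>

lemma clear_denominators:
  assumes "set f \<subseteq> subfractions B"
  shows "\<exists>t\<in>B - P. \<exists>g. set g \<subseteq> B \<and> map \<pi> g = map ((\<otimes>\<^bsub>L\<^esub>) (\<pi> t)) f"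
  using assms
proof (induction f)
  case Nil
  then show ?case using B_one by auto
next
  case (Cons k f)
  then obtain t g where tg: "t \<in> B - P" "set g \<subseteq> B" "map \<pi> g = map ((\<otimes>\<^bsub>L\<^esub>) (\<pi> t)) f" by auto
  obtain a s where k: "a \<in> B" "s \<in> B - P" "k = cls a s" using Cons.prems unfolding subfractions_def by auto
  note kc = B_carr[OF k(1)] B_den[OF k(2)]
  have car: "t \<in> carrier A" "s \<in> carrier A" using tg k B_carr by auto
  have fL: "x \<in> carrier L" if "x \<in> set f" for x
    using that Cons.prems subfieldE(3)[OF subfractions_subfield] by auto
  have kL: "k \<in> carrier L" unfolding k(3) using cls_closed[OF kc] .
  have "\<pi> s \<otimes>\<^bsub>L\<^esub> k = \<pi> a" using cls_iff[OF kc kL] k(3) by simp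
  then have "\<pi> (t \<otimes> a) = \<pi> t \<otimes>\<^bsub>L\<^esub> (\<pi> s \<otimes>\<^bsub>L\<^esub> k)" using car kc by simp
  then have 1: "\<pi> (t \<otimes> a) = \<pi> (s \<otimes> t) \<otimes>\<^bsub>L\<^esub> k" using car kL by (simp add: L.m_ac)
  have "map \<pi> (map ((\<otimes>) s) g) = map ((\<otimes>\<^bsub>L\<^esub>) (\<pi> s)) (map \<pi> g)"
    using tg(2) B_carr car by (auto simp: subset_iff)
  also have "\<dots> = map ((\<otimes>\<^bsub>L\<^esub>) (\<pi> (s \<otimes> t))) f"
    unfolding tg(3) using car fL by (auto simp: L.m_assoc)
  finally have 2: "map \<pi> ((t \<otimes> a) # map ((\<otimes>) s) g) = map ((\<otimes>\<^bsub>L\<^esub>) (\<pi> (s \<otimes> t))) (k # f)" using 1 by simp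
  have 3: "set ((t \<otimes> a) # map ((\<otimes>) s) g) \<subseteq> B" using subringE(6)[OF B] tg k by auto
  show ?case using B_den_mult[OF k(2) tg(1)] 2 3 by blast
qed

text \<open>The lift \<open>g\<close> of a multiple of the minimal polynomial need not be monic. The
  multiplier is nonzero in the residue field and scales the value and the derivative alike, so
  vanishing of the former and nonvanishing of the latter survive.\<close>

lemma separable_lift:
  assumes s: "s \<in> carrier A" and alg: "L.algebraic (subfractions B) (\<pi> s)"
    and sep: "L.deriv_eval (L.Irr (subfractions B) (\<pi> s)) (\<pi> s) \<noteq> \<zero>\<^bsub>L\<^esub>"
  obtains g where "set g \<subseteq> B" "eval g s \<in> P" "deriv_eval g s \<notin> P"
proof -
  let ?K = "subfractions B"
  define f where "f = L.Irr ?K (\<pi> s)"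
  note K = subfractions_subfield
  have ps: "\<pi> s \<in> carrier L" using s by simp
  have alg': "(L.algebraic over ?K) (\<pi> s)" using alg by (simp add: over_def)
  note Irr = L.IrrE[OF K ps alg', folded f_def]
  have fK: "set f \<subseteq> ?K" using Irr(1) unfolding univ_poly_def polynomial_def by auto
  then have fc: "set f \<subseteq> carrier L" using subfieldE(3)[OF K] by auto
  obtain t g where t: "t \<in> B - P" and g: "set g \<subseteq> B" "map \<pi> g = map ((\<otimes>\<^bsub>L\<^esub>) (\<pi> t)) f"
    using clear_denominators[OF fK] by auto
  have gc: "set g \<subseteq> carrier A" using g(1) B_carr by auto
  have tc: "\<pi> t \<in> carrier L" "\<pi> t \<noteq> \<zero>\<^bsub>L\<^esub>" using t B_carr pi_zero_iff[of t] by auto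
  have "\<pi> (eval g s) = \<pi> t \<otimes>\<^bsub>L\<^esub> L.eval f (\<pi> s)"
    unfolding \<pi>.hom_eval[OF gc s] g(2) by (rule L.eval_scale[OF tc(1) fc ps])
  then have "\<pi> (eval g s) = \<zero>\<^bsub>L\<^esub>" using Irr(4) tc by simp
  then have 1: "eval g s \<in> P" using pi_zero_iff[OF eval_in_carrier[OF gc s]] by simp
  have "\<pi> (deriv_eval g s) = \<pi> t \<otimes>\<^bsub>L\<^esub> L.deriv_eval f (\<pi> s)"
    unfolding \<pi>.hom_deriv_eval[OF gc s] g(2) by (rule L.deriv_eval_scale[OF tc(1) fc ps])
  then have "\<pi> (deriv_eval g s) \<noteq> \<zero>\<^bsub>L\<^esub>"
    using sep tc L.integral_iff[OF tc(1) L.deriv_eval_closed[OF fc ps]] unfolding f_def by simp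
  then have 2: "deriv_eval g s \<notin> P" using pi_zero_iff[OF deriv_eval_closed[OF gc s]] by simp
  show ?thesis using that g(1) 1 2 by blast
qed

text \<open>The images of the ring generators are algebraic, so they generate a finite extension
  \<open>E\<close> of the base field. \<open>E\<close> contains the image of \<open>A\<close>, and
  being a field it contains all fractions.\<close>

lemma finite_dimension_residue_field:
  assumes int: "integral_ext B A" and G: "finite G" "G \<subseteq> carrier A" "generate_ring A (B \<union> G) = carrier A"
  shows "L.finite_dimension (subfractions B) (carrier L)"
proof -
  let ?K = "subfractions B"
  note K = subfractions_subfield
  have alg: "(L.algebraic over ?K) (\<pi> g)" if g: "g \<in> carrier A" for g
  proof -
    obtain p where p: "set p \<subseteq> B" "eval (\<one> # p) g = \<zero>" using int g unfolding integral_ext_def by blast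
    have pc: "set (\<one> # p) \<subseteq> carrier A" using p(1) B_carr by auto
    have "L.eval (map \<pi> (\<one> # p)) (\<pi> g) = \<zero>\<^bsub>L\<^esub>" unfolding \<pi>.hom_eval[OF pc g, symmetric] p(2) by simp
    moreover have "map \<pi> (\<one> # p) \<in> carrier (?K[X]\<^bsub>L\<^esub>)"
    proof -
      have "set (\<one> # p) \<subseteq> B" using p(1) subringE(3)[OF B] by simp
      then have "set (map \<pi> (\<one> # p)) \<subseteq> ?K" unfolding set_map by (blast intro: pi_subfractions)
      then show ?thesis unfolding univ_poly_def polynomial_def by simp
    qed
    ultimately show ?thesis by (intro L.algebraicI[of "map \<pi> (\<one> # p)"]) simp_all
  qed
  obtain xs where xs: "set xs = \<pi> ` G" using finite_list[of "\<pi> ` G"] G(1) by blast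
  have xc: "set xs \<subseteq> carrier L" using xs G(2) by auto
  have xalg: "(L.algebraic over ?K) x" if "x \<in> set xs" for x using that xs G(2) alg by auto
  define E where "E = L.finite_extension ?K xs"
  have E: "subfield E L" unfolding E_def by (rule L.finite_extension_is_subfield[OF K xc xalg])
  have KE: "?K \<subseteq> E" unfolding E_def by (rule L.finite_extension_incl[OF subfieldE(3)[OF K] xc])
  have xE: "set xs \<subseteq> E" unfolding E_def by (rule L.finite_extension_mem[OF subfieldE(1)[OF K] xc])
  have pre: "subring {s \<in> carrier A. \<pi> s \<in> E} A"
    using subringE[OF subfieldE(1)[OF E]] by (intro subringI) auto
  have BG: "B \<union> G \<subseteq> {s \<in> carrier A. \<pi> s \<in> E}" using KE xE xs pi_subfractions B_carr G(2) by auto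
  have "B \<union> G \<subseteq> carrier A" using B_carr G(2) by auto
  then have "carrier A \<subseteq> {s \<in> carrier A. \<pi> s \<in> E}"
    using generate_ring_min_subring1[OF _ pre BG] G(3) by simp
  then have piE: "\<pi> s \<in> E" if "s \<in> carrier A" for s using that by auto
  have "carrier L \<subseteq> E"
  proof
    fix x assume x: "x \<in> carrier L"
    then obtain a s where as: "a \<in> carrier A" "s \<in> den" "x = cls a s" by (rule LE)
    have e: "\<pi> s \<otimes>\<^bsub>L\<^esub> x = \<pi> a" using cls_iff[OF as(1,2) x] as(3) by simp
    have "\<pi> s \<noteq> \<zero>\<^bsub>L\<^esub>" using pi_zero_iff[OF den_carr[OF as(2)]] den_not[OF as(2)] by simp
    then have "\<pi> s \<in> E - {\<zero>\<^bsub>L\<^esub>}" using piE[OF den_carr[OF as(2)]] by simp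
    then show "x \<in> E" using L.subfield_m_inv_simprule[OF E _ x] e piE[OF as(1)] by simp
  qed
  then have "E = carrier L" using subfieldE(3)[OF E] by auto
  then show ?thesis using L.finite_extension_finite_dimension(1)[OF K xc xalg] unfolding E_def by simp
qed

end

end

section \<open>Unramified extensions\<close>

text \<open>Brings the condition into the form that both implications use: an explicit base field,
  and the derivative of the minimal polynomial evaluated at the element.\<close>

lemma separable_ext_residual_iff:
  fixes S (structure)
  assumes "cring S" and A: "subring A S" and Q: "primeideal Q S"
  shows "separable_ext (residue_field (S\<lparr>carrier := A\<rparr>) (Q \<inter> A)) (residue_field S Q) (residual_map S Q) \<longleftrightarrow>
    (\<forall>x\<in>carrier (residue_field S Q).
       ring.algebraic (residue_field S Q) (localized_ring.subfractions Q S A) x \<and>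
       ring.deriv_eval (residue_field S Q) (ring.Irr (residue_field S Q) (localized_ring.subfractions Q S A) x) x
         \<noteq> \<zero>\<^bsub>residue_field S Q\<^esub>)"
proof -
  interpret Q: localized_ring Q S unfolding localized_ring_def by (rule Q)
  have K: "residual_map S Q ` carrier (residue_field (S\<lparr>carrier := A\<rparr>) (Q \<inter> A)) = Q.subfractions A"
    unfolding residual_map_image[OF Q A] Q.subfractions_def ..
  note sep = Q.L.separable_Irr_iff[OF Q.subfractions_subfield[OF A]]
  show ?thesis unfolding separable_ext_def Let_def K using sep by auto
qed

context tensor_ext begin

lemma kappa_separable_imp_idempotent:
  assumes int: "integral_ext A S" and fcp: "FCP A S" and tcl: "t_closed A S" and sep: "kappa_separable A S"
  shows "I \<subseteq> ideal_prod T I I"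
proof (rule idempotent_diag_ideal)
  fix s Q assume s: "s \<in> carrier S" and Q: "primeideal Q S"
  interpret Q: localized_ring Q S unfolding localized_ring_def by (rule Q)
  have ps: "Q.\<pi> s \<in> carrier Q.L" using s by simp
  have sx: "Q.L.algebraic (Q.subfractions A) (Q.\<pi> s)"
    "Q.L.deriv_eval (Q.L.Irr (Q.subfractions A) (Q.\<pi> s)) (Q.\<pi> s) \<noteq> \<zero>\<^bsub>Q.L\<^esub>"
    using sep Q separable_ext_residual_iff[OF is_cring A Q] ps unfolding kappa_separable_def by auto
  obtain g where g: "set g \<subseteq> A" "eval g s \<in> Q" "deriv_eval g s \<notin> Q"
    using Q.separable_lift[OF A s sx] .
  obtain e where e: "e \<in> A" "e \<notin> Q" "e \<otimes> eval g s \<in> A"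
    using t_closed_FCP_prime[OF is_cring A int fcp tcl Q g(2)] .
  show "\<exists>p e. set p \<subseteq> A \<and> e \<in> A - Q \<and> e \<otimes> eval p s \<in> A \<and> deriv_eval p s \<notin> Q"
    using g e by blast
qed

end

section \<open>The ideal attached to a balanced map\<close>

context balanced_map begin

lemma lift_add:
  assumes "s \<in> carrier T" "t \<in> carrier T" shows "\<Phi> (s \<oplus>\<^bsub>T\<^esub> t) = \<Phi> s \<oplus>\<^bsub>G\<^esub> \<Phi> t"
proof -
  have "s \<oplus>\<^bsub>T\<^esub> t \<ominus>\<^bsub>T\<^esub> t = s" using assms by (simp add: a_minus_def T.a_assoc T.r_neg)
  then have "\<Phi> s = \<Phi> (s \<oplus>\<^bsub>T\<^esub> t) \<ominus>\<^bsub>G\<^esub> \<Phi> t" using lift_minus[of "s \<oplus>\<^bsub>T\<^esub> t" t] assms by simp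
  then have "\<Phi> s \<oplus>\<^bsub>G\<^esub> \<Phi> t = \<Phi> (s \<oplus>\<^bsub>T\<^esub> t) \<oplus>\<^bsub>G\<^esub> (\<ominus>\<^bsub>G\<^esub> \<Phi> t \<oplus>\<^bsub>G\<^esub> \<Phi> t)"
    using lift_closed assms by (simp add: a_minus_def G.a_assoc)
  then show ?thesis using lift_closed assms by (simp add: G.l_neg)
qed

lemma lift_add_pow:
  assumes "t \<in> carrier T" shows "\<Phi> (add_pow T (n::nat) t) = add_pow G n (\<Phi> t)"
  by (induction n) (use assms lift_zero lift_add in auto)

text \<open>The largest ideal inside the kernel of \<open>\<Phi>\<close>. The kernel itself is only
  a subgroup in general, while the argument on idempotent ideals requires an ideal.\<close>

definition annihilator :: "('a \<times> 'a \<Rightarrow>\<^sub>0 int) set set" where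
  "annihilator = {t \<in> carrier T. \<forall>u\<in>carrier T. \<Phi> (u \<otimes>\<^bsub>T\<^esub> t) = \<zero>\<^bsub>G\<^esub>}"

lemma annihilator_ideal: "ideal annihilator T"
proof (intro T.submod_ideal T.submodI)
  show "annihilator \<subseteq> carrier T" "\<zero>\<^bsub>T\<^esub> \<in> annihilator" unfolding annihilator_def by (auto simp: lift_zero)
  show "s \<oplus>\<^bsub>T\<^esub> t \<in> annihilator" if "s \<in> annihilator" "t \<in> annihilator" for s t
    using that unfolding annihilator_def by (simp add: T.r_distr lift_add)
  show "v \<otimes>\<^bsub>T\<^esub> t \<in> annihilator" if "v \<in> carrier T" "t \<in> annihilator" for v t
    using that unfolding annihilator_def by (simp add: T.m_assoc[symmetric])
qed

end

context tensor_ext begin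

lemma unramified_imp_kappa_separable:
  assumes int: "integral_ext A S" and II: "I \<subseteq> ideal_prod T I I" and ft: "finite_type A S"
  shows "kappa_separable A S"
  unfolding kappa_separable_def
proof (intro allI impI)
  fix Q assume Q: "primeideal Q S"
  interpret Q: localized_ring Q S unfolding localized_ring_def by (rule Q)
  let ?K = "Q.subfractions A" and ?L = "residue_field S Q"
  note K = Q.subfractions_subfield[OF A]
  obtain G where G: "finite G" "G \<subseteq> carrier S" "generate_ring S (A \<union> G) = carrier S"
    using ft unfolding finite_type_def by auto
  have fd: "Q.L.finite_dimension ?K (carrier ?L)" by (rule Q.finite_dimension_residue_field[OF A int G])
  show "separable_ext (residue_field (S\<lparr>carrier := A\<rparr>) (Q \<inter> A)) ?L (residual_map S Q)"
    unfolding separable_ext_residual_iff[OF is_cring A Q]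
  proof (intro ballI conjI)
    fix x assume x: "x \<in> carrier ?L"
    show alg: "Q.L.algebraic ?K x"
      using Q.L.finite_dimension_imp_algebraic[OF K Q.L.carrier_is_subring fd x] by (simp add: over_def)
    show "Q.L.deriv_eval (Q.L.Irr ?K x) x \<noteq> \<zero>\<^bsub>?L\<^esub>"
    proof
      assume "Q.L.deriv_eval (Q.L.Irr ?K x) x = \<zero>\<^bsub>?L\<^esub>"
      then obtain p M where p: "Factorial_Ring.prime (p::nat)" "add_pow ?L p \<one>\<^bsub>?L\<^esub> = \<zero>\<^bsub>?L\<^esub>"
        and M: "subfield M ?L" "?K \<subseteq> M" "\<And>y. y \<in> carrier ?L \<Longrightarrow> y [^]\<^bsub>?L\<^esub> p \<in> M" "M \<noteq> carrier ?L"
        using Q.L.inseparable_imp_subfield[OF K x alg fd] by metis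
      obtain y0 where y0: "y0 \<in> carrier ?L" "y0 \<notin> M" using M(4) subfieldE(3)[OF M(1)] by auto
      obtain \<theta> where \<theta>: "\<And>z. z \<in> carrier ?L \<Longrightarrow> \<theta> z \<in> carrier ?L"
        and \<theta>_add: "\<And>z w. z \<in> carrier ?L \<Longrightarrow> w \<in> carrier ?L \<Longrightarrow> \<theta> (z \<oplus>\<^bsub>?L\<^esub> w) = \<theta> z \<oplus>\<^bsub>?L\<^esub> \<theta> w"
        and \<theta>_lin: "\<And>m z. m \<in> M \<Longrightarrow> z \<in> carrier ?L \<Longrightarrow> \<theta> (m \<otimes>\<^bsub>?L\<^esub> z) = m \<otimes>\<^bsub>?L\<^esub> \<theta> z"
        and \<theta>1: "\<theta> \<one>\<^bsub>?L\<^esub> = \<zero>\<^bsub>?L\<^esub>" and \<theta>y: "\<theta> y0 = \<one>\<^bsub>?L\<^esub>"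
        using Q.L.exists_functional[OF M(1) y0] by blast
      have Mc: "m \<in> carrier ?L" if "m \<in> M" for m using that subfieldE(3)[OF M(1)] by auto
      have piA: "Q.\<pi> r \<in> M" if "r \<in> A" for r using Q.pi_subfractions[OF A that] M(2) by auto
      have lin': "\<theta> (z \<otimes>\<^bsub>?L\<^esub> m) = \<theta> z \<otimes>\<^bsub>?L\<^esub> m" if "m \<in> M" "z \<in> carrier ?L" for m z
        using \<theta>_lin[OF that] Mc[OF that(1)] that(2) \<theta>[OF that(2)] Q.L.m_comm by simp
      \<comment> \<open>Balancedness over \<open>A\<close> holds because the image of
        \<open>A\<close> lies in \<open>M\<close>, over which \<open>\<theta>\<close> is
        linear.\<close>
      define \<psi> where "\<psi> q = Q.\<pi> (fst q) \<otimes>\<^bsub>?L\<^esub> \<theta> (Q.\<pi> (snd q))" for q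
      interpret bm: balanced_map S A ?L \<psi>
      proof (intro balanced_map.intro balanced_map_axioms.intro tensor_ext_axioms)
        show "abelian_group ?L" by (rule Q.L.is_abelian_group)
        fix r x y assume r: "r \<in> A" and xy: "x \<in> carrier S" "y \<in> carrier S"
        then show "\<psi> (r \<otimes> x, y) = \<psi> (x, r \<otimes> y)"
          unfolding \<psi>_def using A_carr[OF r] \<theta> by (simp add: \<theta>_lin[OF piA[OF r]] Q.L.m_ac)
      qed (unfold \<psi>_def, simp_all add: \<theta> \<theta>_add Q.L.l_distr Q.L.r_distr)
      have p0: "p \<noteq> 0" using p(1) prime_gt_0_nat by auto
      have powS: "Q.\<pi> (g [^] p) \<in> M" if "g \<in> carrier S" for g using M(3)[of "Q.\<pi> g"] that by (simp add: Q.\<pi>.ring.hom_nat_pow)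
      \<comment> \<open>Elements with image in \<open>M\<close> may cross the tensor sign under
        \<open>\<Phi>\<close>. This is the gain from linearity over \<open>M\<close> rather than
        over the base field: p-th powers of all elements of \<open>S\<close> have their image in
        \<open>M\<close>.\<close>
      have swap: "bm.\<Phi> (u \<otimes>\<^bsub>T\<^esub> i1 c) = bm.\<Phi> (u \<otimes>\<^bsub>T\<^esub> i2 c)"
        if u: "u \<in> carrier T" and c: "c \<in> carrier S" and cM: "Q.\<pi> c \<in> M" for u c
        using u
      proof (induction rule: T_induct)
        case zero
        then show ?case using c by simp
      next
        case (tensor a b)
        have "i1 a \<otimes>\<^bsub>T\<^esub> i2 b \<otimes>\<^bsub>T\<^esub> i1 c = i1 (a \<otimes> c) \<otimes>\<^bsub>T\<^esub> i2 b" using tensor c by (simp add: T.m_ac)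
        then have 1: "bm.\<Phi> (i1 a \<otimes>\<^bsub>T\<^esub> i2 b \<otimes>\<^bsub>T\<^esub> i1 c) = \<psi> (a \<otimes> c, b)"
          using bm.lift_tensor[of "a \<otimes> c" b] tensor c by (metis m_closed)
        have "i1 a \<otimes>\<^bsub>T\<^esub> i2 b \<otimes>\<^bsub>T\<^esub> i2 c = i1 a \<otimes>\<^bsub>T\<^esub> i2 (b \<otimes> c)" using tensor c by (simp add: T.m_assoc)
        then have 2: "bm.\<Phi> (i1 a \<otimes>\<^bsub>T\<^esub> i2 b \<otimes>\<^bsub>T\<^esub> i2 c) = \<psi> (a, b \<otimes> c)"
          using bm.lift_tensor[of a "b \<otimes> c"] tensor c by (metis m_closed)
        have "\<psi> (a \<otimes> c, b) = \<psi> (a, b \<otimes> c)"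
          unfolding \<psi>_def using tensor c \<theta> by (simp add: lin'[OF cM] Q.L.m_ac)
        then show ?case using 1 2 by simp
      next
        case (minus v w)
        have cc: "i1 c \<in> carrier T" "i2 c \<in> carrier T" using c by auto
        show ?case
          by (simp only: T.minus_mult_distrib[OF cc(1) minus(1,2)] T.minus_mult_distrib[OF cc(2) minus(1,2)]
            bm.lift_minus[OF T.m_closed[OF minus(1) cc(1)] T.m_closed[OF minus(2) cc(1)]]
            bm.lift_minus[OF T.m_closed[OF minus(1) cc(2)] T.m_closed[OF minus(2) cc(2)]] minus(3,4))
      qed
      have IJ: "I \<subseteq> bm.annihilator"
      proof (rule idempotent_diag_ideal_subset[OF II G bm.annihilator_ideal])
        fix g assume "g \<in> G"
        then have g: "g \<in> carrier S" using G(2) by auto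
        have gc: "i1 g \<in> carrier T" "i2 g \<in> carrier T" using g by auto
        \<comment> \<open>The p-th power of \<open>\<gamma> g\<close> is the difference of the two
          images of \<open>g [^] p\<close>, up to a multiple of \<open>p\<close>.
          \<open>\<Phi>\<close> cannot distinguish the two images, and it sends multiples of
          \<open>p\<close> to zero because its values lie in a field of characteristic
          \<open>p\<close>.\<close>
        obtain z where z: "z \<in> carrier T" and
          e: "(i1 g \<ominus>\<^bsub>T\<^esub> i2 g) [^]\<^bsub>T\<^esub> p = (i1 g [^]\<^bsub>T\<^esub> p \<ominus>\<^bsub>T\<^esub> i2 g [^]\<^bsub>T\<^esub> p) \<ominus>\<^bsub>T\<^esub> add_pow T p z"
          using T.freshman_dream_minus[OF gc p(1)] .
        define c where "c = g [^] p"
        have c: "c \<in> carrier S" "Q.\<pi> c \<in> M" unfolding c_def using g powS by auto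
        have cc: "i1 c \<in> carrier T" "i2 c \<in> carrier T" using c by auto
        have e': "\<gamma> g [^]\<^bsub>T\<^esub> p = (i1 c \<ominus>\<^bsub>T\<^esub> i2 c) \<ominus>\<^bsub>T\<^esub> add_pow T p z"
          using e g unfolding \<gamma>_def c_def by (simp add: i1.ring.hom_nat_pow i2.ring.hom_nat_pow)
        have pz: "add_pow T p z \<in> carrier T" using z by simp
        have "bm.\<Phi> (u \<otimes>\<^bsub>T\<^esub> \<gamma> g [^]\<^bsub>T\<^esub> p) = \<zero>\<^bsub>?L\<^esub>" if u: "u \<in> carrier T" for u
        proof -
          have uz: "u \<otimes>\<^bsub>T\<^esub> z \<in> carrier T" using u z by simp
          have "bm.\<Phi> (u \<otimes>\<^bsub>T\<^esub> add_pow T p z) = add_pow ?L p (bm.\<Phi> (u \<otimes>\<^bsub>T\<^esub> z))"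
            using bm.lift_add_pow[OF uz] T.add_pow_rdistr[OF u z] by simp
          also have "\<dots> = \<zero>\<^bsub>?L\<^esub>"
            using Q.L.add_pow_eq_mult[OF bm.lift_closed[OF uz], of p] bm.lift_closed[OF uz] p(2) by simp
          finally have 1: "bm.\<Phi> (u \<otimes>\<^bsub>T\<^esub> add_pow T p z) = \<zero>\<^bsub>?L\<^esub>" .
          have d: "u \<otimes>\<^bsub>T\<^esub> \<gamma> g [^]\<^bsub>T\<^esub> p = (u \<otimes>\<^bsub>T\<^esub> i1 c \<ominus>\<^bsub>T\<^esub> u \<otimes>\<^bsub>T\<^esub> i2 c) \<ominus>\<^bsub>T\<^esub> u \<otimes>\<^bsub>T\<^esub> add_pow T p z"
            unfolding e' using u cc pz by (simp add: T.mult_minus_distrib)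
          have m: "u \<otimes>\<^bsub>T\<^esub> i1 c \<in> carrier T" "u \<otimes>\<^bsub>T\<^esub> i2 c \<in> carrier T" "u \<otimes>\<^bsub>T\<^esub> add_pow T p z \<in> carrier T"
            using u cc pz by auto
          have "bm.\<Phi> (u \<otimes>\<^bsub>T\<^esub> \<gamma> g [^]\<^bsub>T\<^esub> p) =
              (bm.\<Phi> (u \<otimes>\<^bsub>T\<^esub> i1 c) \<ominus>\<^bsub>?L\<^esub> bm.\<Phi> (u \<otimes>\<^bsub>T\<^esub> i2 c)) \<ominus>\<^bsub>?L\<^esub> \<zero>\<^bsub>?L\<^esub>"
            unfolding d bm.lift_minus[OF T.minus_closed[OF m(1,2)] m(3)] bm.lift_minus[OF m(1,2)] 1 ..
          also have "\<dots> = \<zero>\<^bsub>?L\<^esub>"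
            unfolding swap[OF u c] using bm.lift_closed[OF m(2)] by (simp add: a_minus_def Q.L.r_neg)
          finally show ?thesis .
        qed
        moreover have "\<gamma> g [^]\<^bsub>T\<^esub> p \<in> carrier T" using gamma_closed[OF g] by simp
        ultimately have "\<gamma> g [^]\<^bsub>T\<^esub> p \<in> bm.annihilator" unfolding bm.annihilator_def by simp
        then show "\<exists>k::nat. \<gamma> g [^]\<^bsub>T\<^esub> k \<in> bm.annihilator" by blast
      qed
      \<comment> \<open>Since \<open>\<theta>\<close> vanishes at \<open>\<one>\<close>, the value
        of \<open>\<Phi>\<close> at \<open>\<gamma> s\<close> is minus \<open>\<theta>\<close> of
        the residue class of \<open>s\<close>.\<close>
      have \<theta>0: "\<theta> (Q.\<pi> s) = \<zero>\<^bsub>?L\<^esub>" if s: "s \<in> carrier S" for s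
      proof -
        have sc: "i1 s \<in> carrier T" "i2 s \<in> carrier T" using s by auto
        have "\<gamma> s \<in> bm.annihilator" using gamma_I[OF s] IJ by auto
        then have "bm.\<Phi> (\<one>\<^bsub>T\<^esub> \<otimes>\<^bsub>T\<^esub> \<gamma> s) = \<zero>\<^bsub>?L\<^esub>" unfolding bm.annihilator_def by blast
        then have "bm.\<Phi> (i1 s) \<ominus>\<^bsub>?L\<^esub> bm.\<Phi> (i2 s) = \<zero>\<^bsub>?L\<^esub>"
          using bm.lift_minus[OF sc] gamma_closed[OF s] unfolding \<gamma>_def by simp
        moreover have "bm.\<Phi> (i1 s) = \<psi> (s, \<one>)" using bm.lift_tensor[of s \<one>] s by simp
        moreover have "bm.\<Phi> (i2 s) = \<psi> (\<one>, s)" using bm.lift_tensor[of \<one> s] s by simp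
        ultimately show ?thesis using s \<theta>1 \<theta>[of "Q.\<pi> s"] unfolding \<psi>_def by (simp add: a_minus_def)
      qed
      \<comment> \<open>So far \<open>\<theta>\<close> vanishes only on the image of
        \<open>S\<close>, and \<open>y0\<close> is a fraction \<open>a/t\<close>. The denominator is
        cleared with the p-th power of \<open>t\<close>, because that power has its image in
        \<open>M\<close> and can be taken out of \<open>\<theta>\<close>. As
        \<open>\<theta> y0 = \<one>\<close>, the p-th power would have to be zero in the residue
        field.\<close>
      obtain a t where at: "a \<in> carrier S" "t \<in> Q.den" "y0 = Q.cls a t" using Q.LE[OF y0(1)] .
      have tc: "t \<in> carrier S" "Q.\<pi> t \<noteq> \<zero>\<^bsub>?L\<^esub>"
        using Q.den_carr[OF at(2)] Q.pi_zero_iff Q.den_not[OF at(2)] by auto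
      have ty: "Q.\<pi> t \<otimes>\<^bsub>?L\<^esub> y0 = Q.\<pi> a" using Q.cls_iff[OF at(1,2) y0(1)] at(3) by simp
      obtain k where k: "p = Suc k" using p0 not0_implies_Suc by blast
      have "Q.\<pi> t [^]\<^bsub>?L\<^esub> p \<otimes>\<^bsub>?L\<^esub> y0 = Q.\<pi> t [^]\<^bsub>?L\<^esub> k \<otimes>\<^bsub>?L\<^esub> (Q.\<pi> t \<otimes>\<^bsub>?L\<^esub> y0)"
        unfolding k using tc y0(1) by (simp add: Q.L.m_assoc)
      also have "\<dots> = Q.\<pi> (t [^] k \<otimes> a)" unfolding ty using tc at(1) by (simp add: Q.\<pi>.ring.hom_nat_pow)
      finally have "\<theta> (Q.\<pi> t [^]\<^bsub>?L\<^esub> p \<otimes>\<^bsub>?L\<^esub> y0) = \<zero>\<^bsub>?L\<^esub>" using \<theta>0[of "t [^] k \<otimes> a"] tc at(1) by simp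
      moreover have "Q.\<pi> t [^]\<^bsub>?L\<^esub> p \<in> M" using M(3) tc by simp
      ultimately have "Q.\<pi> t [^]\<^bsub>?L\<^esub> p \<otimes>\<^bsub>?L\<^esub> \<one>\<^bsub>?L\<^esub> = \<zero>\<^bsub>?L\<^esub>" using \<theta>_lin[OF _ y0(1)] \<theta>y by simp
      then have "Q.\<pi> t [^]\<^bsub>?L\<^esub> p = \<zero>\<^bsub>?L\<^esub>" using tc by simp
      moreover have "Q.\<pi> t [^]\<^bsub>?L\<^esub> n \<noteq> \<zero>\<^bsub>?L\<^esub>" for n :: nat
        by (induction n) (use tc Q.L.integral_iff in auto)
      ultimately show False by blast
    qed
  qed
qed

end

theorem corollary4p4:
  fixes S :: "('a, 'b) ring_scheme" and R :: "'a set"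
  assumes "cring S" and "subring R S"
    and "integral_ext R S" and "FCP R S" and "t_closed R S"
  shows "unramified R S \<longleftrightarrow> kappa_separable R S"
proof -
  interpret tensor_ext S R
    by (intro tensor_ext.intro tensor_ext_axioms.intro assms(1,2))
  show ?thesis
    unfolding unramified_def kaehler_trivial_iff
    using unramified_imp_kappa_separable[OF assms(3)] FCP_imp_finite_type[OF assms(1,2,4)]
      kappa_separable_imp_idempotent[OF assms(3-5)]
    by blast
qed

end
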